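(* Let $p$ be an odd prime and $R_p$ the dihedral quandle. For every $n\ge1$, $$\dim_{\mathbf F_p}H^Q_n(R_p;\mathbf F_p)=\dim_{\mathbf F_p}H_Q^n(R_p;\mathbf F_p)$$ is equal to the number of finite sequences $((m_1,e_1),\dots,(m_s,e_s))$ with $s\ge 1$, $m_i\in\{0,1,2,\dots\}$, $e_i\in\{0,1\}$, $(m_i,e_i)\neq(0,0)$ for all $i\ge 2$, and $$(s-1)+\sum_{i=1}^s(2m_i+3e_i)=n-1 .$$
   Context: $R_p$ is the set $\mathbf Z/p$ with operation $a*b=2b-a$. For a quandle $X$, $C^R_n(X)$ is the free abelian group on $X^n$, with boundary $\partial=\sum_{i=1}^n(-1)^i(\partial^0_i-\partial^1_i)$, where $\partial^0_i(x_1,\dots,x_n)=(x_1,\dots,x_{i-1},x_{i+1},\dots,x_n)$ and $\partial^1_i(x_1,\dots,x_n)=(x_1*x_i,\dots,x_{i-1}*x_i,x_{i+1},\dots,x_n)$. The subgroups $C^D_n(X)$ generated by tuples with $x_i=x_{i+1}$ for some $i$ form a subcomplex, and $H^Q_n(X;\mathbf F_p)$, $H_Q^n(X;\mathbf F_p)$ are the homology and cohomology with coefficients in $\mathbf F_p$ of the quotient complex $C^Q_n(X)=C^R_n(X)/C^D_n(X)$. *)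

theory Defs
  imports
    "HOL-Library.Poly_Mapping"
    "HOL-Algebra.AbelCoset"
    "Jordan_Normal_Form.VS_Connect"
    "Berlekamp_Zassenhaus.Finite_Field"
begin

text \<open>
  Modules are records of HOL-Algebra over the type-class ring \<open>class_ring\<close>. The fields
  \<open>monoid.mult\<close> and \<open>one\<close> of these records carry no information for a module; they are filled with
  zero elements.
\<close>

section \<open>Free modules and quotient modules\<close>

definition free_module :: "'b set \<Rightarrow> ('k::comm_ring_1, 'b \<Rightarrow>\<^sub>0 'k) module" where
  "free_module S = \<lparr>carrier = {c. Poly_Mapping.keys c \<subseteq> S},
     monoid.mult = (\<lambda>_ _. 0), one = 0, zero = 0, add = (+),
     module.smult = (\<lambda>a. Poly_Mapping.map ((*) a))\<rparr>"

definition linear_extension ::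
    "('b \<Rightarrow> ('c \<Rightarrow>\<^sub>0 'k::comm_ring_1)) \<Rightarrow> ('b \<Rightarrow>\<^sub>0 'k) \<Rightarrow> ('c \<Rightarrow>\<^sub>0 'k)" where
  "linear_extension f c =
     (\<Sum>b\<in>Poly_Mapping.keys c. Poly_Mapping.map ((*) (Poly_Mapping.lookup c b)) (f b))"

text \<open>Scalars act on a coset \<open>A\<close> of \<open>N\<close> through representatives: \<open>a (v + N) = a v + N\<close>.\<close>

definition quotient_module :: "('k, 'v, 'm) module_scheme \<Rightarrow> 'v set \<Rightarrow> ('k, 'v set) module" where
  "quotient_module M N = \<lparr>carrier = a_rcosets\<^bsub>M\<^esub> N,
     monoid.mult = (\<lambda>_ _. N), one = N, zero = N, add = (<+>\<^bsub>M\<^esub>),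
     module.smult = (\<lambda>a A. \<Union>v\<in>A. N +>\<^bsub>M\<^esub> (a \<odot>\<^bsub>M\<^esub> v))\<rparr>"

section \<open>The rack chain complex and its degenerate part\<close>

text \<open>
  A quandle is given by its operation on a type \<open>'x\<close>, and \<open>X\<^sup>n\<close> consists of the lists of
  length \<open>n\<close>. Chains have coefficients in an arbitrary commutative ring \<open>'k\<close>: for
  \<open>'k = int\<close> this is the integral complex, and in general it is the integral complex
  tensored with \<open>'k\<close>. Positions \<open>i\<close> are counted from 1, as in the usual formulas.
\<close>

definition face0 :: "nat \<Rightarrow> 'x list \<Rightarrow> 'x list" where
  "face0 i xs = take (i - 1) xs @ drop i xs"

definition face1 :: "('x \<Rightarrow> 'x \<Rightarrow> 'x) \<Rightarrow> nat \<Rightarrow> 'x list \<Rightarrow> 'x list" where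
  "face1 op i xs = map (\<lambda>x. op x (xs ! (i - 1))) (take (i - 1) xs) @ drop i xs"

definition rack_boundary ::
    "('x \<Rightarrow> 'x \<Rightarrow> 'x) \<Rightarrow> ('x list \<Rightarrow>\<^sub>0 'k::comm_ring_1) \<Rightarrow> ('x list \<Rightarrow>\<^sub>0 'k)" where
  "rack_boundary op = linear_extension (\<lambda>xs. \<Sum>i = 1..length xs.
     Poly_Mapping.single (face0 i xs) ((- 1) ^ i) - Poly_Mapping.single (face1 op i xs) ((- 1) ^ i))"

definition rack_chains :: "nat \<Rightarrow> ('k::comm_ring_1, 'x list \<Rightarrow>\<^sub>0 'k) module" where
  "rack_chains n = free_module {xs. length xs = n}"

definition degenerate_chains :: "nat \<Rightarrow> ('x list \<Rightarrow>\<^sub>0 'k::comm_ring_1) set" where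
  "degenerate_chains n = LinearCombinations.module.span class_ring (rack_chains n)
     {Poly_Mapping.single xs 1 |xs. length xs = n \<and> (\<exists>i. Suc i < n \<and> xs ! i = xs ! Suc i)}"

section \<open>Quandle homology and cohomology\<close>

definition quandle_chains :: "nat \<Rightarrow> ('k::comm_ring_1, ('x list \<Rightarrow>\<^sub>0 'k) set) module" where
  "quandle_chains n = quotient_module (rack_chains n) (degenerate_chains n)"

text \<open>
  The map induced on cosets, from degree \<open>n\<close> to degree \<open>n - 1\<close>. In degree 0 the sum
  defining \<^const>\<open>rack_boundary\<close> is empty, so the map is zero there and the truncated
  subtraction is harmless.
\<close>

definition quandle_boundary ::
    "('x \<Rightarrow> 'x \<Rightarrow> 'x) \<Rightarrow> nat \<Rightarrow> ('x list \<Rightarrow>\<^sub>0 'k::comm_ring_1) set \<Rightarrow> ('x list \<Rightarrow>\<^sub>0 'k) set" where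
  "quandle_boundary op n A =
     (\<Union>c\<in>A. degenerate_chains (n - 1) +>\<^bsub>rack_chains (n - 1)\<^esub> rack_boundary op c)"

definition quandle_cycles ::
    "('x \<Rightarrow> 'x \<Rightarrow> 'x) \<Rightarrow> nat \<Rightarrow> ('x list \<Rightarrow>\<^sub>0 'k::comm_ring_1) set set" where
  "quandle_cycles op n =
     {A \<in> carrier (quandle_chains n). quandle_boundary op n A = \<zero>\<^bsub>quandle_chains (n - 1)\<^esub>}"

definition quandle_boundaries ::
    "('x \<Rightarrow> 'x \<Rightarrow> 'x) \<Rightarrow> nat \<Rightarrow> ('x list \<Rightarrow>\<^sub>0 'k::comm_ring_1) set set" where
  "quandle_boundaries op n =
     quandle_boundary op (Suc n) ` carrier (quandle_chains (Suc n))"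

definition quandle_homology ::
    "('x \<Rightarrow> 'x \<Rightarrow> 'x) \<Rightarrow> nat \<Rightarrow> ('k::comm_ring_1, ('x list \<Rightarrow>\<^sub>0 'k) set set) module" where
  "quandle_homology op n =
     quotient_module (quandle_chains n\<lparr>carrier := quandle_cycles op n\<rparr>) (quandle_boundaries op n)"

text \<open>
  Cochains are the additive maps from the integral quandle chain group to \<open>'k\<close>, made
  extensional so that they are determined by their values on the chain group.
\<close>

definition quandle_cochains ::
    "nat \<Rightarrow> ('k::comm_ring_1, ('x list \<Rightarrow>\<^sub>0 int) set \<Rightarrow> 'k) module" where
  "quandle_cochains n =
     (let C = quandle_chains n in
      \<lparr>carrier = hom (add_monoid C) (add_monoid class_ring) \<inter> extensional (carrier C),
       monoid.mult = (\<lambda>_ _. \<lambda>A\<in>carrier C. 0), one = (\<lambda>A\<in>carrier C. 0), zero = (\<lambda>A\<in>carrier C. 0),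
       add = (\<lambda>\<phi> \<psi>. \<lambda>A\<in>carrier C. \<phi> A + \<psi> A),
       module.smult = (\<lambda>a \<phi>. \<lambda>A\<in>carrier C. a * \<phi> A)\<rparr>)"

text \<open>The map from degree \<open>n - 1\<close> to degree \<open>n\<close>; it is zero for \<open>n = 0\<close>.\<close>

definition quandle_coboundary ::
    "('x \<Rightarrow> 'x \<Rightarrow> 'x) \<Rightarrow> nat \<Rightarrow> (('x list \<Rightarrow>\<^sub>0 int) set \<Rightarrow> 'k::comm_ring_1)
      \<Rightarrow> (('x list \<Rightarrow>\<^sub>0 int) set \<Rightarrow> 'k)" where
  "quandle_coboundary op n \<phi> =
     (\<lambda>A\<in>carrier (quandle_chains n). \<phi> (quandle_boundary op n A))"

definition quandle_cocycles ::
    "('x \<Rightarrow> 'x \<Rightarrow> 'x) \<Rightarrow> nat \<Rightarrow> (('x list \<Rightarrow>\<^sub>0 int) set \<Rightarrow> 'k::comm_ring_1) set" where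
  "quandle_cocycles op n =
     {\<phi> \<in> carrier (quandle_cochains n).
        quandle_coboundary op (Suc n) \<phi> = \<zero>\<^bsub>quandle_cochains (Suc n)\<^esub>}"

definition quandle_coboundaries ::
    "('x \<Rightarrow> 'x \<Rightarrow> 'x) \<Rightarrow> nat \<Rightarrow> (('x list \<Rightarrow>\<^sub>0 int) set \<Rightarrow> 'k::comm_ring_1) set" where
  "quandle_coboundaries op n =
     quandle_coboundary op n ` carrier (quandle_cochains (n - 1))"

definition quandle_cohomology ::
    "('x \<Rightarrow> 'x \<Rightarrow> 'x) \<Rightarrow> nat
      \<Rightarrow> ('k::comm_ring_1, (('x list \<Rightarrow>\<^sub>0 int) set \<Rightarrow> 'k) set) module" where
  "quandle_cohomology op n =
     quotient_module (quandle_cochains n\<lparr>carrier := quandle_cocycles op n\<rparr>)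
       (quandle_coboundaries op n)"

section \<open>Dihedral quandles and the counted sequences\<close>

text \<open>
  For \<open>'p\<close> of prime cardinality \<open>p\<close>, the type \<open>'p mod_ring\<close> is \<open>\<int>/p\<close>. It serves both as
  the underlying set of the dihedral quandle \<open>R\<^sub>p\<close> and as the coefficient field.
\<close>

definition dihedral_op :: "'p::nontriv mod_ring \<Rightarrow> 'p mod_ring \<Rightarrow> 'p mod_ring" where
  "dihedral_op a b = 2 * b - a"

definition dihedral_sequences :: "nat \<Rightarrow> (nat \<times> nat) list set" where
  "dihedral_sequences n =
     {l. length l \<ge> 1 \<and> (\<forall>(m, e)\<in>set l. e \<in> {0, 1}) \<and>
         (\<forall>i. 1 \<le> i \<and> i < length l \<longrightarrow> l ! i \<noteq> (0, 0)) \<and>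
         (length l - 1) + (\<Sum>(m, e)\<leftarrow>l. 2 * m + 3 * e) = n - 1}"

end

theory Submission
  imports Defs
begin

text \<open>
  Write \<open>k\<close> for the field with \<open>p\<close> elements. In the coordinates \<open>u_i = x_i - x_(i+1)\<close> and \<open>u_n = x_n\<close> the chains
  of degree \<open>n\<close> are the \<open>n\<close>-th tensor power of the group algebra of the additive group of \<open>k\<close>. The first family
  of faces multiplies two neighbouring factors; the second one does the same after inverting all group elements
  up to the first of the two. The group algebra over \<open>k\<close> is \<open>k[w] / (w ^ p)\<close>, with a generator \<open>w\<close> that
  inversion negates. In the basis of monomials, with the divided powers of the coordinates as dual functions, the
  quandle complex is therefore combinatorial: its basis consists of the lists of exponents below \<open>p\<close> all of
  whose entries except possibly the last are positive, and up to sign the boundary is twice the alternating sum of all merges of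
  neighbours \<open>a_i, a_(i+1)\<close> for which \<open>a_1 + \<dots> + a_i\<close> is odd and \<open>a_i + a_(i+1) < p\<close>. The passage to this basis is
  \<open>diff_cob_phi\<close> with \<open>twisted_cob_diff\<close>, \<open>sum_face\<close> and the inversion formulas \<open>phi_psi\<close> and \<open>psi_phi\<close>.

  Even partial sums are never removed, and between two of them the complex resembles the bar complex of a truncated
  polynomial algebra, with homology of rank at most one in every internal degree. The contraction splits off \<open>1\<close> from an entry at an even
  position and \<open>2\<close> from an entry at an odd one. It retracts the complex onto the span of the critical cells, in which
  no merge is possible (\<open>homotopy\<close>, \<open>aug_cob_crit\<close>, \<open>aug_cob_retraction\<close>). A critical cell is a concatenation
  of blocks \<open>1, p - 1, 2, p - 1, 2, \<dots>\<close>, each ending with \<open>1\<close> or \<open>p - 2\<close> at an even partial sum, and possibly a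
  final \<open>0\<close>. There is one block of each length at least \<open>3\<close>; reading a block of length \<open>1 + 2m + 3e\<close> as the pair
  \<open>(m, e)\<close>, the final \<open>0\<close> as \<open>(0, 0)\<close>, and reversing the order gives the counted sequences. The numbers are
  compared through their recursion in \<open>card_rseqs_critical_cells\<close>.

  All operators are written on functions, that is, as transposes. The homotopy thus gives cohomology at once: classes
  have their values on the critical cells as coordinates. For homology the same identity is paired with chains, and
  the coordinates are the pairings with the cocycles dual to the critical cells.
\<close>


section \<open>The complex of merges of cells\<close>

text \<open>
  The transpose of the boundary in the monomial basis, divided by \<open>2\<close> up to sign. A list stands for the
  monomial with these exponents, \<open>od\<close> says whether the exponents to its left have odd sum, and the merge of
  two neighbours survives exactly if the sum up to the first of them is odd and the result is below \<open>p\<close>.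
  Working with functions on cells instead of linear combinations of cells makes every operator an explicit
  pointwise formula.
\<close>

fun merge_cob :: "nat \<Rightarrow> bool \<Rightarrow> (nat list \<Rightarrow> 'k::ab_group_add) \<Rightarrow> nat list \<Rightarrow> 'k" where
  "merge_cob p od G (a # b # r) =
     - (if odd a \<noteq> od \<and> a + b < p then G ((a + b) # r) else 0)
     - merge_cob p (odd a \<noteq> od) (\<lambda>l. G (a # l)) (b # r)"
| "merge_cob p od G [a] = 0"
| "merge_cob p od G [] = 0"

text \<open>
  After an entry \<open>p - 1\<close> at whose end the partial sum is odd, the only possible merge with the next entry is
  with a final \<open>0\<close>. The remaining entries thus form a complex of their own in which \<open>[0]\<close> has the empty list
  as an additional boundary.
\<close>

definition aug_cob :: "nat \<Rightarrow> bool \<Rightarrow> (nat list \<Rightarrow> 'k::ab_group_add) \<Rightarrow> nat list \<Rightarrow> 'k" where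
  "aug_cob p od G l = merge_cob p od G l + (if od \<and> l = [0] then G [] else 0)"

text \<open>
  A last entry \<open>0\<close> is allowed because equality of neighbours imposes no condition on the last coordinate.
\<close>

fun cell :: "nat \<Rightarrow> nat list \<Rightarrow> bool" where
  "cell p (a # b # r) = (1 \<le> a \<and> a < p \<and> cell p (b # r))"
| "cell p [a] = (a < p)"
| "cell p [] = True"

lemma merge_cob_cong:
  assumes "\<And>l'. length l' + 1 = length l \<Longrightarrow> l' \<noteq> [] \<Longrightarrow> G l' = G' l'"
  shows "merge_cob p od G l = merge_cob p od G' l"
  using assms
proof (induction p od G l arbitrary: G' rule: merge_cob.induct)
  case (1 p od G a b r)
  have "merge_cob p (odd a \<noteq> od) (\<lambda>l. G (a # l)) (b # r) = merge_cob p (odd a \<noteq> od) (\<lambda>l. G' (a # l)) (b # r)"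
    by (rule "1.IH") (use "1.prems" in auto)
  with "1.prems" show ?case by auto
qed auto

lemma merge_cob_zero [simp]: "merge_cob p od (\<lambda>l. 0) l = 0"
  by (induction p od "\<lambda>l::nat list. 0::'k::ab_group_add" l rule: merge_cob.induct) auto

lemma merge_cob_add: "merge_cob p od (\<lambda>l. G l + G' l) l = merge_cob p od G l + merge_cob p od G' l"
proof (induction p od G l arbitrary: G' rule: merge_cob.induct)
  case (1 p od G a b r)
  show ?case unfolding merge_cob.simps "1.IH" by simp
qed simp_all

lemma merge_cob_uminus: "merge_cob p od (\<lambda>l. - G l) l = - merge_cob p od G l"
  by (induction p od G l rule: merge_cob.induct) auto

lemma aug_cob_add: "aug_cob p od (\<lambda>l. G l + G' l) l = aug_cob p od G l + aug_cob p od G' l"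
  and aug_cob_uminus: "aug_cob p od (\<lambda>l. - G l) l = - aug_cob p od G l"
  by (auto simp: aug_cob_def merge_cob_add merge_cob_uminus)

text \<open>
  Splitting \<open>1\<close> off an entry at an even position, and \<open>2\<close> off one at an odd position, creates a cut that the
  boundary removes again. These are the first approximations of the contraction. The value of \<open>split2\<close> at the
  empty list inverts the augmentation.
\<close>

fun split1 :: "(nat list \<Rightarrow> 'k::ab_group_add) \<Rightarrow> nat list \<Rightarrow> 'k" where
  "split1 G [] = 0"
| "split1 G (a # r) = (if 1 < a \<or> a = 1 \<and> r = [] then - G (1 # (a - 1) # r) else 0)"

fun split2 :: "(nat list \<Rightarrow> 'k::ab_group_add) \<Rightarrow> nat list \<Rightarrow> 'k" where
  "split2 G [] = G [0]"
| "split2 G (a # r) = (if 2 < a \<or> a = 2 \<and> r = [] then - G (2 # (a - 2) # r) else 0)"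

text \<open>
  Transposes of the projections that recognise an initial entry \<open>1\<close>, or an initial pair of given sum, and
  keep the rest of the cell.
\<close>

fun after_one :: "(nat list \<Rightarrow> 'k::ab_group_add) \<Rightarrow> nat list \<Rightarrow> 'k" where
  "after_one Y (a # r) = (if a = 1 then Y r else 0)"
| "after_one Y [] = 0"

fun after_pair :: "bool \<Rightarrow> nat \<Rightarrow> (nat list \<Rightarrow> 'k::ab_group_add) \<Rightarrow> nat list \<Rightarrow> 'k" where
  "after_pair od s Y (a # b # r) = (if odd a = od \<and> a + b = s then Y r else 0)"
| "after_pair od s Y _ = 0"

lemma cell_Cons: "cell p (a # r) \<Longrightarrow> cell p r \<and> a < p \<and> (r \<noteq> [] \<longrightarrow> 1 \<le> a)"
  by (cases r) auto

lemma aug_cob_after_one: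
  assumes "cell p l"
  shows "aug_cob p True (after_one Y) l = - after_one (aug_cob p False Y) l"
proof -
  consider "l = []" | a where "l = [a]" | a b r where "l = a # b # r"
    by (cases l rule: remdups_adj.cases) auto
  then show ?thesis
  proof cases
    case 3
    have "merge_cob p (odd a \<noteq> True) (\<lambda>l. after_one Y (a # l)) (b # r)
      = (if a = 1 then merge_cob p False Y (b # r) else 0)"
      by auto
    with 3 assms show ?thesis by (auto simp: aug_cob_def dest!: cell_Cons)
  qed (auto simp: aug_cob_def)
qed

lemma merge_cob_hd_eq:
  "merge_cob p od (\<lambda>l. case l of [] \<Rightarrow> 0 | b # r \<Rightarrow> if b = m then Y r else 0) (b # c # r) =
     - (if odd b \<noteq> od \<and> b + c < p \<and> b + c = m then Y r else 0)
     - (if b = m then merge_cob p (odd b \<noteq> od) Y (c # r) else 0)"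
  by (auto simp: )

lemma merge_cob_if: "merge_cob p q (\<lambda>l. if A then Y l else 0) x = (if A then merge_cob p q Y x else 0)"
  by auto

text \<open>
  A merge leaves the other partial sums unchanged, and if three entries add up to less than \<open>p\<close> they can be merged
  in either order. So two merges commute and the terms cancel in pairs, as in a bar complex.
\<close>

lemma merge_cob_merge_cob: "merge_cob p od (merge_cob p od G) l = 0"
proof (induction "length l" arbitrary: l od G rule: less_induct)
  case less
  consider "l = []" | a where "l = [a]" | a b where "l = [a, b]" | a b c r where "l = a # b # c # r"
    by (metis list.exhaust)
  then show ?case
  proof cases
    case 4
    define q where "q \<longleftrightarrow> (odd a \<noteq> od)"
    define q' where "q' \<longleftrightarrow> (odd b \<noteq> q)"
    have q'': "(odd (a + b) \<noteq> od) = q'" unfolding q_def q'_def by auto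
    define M where "M = (\<lambda>l. case l of [] \<Rightarrow> 0 | c # l' \<Rightarrow> if q \<and> a + c < p then G ((a + c) # l') else 0)"
    have inner: "merge_cob p q (\<lambda>l. merge_cob p od G (a # l)) (b # c # r)
      = merge_cob p q (\<lambda>l. - M l + - merge_cob p q (\<lambda>l. G (a # l)) l) (b # c # r)"
      by (rule merge_cob_cong) (auto simp: M_def q_def neq_Nil_conv)
    also have "\<dots> = - merge_cob p q M (b # c # r)"
      unfolding merge_cob_add merge_cob_uminus using less(1)[of "b # c # r" q "\<lambda>l. G (a # l)"] 4 by simp
    also have "merge_cob p q M (b # c # r) = - (if q' \<and> b + c < p then M ((b + c) # r) else 0)
        - (if q \<and> a + b < p then merge_cob p q' (\<lambda>l. G ((a + b) # l)) (c # r) else 0)"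
    proof -
      have "(\<lambda>l. M (b # l)) = (\<lambda>l. if q \<and> a + b < p then G ((a + b) # l) else 0)"
        by (simp add: M_def)
      then show ?thesis unfolding merge_cob.simps(1)[of p q M] q'_def[symmetric] by (simp only: merge_cob_if)
    qed
    finally have 1: "merge_cob p q (\<lambda>l. merge_cob p od G (a # l)) (b # c # r)
      = (if q \<and> q' \<and> a + b + c < p then G ((a + b + c) # r) else 0)
        + (if q \<and> a + b < p then merge_cob p q' (\<lambda>l. G ((a + b) # l)) (c # r) else 0)"
      by (auto simp: M_def add.assoc)
    have 2: "merge_cob p od G ((a + b) # c # r) = - (if q' \<and> a + b + c < p then G ((a + b + c) # r) else 0)
        - merge_cob p q' (\<lambda>l. G ((a + b) # l)) (c # r)"
      unfolding merge_cob.simps(1)[of p od G "a + b"] q'' ..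
    show ?thesis
      unfolding 4 merge_cob.simps(1)[of p od _ a] q_def[symmetric] 1 2 by auto
  qed auto
qed

text \<open>
  The projection is a chain map. For a cell \<open>a # b # c # r\<close> with \<open>a + b + c = s\<close>, the merge of the first two
  entries and that of the next two give the same rest with opposite signs, and one is allowed if the other is,
  except for a final \<open>c = 0\<close>: there \<open>a + b = s\<close> already, and the merge of \<open>b\<close> with \<open>0\<close> is the augmentation of
  the rest.
\<close>

lemma aug_cob_after_pair:
  fixes Y :: "nat list \<Rightarrow> 'k::ab_group_add"
  assumes "cell p l" and s: "s = p \<or> s = p + 1 \<and> \<not> od'" and p: "odd p" and "od' \<noteq> od"
  shows "aug_cob p od (after_pair od' s Y) l = after_pair od' s (aug_cob p (od \<noteq> odd s) Y) l"
proof -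
  consider "l = []" | a where "l = [a]" | a b where "l = [a, b]" | a b c r where "l = a # b # c # r"
    by (metis list.exhaust)
  then show ?thesis
  proof cases
    case 1
    then show ?thesis by (simp add: aug_cob_def)
  next
    case (2 a)
    then show ?thesis by (simp add: aug_cob_def)
  next
    case (3 a b)
    then show ?thesis by (simp add: aug_cob_def)
  next
    case 4
    have *: "(\<lambda>l. after_pair od' s Y (a # l)) =
      (\<lambda>l. if odd a = od' \<and> a \<le> s then (case l of [] \<Rightarrow> 0 | b # r \<Rightarrow> if b = s - a then Y r else 0) else 0)"
      by (auto simp: fun_eq_iff split: list.splits)
    from assms(1) 4 have bounds: "1 \<le> a" "a < p" "1 \<le> b" "b < p" "c < p" "1 \<le> c \<or> r = []"
      by (auto dest!: cell_Cons)
    show ?thesis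
    proof (cases "odd a = od'")
      case False
      with \<open>od' \<noteq> od\<close> have "(odd a \<noteq> od) = False" by auto
      with False show ?thesis unfolding 4 aug_cob_def merge_cob.simps(1)[of _ _ _ a] * merge_cob_if by simp
    next
      case True
      then have od: "(odd a \<noteq> od) = True" "od = (\<not> od')" using \<open>od' \<noteq> od\<close> by auto
      define X1 X2 X3 X4 where X: "X1 \<longleftrightarrow> a + b < p \<and> odd (a + b) = od' \<and> a + b + c = s"
        "X2 \<longleftrightarrow> a \<le> s \<and> even b \<and> b + c < p \<and> b + c = s - a"
        "X3 \<longleftrightarrow> a + b = s" "X4 \<longleftrightarrow> (od \<noteq> odd s) \<and> c = 0"
      have s_le: "s \<le> p \<or> s \<le> p + 1 \<and> even a" using s True by auto
      have "2 \<le> a" if "even a" using that bounds(1) by (cases "a = 1") auto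
      then have "b + c < p" if "a + b + c = s" using that s_le bounds(1) by auto
      then have X2: "X2 \<longleftrightarrow> even b \<and> a + b + c = s" unfolding X by auto
      have X1: "X1 \<longleftrightarrow> a + b < p \<and> even b \<and> a + b + c = s"
        using True unfolding X by auto
      have X34: "X3 \<and> X4 \<longleftrightarrow> even b \<and> a + b = s \<and> c = 0"
        using True od unfolding X by auto
      have "a + b < p" if "even b" "a + b + c = s" "c \<noteq> 0"
      proof (rule ccontr)
        assume "\<not> a + b < p"
        with that s have "a + b = p" "s = p + 1 \<and> \<not> od'" by auto
        with that p True show False by (metis even_add)
      qed
      then have e1: "X2 \<longleftrightarrow> X1 \<or> X3 \<and> X4" unfolding X1 X2 X34 by (cases "c = 0") auto
      have e2: "\<not> (X1 \<and> X3 \<and> X4)"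
        unfolding X using s by auto
      have l: "aug_cob p od (after_pair od' s Y) l = - (if X1 then Y r else 0) + (if X2 then Y r else 0)
         + (if X3 then merge_cob p (even b) Y (c # r) else 0)"
      proof -
        have "a \<le> s" using bounds s by auto
        have m1: "(if True \<and> a + b < p then after_pair od' s Y ((a + b) # c # r) else 0) = (if X1 then Y r else 0)"
          unfolding X by (simp only: after_pair.simps) simp
        have m2: "even b \<and> b + c < p \<and> b + c = s - a \<longleftrightarrow> X2" "b = s - a \<longleftrightarrow> X3" "(odd b \<noteq> True) = even b"
          unfolding X using \<open>a \<le> s\<close> by auto
        show ?thesis
          unfolding 4 aug_cob_def merge_cob.simps(1)[of _ _ _ a] * merge_cob_if merge_cob_hd_eq od(1) m1 m2
          by (simp only: True \<open>a \<le> s\<close> simp_thms if_True) simp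
      qed
      have "even b = (od \<noteq> odd s)" if X3
      proof -
        have "odd s = (odd a \<noteq> odd b)" using that unfolding X by (metis even_add)
        with True od(2) show ?thesis by blast
      qed
      then have r: "after_pair od' s (aug_cob p (od \<noteq> odd s) Y) l
        = (if X3 then merge_cob p (even b) Y (c # r) + (if X4 then Y [] else 0) else 0)"
        using True bounds unfolding 4 aug_cob_def X by auto
      have "X4 \<Longrightarrow> r = []" using bounds unfolding X by auto
      then show ?thesis unfolding l r using e1 e2 by auto
    qed
  qed
qed

text \<open>
  Splitting before or after merging the first two entries \<open>a\<close> and \<open>b\<close> gives the same result unless
  \<open>a + b = p\<close>, where only the merge after splitting is below \<open>p\<close>; this leaves the projection to the cells
  beginning with \<open>1, p - 1\<close>.
\<close>

lemma aug_cob_split1: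
  assumes "cell p l" "odd p"
  shows "aug_cob p False (split1 G) l + split1 (aug_cob p False G) l
    = G l - after_pair True p (\<lambda>r. G (1 # (p - 1) # r)) l - (if l = [] \<or> l = [0] then G l else 0)"
proof -
  consider "l = []" | a where "l = [a]" | a b r where "l = a # b # r"
    by (cases l rule: remdups_adj.cases) auto
  then show ?thesis
  proof cases
    case 1
    then show ?thesis by (simp add: aug_cob_def)
  next
    case (2 a)
    with assms show ?thesis by (auto simp add: aug_cob_def)
  next
    case (3 a b r)
    with assms have bounds: "1 \<le> a" "a < p" "b < p" "1 \<le> b \<or> r = []"
      by (auto dest!: cell_Cons)
    have *: "merge_cob p od (\<lambda>l. split1 G (a # l)) (b # r) = (if 1 < a then - merge_cob p od (\<lambda>l. G (1 # (a - 1) # l)) (b # r) else 0)" for od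
      unfolding merge_cob_uminus[symmetric] merge_cob_if[symmetric] by (rule merge_cob_cong) auto
    have **: "merge_cob p od (\<lambda>l. split1 G (a # l)) (b # r) = 0" if "a = 1" for od
      unfolding * using that by simp
    show ?thesis unfolding 3 aug_cob_def merge_cob.simps(1)[of _ _ _ a] *
      using bounds assms(2) by (cases "a = 1") (auto simp: algebra_simps)
  qed
qed

text \<open>
  As splitting off \<open>2\<close> lowers the entry by two, both sums \<open>p\<close> and \<open>p + 1\<close> give a defect, and an entry \<open>1\<close>
  cannot be split at all.
\<close>

lemma aug_cob_split2:
  assumes "cell p l" "odd p" "1 < p"
  shows "aug_cob p True (split2 G) l + split2 (aug_cob p True G) l
    = G l - after_pair False p (\<lambda>r. G (2 # (p - 2) # r)) l
          - after_pair False (p + 1) (\<lambda>r. G (2 # (p - 1) # r)) l - after_one (\<lambda>r. G (1 # r)) l"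
proof -
  consider "l = []" | a where "l = [a]" | a b r where "l = a # b # r"
    by (cases l rule: remdups_adj.cases) auto
  then show ?thesis
  proof cases
    case 1
    then show ?thesis by (simp add: aug_cob_def)
  next
    case (2 a)
    have "2 < a \<Longrightarrow> Suc (Suc (a - 2)) = a" "\<not> 2 < a \<Longrightarrow> a = 0 \<or> a = 1 \<or> a = 2" by arith+
    with 2 assms show ?thesis by (auto simp add: aug_cob_def)
  next
    case (3 a b r)
    with assms have bounds: "1 \<le> a" "a < p" "b < p" "1 \<le> b \<or> r = []"
      by (auto dest!: cell_Cons)
    have *: "merge_cob p od (\<lambda>l. split2 G (a # l)) (b # r) = (if 2 < a then - merge_cob p od (\<lambda>l. G (2 # (a - 2) # l)) (b # r) else 0)" for od
      unfolding merge_cob_uminus[symmetric] merge_cob_if[symmetric] by (rule merge_cob_cong) auto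
    have "2 < a \<Longrightarrow> Suc (Suc (a - 2)) = a" by simp
    consider "a = 1" | "a = 2" | "2 < a" using bounds by linarith
    then show ?thesis 
    proof cases
      case 1
      then show ?thesis unfolding 3 aug_cob_def merge_cob.simps(1)[of _ _ _ a] *
        using bounds assms by (auto simp: algebra_simps)
    next
      case 2
      have "p - Suc 0 = b" if "Suc (Suc b) \<noteq> p" "\<not> Suc (Suc b) < p" using that bounds by simp
      with 2 show ?thesis unfolding 3 aug_cob_def merge_cob.simps(1)[of _ _ _ a] *
        using bounds assms(2,3) by (auto simp: algebra_simps)
    next
      case 3
      then show ?thesis unfolding \<open>l = a # b # r\<close> aug_cob_def merge_cob.simps(1)[of _ _ _ a] *
        using bounds assms(2,3) \<open>2 < a \<Longrightarrow> Suc (Suc (a - 2)) = a\<close> by (auto simp: algebra_simps)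
    qed
  qed
qed

section \<open>Functionals represented by finite chains\<close>

text \<open>
  Representability by coefficients on \<open>S\<close> is what makes an operator on functions the transpose of an operator
  on chains. It lets one identity between operators on functions serve for homology and cohomology alike.
\<close>

definition functional :: "'a set \<Rightarrow> (('a \<Rightarrow> 'k::comm_ring_1) \<Rightarrow> 'k) \<Rightarrow> bool" where
  "functional S L \<longleftrightarrow> (\<exists>c. \<forall>G. L G = (\<Sum>x\<in>S. c x * G x))"

lemma functional_zero [simp]: "functional S (\<lambda>G. 0)"
  unfolding functional_def by (rule exI[of _ "\<lambda>_. 0"]) simp

lemma functional_add: "functional S L \<Longrightarrow> functional S M \<Longrightarrow> functional S (\<lambda>G. L G + M G)"
  unfolding functional_def
  by (elim exE, rule_tac x = "\<lambda>x. c x + ca x" in exI) (simp add: sum.distrib distrib_right)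

lemma functional_mult: "functional S L \<Longrightarrow> functional S (\<lambda>G. a * L G)"
  unfolding functional_def
  by (elim exE, rule_tac x = "\<lambda>x. a * c x" in exI) (simp add: sum_distrib_left mult.assoc)

lemma functional_uminus: "functional S L \<Longrightarrow> functional S (\<lambda>G. - L G)"
  using functional_mult[of S L "- 1"] by simp

lemma functional_sum:
  "(\<And>i. i \<in> I \<Longrightarrow> functional S (L i)) \<Longrightarrow> functional S (\<lambda>G. \<Sum>i\<in>I. L i G)"
  by (induction I rule: infinite_finite_induct) (simp_all add: functional_add)

lemma functional_if:
  "(A \<Longrightarrow> functional S L) \<Longrightarrow> functional S (\<lambda>G. if A then L G else 0)"
  by (cases A) simp_all

lemma functional_point: "finite S \<Longrightarrow> x \<in> S \<Longrightarrow> functional S (\<lambda>G. G x)"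
  unfolding functional_def
  by (rule exI[of _ "\<lambda>y. if y = x then 1 else 0"]) (simp add: if_distrib[of "\<lambda>c. c * _"] cong: if_cong)

lemma functional_comp:
  assumes "functional S L" "f ` S \<subseteq> T" "finite S" "finite T"
  shows "functional T (\<lambda>G. L (\<lambda>x. G (f x)))"
proof -
  from assms(1) obtain c where "\<And>G. L G = (\<Sum>x\<in>S. c x * G x)" unfolding functional_def by blast
  moreover have "functional T (\<lambda>G. \<Sum>x\<in>S. c x * G (f x))"
    by (intro functional_sum functional_mult functional_point) (use assms in auto)
  ultimately show ?thesis by simp
qed

lemma functional_cong:
  assumes "functional S L" "\<And>x. x \<in> S \<Longrightarrow> G x = G' x"
  shows "L G = L G'"
proof -
  from assms(1) obtain c where "\<And>G. L G = (\<Sum>x\<in>S. c x * G x)" unfolding functional_def by blast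
  with assms(2) show ?thesis by simp
qed

lemma functional_expand:
  assumes "functional S L" "finite S"
  shows "L G = (\<Sum>x\<in>S. G x * L (\<lambda>y. if y = x then 1 else 0))"
proof -
  from assms(1) obtain c where c: "\<And>G. L G = (\<Sum>x\<in>S. c x * G x)" unfolding functional_def by blast
  show ?thesis unfolding c
    by (rule sum.cong) (use assms(2) in \<open>simp_all add: mult.commute if_distrib[of "\<lambda>c. _ * c"] cong: if_cong\<close>)
qed

lemma functional_uminus_arg: "functional S L \<Longrightarrow> L (\<lambda>x. - G x) = - L G"
  unfolding functional_def by (auto simp: sum_negf)

lemma functional_sum_arg:
  assumes "functional S L"
  shows "L (\<lambda>x. \<Sum>i\<in>I. c i * G i x) = (\<Sum>i\<in>I. c i * L (G i))"
proof -
  from assms obtain d where d: "\<And>G. L G = (\<Sum>x\<in>S. d x * G x)" unfolding functional_def by blast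
  show ?thesis unfolding d sum_distrib_left
    by (subst sum.swap) (simp add: mult.left_commute)
qed

lemma functional_add_arg: "functional S L \<Longrightarrow> L (\<lambda>x. G x + G' x) = L G + L G'"
  unfolding functional_def by (auto simp: sum.distrib distrib_left)

lemma functional_mult_arg: "functional S L \<Longrightarrow> L (\<lambda>x. a * G x) = a * L G"
  unfolding functional_def by (auto simp: sum_distrib_left mult.left_commute)

lemma functional_diff_arg: "functional S L \<Longrightarrow> L (\<lambda>x. G x - G' x) = L G - L G'"
  unfolding functional_def by (auto simp: sum_subtractf right_diff_distrib)

lemma functional_bind:
  assumes "functional S L" "\<And>x. x \<in> S \<Longrightarrow> functional T (\<lambda>F. M F x)"
  shows "functional T (\<lambda>F. L (M F))"
proof -
  from assms(1) obtain c where "\<And>G. L G = (\<Sum>x\<in>S. c x * G x)" unfolding functional_def by blast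
  moreover have "functional T (\<lambda>F. \<Sum>x\<in>S. c x * M F x)"
    by (intro functional_sum functional_mult assms(2))
  ultimately show ?thesis by simp
qed

lemma functional_zero_arg: "functional S L \<Longrightarrow> L (\<lambda>x. 0) = 0"
  unfolding functional_def by auto

section \<open>The contraction onto critical cells\<close>

definition cells :: "nat \<Rightarrow> nat \<Rightarrow> nat list set" where
  "cells p n = {l. length l = n \<and> cell p l}"

lemma cell_bound: "cell p l \<Longrightarrow> set l \<subseteq> {..<p}"
  by (induction p l rule: cell.induct) auto

lemma finite_cells [simp]: "finite (cells p n)"
  by (rule finite_subset[OF _ finite_lists_length_eq[of "{..<p}" n]])
    (use cell_bound in \<open>auto simp: cells_def\<close>)

text \<open>
  The contraction of the cells with odd (\<open>True\<close>) or even (\<open>False\<close>) initial position: the splitting, corrected on the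
  cells with prefix \<open>1, p - 1\<close>, respectively \<open>1\<close>, \<open>2, p - 2\<close> and \<open>2, p - 1\<close>, by the contraction of the rest.
  A prefix of one entry brings in a sign.
\<close>

fun contraction :: "nat \<Rightarrow> bool \<Rightarrow> (nat list \<Rightarrow> 'k::comm_ring_1) \<Rightarrow> nat list \<Rightarrow> 'k" where
  "contraction p False G (a # b # r) = split1 G (a # b # r)
     + (if odd a \<and> a + b = p then contraction p True (\<lambda>l. G (1 # (p - 1) # l)) r else 0)"
| "contraction p True G (a # b # r) = split2 G (a # b # r)
     - (if a = 1 then contraction p False (\<lambda>l. G (1 # l)) (b # r) else 0)
     + (if even a \<and> a + b = p then contraction p False (\<lambda>l. G (2 # (p - 2) # l)) r else 0)
     + (if even a \<and> a + b = p + 1 then contraction p True (\<lambda>l. G (2 # (p - 1) # l)) r else 0)"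
| "contraction p False G [a] = split1 G [a]"
| "contraction p True G [a] = split2 G [a]"
| "contraction p False G [] = split1 G []"
| "contraction p True G [] = split2 G []"

fun retraction :: "nat \<Rightarrow> bool \<Rightarrow> (nat list \<Rightarrow> 'k::comm_ring_1) \<Rightarrow> nat list \<Rightarrow> 'k" where
  "retraction p False G (a # b # r) =
     (if odd a \<and> a + b = p then retraction p True (\<lambda>l. G (1 # (p - 1) # l)) r else 0)"
| "retraction p True G (a # b # r) =
     (if a = 1 then retraction p False (\<lambda>l. G (1 # l)) (b # r) else 0)
     + (if even a \<and> a + b = p then retraction p False (\<lambda>l. G (2 # (p - 2) # l)) r else 0)
     + (if even a \<and> a + b = p + 1 then retraction p True (\<lambda>l. G (2 # (p - 1) # l)) r else 0)"
| "retraction p False G [a] = (if a = 0 then G [a] else 0)"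
| "retraction p True G [a] = (if a = 1 then G [a] else 0)"
| "retraction p False G [] = G []"
| "retraction p True G [] = 0"

lemma contraction_False: "contraction p False G l = split1 G l + after_pair True p (contraction p True (\<lambda>l. G (1 # (p - 1) # l))) l"
  by (cases l rule: remdups_adj.cases) auto

lemma contraction_True: "contraction p True G l = split2 G l - after_one (contraction p False (\<lambda>l. G (1 # l))) l
   + after_pair False p (contraction p False (\<lambda>l. G (2 # (p - 2) # l))) l
   + after_pair False (p + 1) (contraction p True (\<lambda>l. G (2 # (p - 1) # l))) l"
  by (cases l rule: remdups_adj.cases) auto

lemma retraction_False: "retraction p False G l = after_pair True p (retraction p True (\<lambda>l. G (1 # (p - 1) # l))) l
   + (if l = [] \<or> l = [0] then G l else 0)"
  by (cases l rule: remdups_adj.cases) auto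

lemma retraction_True: "retraction p True G l = after_one (retraction p False (\<lambda>l. G (1 # l))) l
   + after_pair False p (retraction p False (\<lambda>l. G (2 # (p - 2) # l))) l
   + after_pair False (p + 1) (retraction p True (\<lambda>l. G (2 # (p - 1) # l))) l"
  by (cases l rule: remdups_adj.cases) auto

text \<open>
  Within each of these prefixes and at its end no merge is possible, apart from that of \<open>p - 1\<close> with a final \<open>0\<close>, which
  is the augmentation of the rest.
\<close>

lemma aug_cob_prefix:
  assumes "cell p l" "odd p" "1 < p"
  shows "aug_cob p False G (1 # (p - 1) # l) = aug_cob p True (\<lambda>l. G (1 # (p - 1) # l)) l"
    and "aug_cob p True G (1 # l) = - aug_cob p False (\<lambda>l. G (1 # l)) l"
    and "aug_cob p True G (2 # (p - 2) # l) = aug_cob p False (\<lambda>l. G (2 # (p - 2) # l)) l"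
    and "aug_cob p True G (2 # (p - 1) # l) = aug_cob p True (\<lambda>l. G (2 # (p - 1) # l)) l"
proof -
  obtain q where p: "p = Suc (Suc q)" using less_imp_Suc_add[OF \<open>1 < p\<close>] by auto
  with assms have q: "odd q" by simp
  consider "l = []" | a where "l = [a]" | a b r where "l = a # b # r" "1 \<le> a"
    using assms(1) by (cases l rule: remdups_adj.cases) auto
  note l = this
  from l show "aug_cob p False G (1 # (p - 1) # l) = aug_cob p True (\<lambda>l. G (1 # (p - 1) # l)) l"
    by cases (simp_all add: aug_cob_def p q)
  from l show "aug_cob p True G (1 # l) = - aug_cob p False (\<lambda>l. G (1 # l)) l"
    by cases (simp_all add: aug_cob_def)
  from l show "aug_cob p True G (2 # (p - 2) # l) = aug_cob p False (\<lambda>l. G (2 # (p - 2) # l)) l"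
    by cases (simp_all add: aug_cob_def p q)
  from l show "aug_cob p True G (2 # (p - 1) # l) = aug_cob p True (\<lambda>l. G (2 # (p - 1) # l)) l"
    by cases (simp_all add: aug_cob_def p q)
qed

lemma cell_append:
  assumes "cell p r" "\<forall>x\<in>set pre. 1 \<le> x \<and> x < p"
  shows "cell p (pre @ r)"
  using assms(2)
proof (induction pre)
  case (Cons x pre)
  then show ?case by (cases "pre @ r") auto
qed (use assms(1) in simp)

text \<open>
  The contraction raises the length by one and stays inside the cells; in particular its values on a cell depend
  only on the values of the function on longer cells.
\<close>

lemma contraction_functional:
  fixes p :: nat
  assumes "cell p l" "odd p" "1 < p"
  shows "functional (cells p (Suc (length l))) (\<lambda>G. contraction p od G l :: 'k::comm_ring_1)"
  using assms
proof (induction "length l" arbitrary: l od rule: less_induct)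
  case less
  have p: "2 < p" using less.prems by (cases "p = 2") auto
  have pt: "cell p x \<Longrightarrow> length x = n \<Longrightarrow> functional (cells p n) (\<lambda>G. G x :: 'k)" for x n
    by (rule functional_point, simp, simp add: cells_def)
  have cm: "functional (cells p (Suc (length l))) (\<lambda>G. contraction p q (\<lambda>r. G (pre @ r)) r :: 'k)"
    if "length l = length pre + length r" "pre \<noteq> []" "cell p r" "\<forall>x\<in>set pre. 1 \<le> x \<and> x < p" for q pre r
  proof (rule functional_comp[OF less.hyps])
    show "(@) pre ` cells p (Suc (length r)) \<subseteq> cells p (Suc (length l))"
      using that by (auto simp: cells_def intro: cell_append)
    show "length r < length l" using that by (cases pre) auto
    show "cell p r" "odd p" "1 < p" using that less.prems by auto
  qed auto
  have sp1: "functional (cells p (Suc (length l))) (\<lambda>G. split1 G l :: 'k)"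
    using less.prems p by (cases l rule: remdups_adj.cases) (auto intro!: functional_if functional_uminus pt)
  have sp2: "functional (cells p (Suc (length l))) (\<lambda>G. split2 G l :: 'k)"
    using less.prems p by (cases l rule: remdups_adj.cases) (auto intro!: functional_if functional_uminus pt)
  show ?case
  proof (cases od)
    case False
    have "functional (cells p (Suc (length l))) (\<lambda>G. after_pair True p (contraction p True (\<lambda>l. G (1 # (p - 1) # l))) l :: 'k)"
    proof (cases l rule: remdups_adj.cases)
      case (3 a b r)
      have "functional (cells p (Suc (length l))) (\<lambda>G. contraction p True (\<lambda>r. G ([1, p - 1] @ r)) r :: 'k)"
        by (rule cm) (use 3 less.prems p in \<open>auto dest!: cell_Cons\<close>)
      with 3 show ?thesis by (auto intro!: functional_if)
    qed auto
    with False sp1 show ?thesis by (simp only: contraction_False) (intro functional_add)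
  next
    case True
    have "functional (cells p (Suc (length l))) (\<lambda>G. after_one (contraction p False (\<lambda>l. G (1 # l))) l :: 'k)"
    proof (cases l)
      case (Cons a r)
      have "functional (cells p (Suc (length l))) (\<lambda>G. contraction p False (\<lambda>r. G ([1] @ r)) r :: 'k)"
        by (rule cm) (use Cons less.prems p in \<open>auto dest!: cell_Cons\<close>)
      with Cons show ?thesis by (auto intro!: functional_if)
    qed auto
    moreover have "functional (cells p (Suc (length l))) (\<lambda>G. after_pair False p (contraction p False (\<lambda>l. G (2 # (p - 2) # l))) l :: 'k)"
    proof (cases l rule: remdups_adj.cases)
      case (3 a b r)
      have "functional (cells p (Suc (length l))) (\<lambda>G. contraction p False (\<lambda>r. G ([2, p - 2] @ r)) r :: 'k)"
        by (rule cm) (use 3 less.prems p in \<open>auto dest!: cell_Cons\<close>)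
      with 3 show ?thesis by (auto intro!: functional_if)
    qed auto
    moreover have "functional (cells p (Suc (length l))) (\<lambda>G. after_pair False (p + 1) (contraction p True (\<lambda>l. G (2 # (p - 1) # l))) l :: 'k)"
    proof (cases l rule: remdups_adj.cases)
      case (3 a b r)
      have "functional (cells p (Suc (length l))) (\<lambda>G. contraction p True (\<lambda>r. G ([2, p - 1] @ r)) r :: 'k)"
        by (rule cm) (use 3 less.prems p in \<open>auto dest!: cell_Cons\<close>)
      with 3 show ?thesis by (auto intro!: functional_if)
    qed auto
    ultimately show ?thesis using True sp2 
      by (simp only: contraction_True diff_conv_add_uminus) (intro functional_add functional_uminus)
  qed
qed

lemma contraction_cong:
  assumes "cell p l" "odd p" "1 < p"
    and "\<And>l'. cell p l' \<Longrightarrow> length l' = Suc (length l) \<Longrightarrow> G l' = G' l'"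
  shows "contraction p od G l = contraction p od G' l"
  by (rule functional_cong[OF contraction_functional[OF assms(1-3)]]) (simp add: assms(4) cells_def)

lemma contraction_uminus:
  assumes "cell p l" "odd p" "1 < p"
  shows "contraction p od (\<lambda>l. - G l) l = - contraction p od G l"
  by (rule functional_uminus_arg[OF contraction_functional[OF assms]])

lemma homotopy_sum1:
  fixes A :: "'k::ab_group_add"
  assumes "A = A1 + x" "B = B1 + y" "x + y = g - q" "A1 + B1 = G - g - z" "P = q + z"
  shows "A + B = G - P"
proof -
  have "A + B = (A1 + B1) + (x + y)" using assms(1,2) by (simp add: algebra_simps)
  then show ?thesis unfolding assms(3-5) by (simp add: algebra_simps)
qed

lemma homotopy_sum3:
  fixes A :: "'k::ab_group_add"
  assumes "A = A1 + x1 + x2 + x3" "B = B1 + y1 + y2 + y3"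
    "x1 + y1 = g1 - q1" "x2 + y2 = g2 - q2" "x3 + y3 = g3 - q3"
    "A1 + B1 = G - g2 - g3 - g1" "P = q1 + q2 + q3"
  shows "A + B = G - P"
proof -
  have "A + B = (A1 + B1) + (x1 + y1) + (x2 + y2) + (x3 + y3)" using assms(1,2) by (simp add: algebra_simps)
  then show ?thesis unfolding assms(3-7) by (simp add: algebra_simps)
qed

text \<open>
  Recursion on the prefixes: the splitting is a homotopy from the identity to the sum of the projections to the
  prefixes, and behind each prefix the induction hypothesis applies because the projections are chain maps.
\<close>

lemma homotopy:
  assumes "cell p l" "odd p" "1 < p"
  shows "aug_cob p od (contraction p od G) l + contraction p od (aug_cob p od G) l = G l - retraction p od G l"
  using assms
proof (induction "length l" arbitrary: l od G rule: less_induct)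
  case less
  show ?case
  proof (cases od)
    case False
    let ?G = "\<lambda>l. G (1 # (p - 1) # l)"
    have "aug_cob p False (contraction p False G) l = aug_cob p False (split1 G) l
       + after_pair True p (aug_cob p True (contraction p True ?G)) l"
      using less.prems by (simp add: contraction_False[abs_def] aug_cob_add aug_cob_after_pair)
    moreover have "contraction p False (aug_cob p False G) l = split1 (aug_cob p False G) l
       + after_pair True p (contraction p True (aug_cob p True ?G)) l"
    proof (cases l rule: remdups_adj.cases)
      case (3 a b r)
      with less.prems have "cell p r" by (auto dest!: cell_Cons)
      have "contraction p True (\<lambda>l. aug_cob p False G (1 # (p - 1) # l)) r = contraction p True (aug_cob p True ?G) r"
        by (rule contraction_cong) (use less.prems \<open>cell p r\<close> aug_cob_prefix(1) in auto)
      with 3 show ?thesis by simp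
    qed auto
    moreover have "after_pair True p (aug_cob p True (contraction p True ?G)) l
        + after_pair True p (contraction p True (aug_cob p True ?G)) l = after_pair True p ?G l - after_pair True p (retraction p True ?G) l"
    proof (cases l rule: remdups_adj.cases)
      case (3 a b r)
      with less.prems have "cell p r" by (auto dest!: cell_Cons)
      with less.hyps[of r True ?G] 3 less.prems show ?thesis by simp
    qed auto
    ultimately show ?thesis
      using homotopy_sum1 aug_cob_split1[OF less.prems(1,2), of G] retraction_False[of p G l]
      unfolding Eq_FalseI[OF False] by blast
  next
    case True
    let ?G1 = "\<lambda>l. G (1 # l)" and ?G2 = "\<lambda>l. G (2 # (p - 2) # l)" and ?G3 = "\<lambda>l. G (2 # (p - 1) # l)"
    have "aug_cob p True (contraction p True G) l = aug_cob p True (split2 G) l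
       + after_one (aug_cob p False (contraction p False ?G1)) l
       + after_pair False p (aug_cob p False (contraction p False ?G2)) l
       + after_pair False (p + 1) (aug_cob p True (contraction p True ?G3)) l"
    proof -
      have *: "contraction p True G = (\<lambda>l. split2 G l + - after_one (contraction p False ?G1) l
        + after_pair False p (contraction p False ?G2) l + after_pair False (p + 1) (contraction p True ?G3) l)"
        by (rule ext) (simp only: contraction_True[of p G] diff_conv_add_uminus)
      have "aug_cob p True (after_pair False p Y) l = after_pair False p (aug_cob p False Y) l" for Y :: "nat list \<Rightarrow> 'a"
        using aug_cob_after_pair[of p l p False True Y] less.prems by simp
      moreover have "aug_cob p True (after_pair False (p + 1) Y) l = after_pair False (p + 1) (aug_cob p True Y) l" for Y :: "nat list \<Rightarrow> 'a"
        using aug_cob_after_pair[of p l "p + 1" False True Y] less.prems by simp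
      ultimately show ?thesis
        unfolding * aug_cob_add aug_cob_uminus aug_cob_after_one[OF less.prems(1)] by simp
    qed
    moreover have "contraction p True (aug_cob p True G) l = split2 (aug_cob p True G) l
       + after_one (contraction p False (aug_cob p False ?G1)) l
       + after_pair False p (contraction p False (aug_cob p False ?G2)) l
       + after_pair False (p + 1) (contraction p True (aug_cob p True ?G3)) l"
    proof -
      have "after_one (contraction p False (\<lambda>l. aug_cob p True G (1 # l))) l = - after_one (contraction p False (aug_cob p False ?G1)) l"
      proof (cases l)
        case (Cons a r)
        with less.prems have "cell p r" by (auto dest!: cell_Cons)
        have "contraction p False (\<lambda>l. aug_cob p True G (1 # l)) r = contraction p False (\<lambda>l. - aug_cob p False ?G1 l) r"
          by (rule contraction_cong) (use less.prems \<open>cell p r\<close> aug_cob_prefix(2) in auto)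
        with Cons show ?thesis by (simp add: contraction_uminus[OF \<open>cell p r\<close> less.prems(2,3)])
      qed auto
      moreover have "after_pair False p (contraction p False (\<lambda>l. aug_cob p True G (2 # (p - 2) # l))) l = after_pair False p (contraction p False (aug_cob p False ?G2)) l"
      proof (cases l rule: remdups_adj.cases)
        case (3 a b r)
        with less.prems have "cell p r" by (auto dest!: cell_Cons)
        have "contraction p False (\<lambda>l. aug_cob p True G (2 # (p - 2) # l)) r = contraction p False (aug_cob p False ?G2) r"
          by (rule contraction_cong) (use less.prems \<open>cell p r\<close> aug_cob_prefix(3) in auto)
        with 3 show ?thesis by simp
      qed auto
      moreover have "after_pair False (p + 1) (contraction p True (\<lambda>l. aug_cob p True G (2 # (p - 1) # l))) l = after_pair False (p + 1) (contraction p True (aug_cob p True ?G3)) l"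
      proof (cases l rule: remdups_adj.cases)
        case (3 a b r)
        with less.prems have "cell p r" by (auto dest!: cell_Cons)
        have "contraction p True (\<lambda>l. aug_cob p True G (2 # (p - 1) # l)) r = contraction p True (aug_cob p True ?G3) r"
          by (rule contraction_cong) (use less.prems \<open>cell p r\<close> aug_cob_prefix(4) in auto)
        with 3 show ?thesis by simp
      qed auto
      ultimately show ?thesis by (subst contraction_True) simp
    qed
    moreover have "after_one (aug_cob p False (contraction p False ?G1)) l + after_one (contraction p False (aug_cob p False ?G1)) l
        = after_one ?G1 l - after_one (retraction p False ?G1) l"
    proof (cases l)
      case (Cons a r)
      with less.prems have "cell p r" by (auto dest!: cell_Cons)
      with less.hyps[of r False ?G1] Cons less.prems show ?thesis by simp
    qed auto
    moreover have "after_pair False p (aug_cob p False (contraction p False ?G2)) l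
        + after_pair False p (contraction p False (aug_cob p False ?G2)) l = after_pair False p ?G2 l - after_pair False p (retraction p False ?G2) l"
    proof (cases l rule: remdups_adj.cases)
      case (3 a b r)
      with less.prems have "cell p r" by (auto dest!: cell_Cons)
      with less.hyps[of r False ?G2] 3 less.prems show ?thesis by simp
    qed auto
    moreover have "after_pair False (p + 1) (aug_cob p True (contraction p True ?G3)) l
        + after_pair False (p + 1) (contraction p True (aug_cob p True ?G3)) l = after_pair False (p + 1) ?G3 l - after_pair False (p + 1) (retraction p True ?G3) l"
    proof (cases l rule: remdups_adj.cases)
      case (3 a b r)
      with less.prems have "cell p r" by (auto dest!: cell_Cons)
      with less.hyps[of r True ?G3] 3 less.prems show ?thesis by simp
    qed auto
    ultimately show ?thesis
      using homotopy_sum3 aug_cob_split2[OF less.prems, of G] retraction_True[of p G l]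
      unfolding Eq_TrueI[OF True] by blast
  qed
qed


text \<open>
  The cells left over by the contraction. From an even position on they consist of blocks \<open>1, p - 1, 2, p - 1, \<dots>\<close> that end at the next
  even position, followed by at most one final \<open>0\<close>.
\<close>

fun crit :: "nat \<Rightarrow> bool \<Rightarrow> nat list \<Rightarrow> bool" where
  "crit p False (a # b # r) = (a = 1 \<and> b = p - 1 \<and> crit p True r)"
| "crit p True (a # b # r) = (a = 1 \<and> crit p False (b # r) \<or> a = 2 \<and> b = p - 2 \<and> crit p False r
     \<or> a = 2 \<and> b = p - 1 \<and> crit p True r)"
| "crit p False [a] = (a = 0)"
| "crit p True [a] = (a = 1)"
| "crit p False [] = True"
| "crit p True [] = False"

definition critical_cells :: "nat \<Rightarrow> bool \<Rightarrow> nat \<Rightarrow> nat list set" where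
  "critical_cells p od n = {l. length l = n \<and> crit p od l}"

lemma crit_True: "crit p True l \<longleftrightarrow> (\<exists>r. l = 1 # r \<and> crit p False r \<or> l = 2 # (p - 2) # r \<and> crit p False r
     \<or> l = 2 # (p - 1) # r \<and> crit p True r)"
  by (cases l rule: remdups_adj.cases) auto

lemma crit_False: "crit p False l \<longleftrightarrow> l = [] \<or> l = [0] \<or> (\<exists>r. l = 1 # (p - 1) # r \<and> crit p True r)"
  by (cases l rule: remdups_adj.cases) auto

text \<open>
  The case names give the parities of the positions before and after the prefix; \<open>OE2\<close> is the prefix \<open>1\<close> and
  \<open>OE\<close> the prefix \<open>2, p - 2\<close>.
\<close>

lemma crit_induct [consumes 1, case_names Nil Zero EO OE2 OE OO]:
  assumes "crit p od l" "P False []" "P False [0]"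
    and "\<And>r. crit p True r \<Longrightarrow> P True r \<Longrightarrow> P False (1 # (p - 1) # r)"
    and "\<And>r. crit p False r \<Longrightarrow> P False r \<Longrightarrow> P True (1 # r)"
    and "\<And>r. crit p False r \<Longrightarrow> P False r \<Longrightarrow> P True (2 # (p - 2) # r)"
    and "\<And>r. crit p True r \<Longrightarrow> P True r \<Longrightarrow> P True (2 # (p - 1) # r)"
  shows "P od l"
  using assms(1)
proof (induction "length l" arbitrary: l od rule: less_induct)
  case less
  show ?case
  proof (cases od)
    case True
    with less.prems crit_True[of p l] obtain r where "l = 1 # r \<and> crit p False r \<or> l = 2 # (p - 2) # r \<and> crit p False r
     \<or> l = 2 # (p - 1) # r \<and> crit p True r" by auto
    then show ?thesis using less.hyps[of r] assms(5-7) True by auto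
  next
    case False
    with less.prems crit_False[of p l] consider "l = [] \<or> l = [0]" | r where "l = 1 # (p - 1) # r" "crit p True r" by auto
    then show ?thesis
      by cases (use assms(2-4) False less.hyps in auto)
  qed
qed

lemma crit_cell:
  assumes "crit p od l" "odd p" "1 < p"
  shows "cell p l"
proof -
  have p: "2 < p" using assms by (cases "p = 2") auto
  note c = cell_append[where pre = "[a]" for a, simplified] cell_append[where pre = "[a, b]" for a b, simplified]
  show ?thesis using assms(1)
    by (induction rule: crit_induct) (use p in \<open>auto intro!: c\<close>)
qed

lemma finite_critical_cells [simp]:
  assumes "odd p" "1 < p"
  shows "finite (critical_cells p od n)"
  by (rule finite_subset[OF _ finite_cells[of p n]]) (use crit_cell assms in \<open>auto simp: critical_cells_def cells_def\<close>)

text \<open>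
  No two neighbours of a critical cell can be merged, so critical cells are cycles.
\<close>

lemma aug_cob_crit:
  assumes "crit p od l" "odd p" "1 < p"
  shows "aug_cob p od G l = 0"
  using assms(1)
proof (induction arbitrary: G rule: crit_induct)
  case (EO r)
  show ?case unfolding aug_cob_prefix[OF crit_cell[OF EO.hyps assms(2,3)] assms(2,3)] by (rule EO.IH)
next
  case (OE2 r)
  show ?case unfolding aug_cob_prefix[OF crit_cell[OF OE2.hyps assms(2,3)] assms(2,3)] by (simp add: OE2.IH)
next
  case (OE r)
  show ?case unfolding aug_cob_prefix[OF crit_cell[OF OE.hyps assms(2,3)] assms(2,3)] by (rule OE.IH)
next
  case (OO r)
  show ?case unfolding aug_cob_prefix[OF crit_cell[OF OO.hyps assms(2,3)] assms(2,3)] by (rule OO.IH)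
qed (auto simp: aug_cob_def)

lemma retraction_crit:
  assumes "crit p od l" "odd p" "1 < p"
  shows "retraction p od G l = G l"
  using assms(1)
proof (induction arbitrary: G rule: crit_induct)
  case (OE2 r)
  then show ?case by (cases r) auto
qed (use assms(2,3) in auto)

lemma crit_TrueI:
  "crit p False r \<Longrightarrow> crit p True (1 # r)"
  "crit p False r \<Longrightarrow> crit p True (2 # (p - 2) # r)"
  "crit p True r \<Longrightarrow> crit p True (2 # (p - 1) # r)"
  by (subst crit_True, blast)+

lemma retraction_functional:
  assumes "odd p" "1 < p"
  shows "functional (critical_cells p od (length l)) (\<lambda>G. retraction p od G l :: 'k::comm_ring_1)"
proof (induction "length l" arbitrary: l od rule: less_induct)
  case less
  have cm: "functional (critical_cells p od (length l)) (\<lambda>G. retraction p q (\<lambda>r. G (pre @ r)) r :: 'k)"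
    if "length l = length pre + length r" "pre \<noteq> []" "\<And>r. crit p q r \<Longrightarrow> crit p od (pre @ r)" for q pre r
  proof (rule functional_comp[OF less.hyps])
    show "(@) pre ` critical_cells p q (length r) \<subseteq> critical_cells p od (length l)"
      using that by (auto simp: critical_cells_def)
    show "length r < length l" using that by (cases pre) auto
  qed (use assms in auto)
  have pt: "x \<in> critical_cells p od n \<Longrightarrow> functional (critical_cells p od n) (\<lambda>G. G x :: 'k)" for x n
    by (rule functional_point) (use assms in auto)
  show ?case
  proof (cases od)
    case False
    show ?thesis
    proof (cases l rule: remdups_adj.cases)
      case 1
      then show ?thesis using False pt[of "[]" 0] by (simp add: critical_cells_def)
    next
      case (2 a)
      then show ?thesis using False pt[of "[a]" 1] by (auto intro!: functional_if simp: critical_cells_def)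
    next
      case (3 a b r)
      have "functional (critical_cells p od (length l)) (\<lambda>G. retraction p True (\<lambda>r. G ([1, p - 1] @ r)) r :: 'k)"
        by (rule cm) (use 3 False in auto)
      then show ?thesis using False 3 by (auto intro!: functional_if)
    qed
  next
    case True
    show ?thesis
    proof (cases l rule: remdups_adj.cases)
      case 1
      then show ?thesis using True by simp
    next
      case (2 a)
      then show ?thesis using True pt[of "[a]" 1] by (auto intro!: functional_if simp: critical_cells_def)
    next
      case (3 a b r)
      have 1: "functional (critical_cells p od (length l)) (\<lambda>G. retraction p False (\<lambda>r. G ([1] @ r)) (b # r) :: 'k)"
        by (rule cm) (use 3 True crit_TrueI in \<open>simp_all del: crit.simps\<close>)
      have 2: "functional (critical_cells p od (length l)) (\<lambda>G. retraction p False (\<lambda>r. G ([2, p - 2] @ r)) r :: 'k)"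
        by (rule cm) (use 3 True crit_TrueI in \<open>simp_all del: crit.simps\<close>)
      have 3: "functional (critical_cells p od (length l)) (\<lambda>G. retraction p True (\<lambda>r. G ([2, p - 1] @ r)) r :: 'k)"
        by (rule cm) (use 3 True crit_TrueI in \<open>simp_all del: crit.simps\<close>)
      from 1 2 3 show ?thesis using True \<open>l = a # b # r\<close> by (auto intro!: functional_if functional_add)
    qed
  qed
qed

lemma merge_cob_indicator:
  assumes "cell p l"
  shows "merge_cob p False (\<lambda>l. if l = [] \<or> l = [0] then G l else 0) l = 0"
proof (cases l rule: remdups_adj.cases)
  case (3 a b r)
  with assms have "a \<noteq> 0" by auto
  with 3 show ?thesis by simp
qed auto

text \<open>
  Dually, the functions pulled back along the retraction are cocycles: the projections are chain maps onto complexes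
  in which, by induction, the same holds.
\<close>

lemma aug_cob_retraction:
  assumes "cell p l" "odd p" "1 < p"
  shows "aug_cob p od (retraction p od G) l = 0"
  using assms
proof (induction "length l" arbitrary: l od G rule: less_induct)
  case less
  have p1: "after_one (aug_cob p q (retraction p q G')) l = 0" for q and G' :: "nat list \<Rightarrow> 'a"
  proof (cases l)
    case (Cons a r)
    with less.prems have "cell p r" by (auto dest!: cell_Cons)
    with Cons less show ?thesis by simp
  qed simp
  have p2: "after_pair od' s (aug_cob p q (retraction p q G')) l = 0" for od' s q and G' :: "nat list \<Rightarrow> 'a"
  proof (cases l rule: remdups_adj.cases)
    case (3 a b r)
    with less.prems have "cell p r" by (auto dest!: cell_Cons)
    with 3 less show ?thesis by simp
  qed auto
  show ?case
  proof (cases od)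
    case False
    have "retraction p False G = (\<lambda>l. after_pair True p (retraction p True (\<lambda>l. G (1 # (p - 1) # l))) l
        + (if l = [] \<or> l = [0] then G l else 0))"
      by (rule ext) (rule retraction_False)
    moreover have "aug_cob p False (after_pair True p Y) l = after_pair True p (aug_cob p True Y) l" for Y :: "nat list \<Rightarrow> 'a"
      using aug_cob_after_pair[of p l p True False Y] less.prems by simp
    moreover have "aug_cob p False (\<lambda>l. if l = [] \<or> l = [0] then G l else 0) l = 0"
      using merge_cob_indicator[OF less.prems(1)] by (simp add: aug_cob_def)
    ultimately show ?thesis using False p2 by (simp add: aug_cob_add)
  next
    case True
    have *: "retraction p True G = (\<lambda>l. after_one (retraction p False (\<lambda>l. G (1 # l))) l
      + after_pair False p (retraction p False (\<lambda>l. G (2 # (p - 2) # l))) l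
      + after_pair False (p + 1) (retraction p True (\<lambda>l. G (2 # (p - 1) # l))) l)"
      by (rule ext) (rule retraction_True)
    have a: "aug_cob p True (after_pair False p Y) l = after_pair False p (aug_cob p False Y) l" for Y :: "nat list \<Rightarrow> 'a"
      using aug_cob_after_pair[of p l p False True Y] less.prems by simp
    have b: "aug_cob p True (after_pair False (p + 1) Y) l = after_pair False (p + 1) (aug_cob p True Y) l" for Y :: "nat list \<Rightarrow> 'a"
      using aug_cob_after_pair[of p l "p + 1" False True Y] less.prems by simp
    show ?thesis
      unfolding Eq_TrueI[OF True] * aug_cob_add aug_cob_after_one[OF less.prems(1)] a b p1 p2 by simp
  qed
qed

section \<open>Divided powers on the prime field\<close>

text \<open>
  For \<open>a < p\<close> the divided power \<open>u ^ a / a!\<close> is additive in the sense of the binomial theorem and has parity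
  \<open>a\<close> under \<open>u \<mapsto> - u\<close>. It is the coefficient of \<open>w ^ a\<close> in the group element \<open>exp (u w)\<close> of
  \<open>k[w] / (w ^ p)\<close>, the group algebra of the prime field.
\<close>

definition dpow :: "nat \<Rightarrow> 'p::prime_card mod_ring \<Rightarrow> 'p mod_ring" where
  "dpow a u = u ^ a / of_nat (fact a)"

text \<open>
  The inverse of the matrix of divided powers, read off from the expansion of \<open>1 - (u - v) ^ (p - 1)\<close>,
  the indicator function of \<open>u = v\<close>.
\<close>

definition dual_dpow :: "'p::prime_card mod_ring \<Rightarrow> nat \<Rightarrow> 'p mod_ring" where
  "dual_dpow v j = (if j = 0 then 1 else 0) - of_nat (fact j) * v ^ (CARD('p) - Suc j)"

lemma fact_nonzero:
  assumes "a < CARD('p)"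
  shows "(of_nat (fact a) :: 'p::prime_card mod_ring) \<noteq> 0"
proof
  assume "(of_nat (fact a) :: 'p mod_ring) = 0"
  then have "CARD('p) dvd fact a" by (rule of_nat_0_mod_ring_dvd)
  then show False using assms prime_card[where 'a = 'p] prime_dvd_fact_iff[of "CARD('p)" a] by simp
qed

lemma dpow_0 [simp]: "dpow 0 u = 1"
  by (simp add: dpow_def)

lemma dpow_zero: "dpow a 0 = (if a = 0 then 1 else 0)"
  by (simp add: dpow_def)

lemma dpow_mult: "dpow a (e * u) = e ^ a * dpow a u"
  by (simp add: dpow_def power_mult_distrib)

lemma dpow_add:
  fixes u v :: "'p::prime_card mod_ring"
  assumes "a < CARD('p)"
  shows "dpow a (u + v) = (\<Sum>i\<le>a. dpow i u * dpow (a - i) v)"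
proof -
  have "of_nat (a choose i) / of_nat (fact a) = (1 / (of_nat (fact i) * of_nat (fact (a - i))) :: 'p mod_ring)" if "i \<le> a" for i
  proof -
    have nz: "(of_nat (fact i) :: 'p mod_ring) \<noteq> 0" "(of_nat (fact (a - i)) :: 'p mod_ring) \<noteq> 0" "(of_nat (fact a) :: 'p mod_ring) \<noteq> 0"
      using assms that by (auto intro!: fact_nonzero)
    have "(of_nat (fact i * fact (a - i) * (a choose i)) :: 'p mod_ring) = of_nat (fact a)"
      by (simp only: binomial_fact_lemma[OF that])
    then have "of_nat (fact i) * of_nat (fact (a - i)) * of_nat (a choose i) = (of_nat (fact a) :: 'p mod_ring)" by (simp only: of_nat_mult)
    with nz show ?thesis by (simp add: field_simps)
  qed
  then have *: "of_nat (a choose i) * x / of_nat (fact a) = x / (of_nat (fact i) * of_nat (fact (a - i)))" if "i \<le> a" for i and x :: "'p mod_ring"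
    using that by (metis (no_types, lifting) mult.commute mult_1 times_divide_eq_right)
  show ?thesis
    unfolding dpow_def binomial_ring sum_divide_distrib
    by (rule sum.cong) (auto simp: * mult.assoc)
qed

lemma dpow_dual1:
  fixes u v :: "'p::prime_card mod_ring"
  shows "(\<Sum>j<CARD('p). dpow j u * dual_dpow v j) = (if u = v then 1 else 0)"
proof -
  have p: "0 < CARD('p)" by simp
  have fl: "x ^ CARD('p) = x" for x :: "'p mod_ring"
    using finite_field_power_card_eq_same[of x] by simp
  have cancel: "f \<noteq> 0 \<Longrightarrow> x / f * (0 - f * w) = 0 - w * x" for f x w :: "'p mod_ring"
    by simp
  have "(\<Sum>j<CARD('p). dpow j u * dual_dpow v j)
      = (\<Sum>j<CARD('p). (if j = 0 then 1 else 0) - v ^ (CARD('p) - Suc j) * u ^ j)"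
  proof (rule sum.cong)
    fix j assume "j \<in> {..<CARD('p)}"
    then have "(of_nat (fact j) :: 'p mod_ring) \<noteq> 0" by (intro fact_nonzero) simp
    then show "dpow j u * dual_dpow v j = (if j = 0 then 1 else 0) - v ^ (CARD('p) - Suc j) * u ^ j"
      using cancel[of "of_nat (fact j)" "u ^ j" "v ^ (CARD('p) - Suc j)"]
      by (cases "j = 0") (simp_all only: dual_dpow_def dpow_def if_True if_False power_0 fact_0 of_nat_1 div_by_1 mult_1 mult_1_right simp_thms)
  qed simp
  also have "\<dots> = 1 - (\<Sum>j<CARD('p). v ^ (CARD('p) - Suc j) * u ^ j)"
    using p by (simp add: sum_subtractf)
  also have "(\<Sum>j<CARD('p). v ^ (CARD('p) - Suc j) * u ^ j) = (if u = v then 0 else 1)"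
  proof (cases "u = v")
    case True
    have "(\<Sum>j<CARD('p). v ^ (CARD('p) - Suc j) * v ^ j) = (\<Sum>j<CARD('p). v ^ (CARD('p) - 1))"
      by (rule sum.cong) (auto simp: power_add[symmetric])
    also have "\<dots> = 0" by simp
    finally show ?thesis using True by simp
  next
    case False
    have "(u - v) * (\<Sum>j<CARD('p). v ^ (CARD('p) - Suc j) * u ^ j) = (u - v) * 1"
      using power_diff_sumr2[of u "CARD('p)" v] fl by simp
    with False show ?thesis by simp
  qed
  finally show ?thesis by simp
qed

lemma dual_dpow_0: "dual_dpow v 0 = (if v = 0 then 1 else 0)"
  for v :: "'p::prime_card mod_ring"
proof -
  have "(\<Sum>j<CARD('p). dpow j 0 * dual_dpow v j) = dual_dpow v 0"
    by (simp add: dpow_zero if_distrib[of "\<lambda>x. x * _"] cong: if_cong)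
  then show ?thesis using dpow_dual1[of 0 v] by auto
qed

text \<open>
  A polynomial of degree below \<open>p\<close> with \<open>p\<close> roots vanishes.
\<close>

lemma dpow_independent:
  fixes c :: "nat \<Rightarrow> 'p::prime_card mod_ring"
  assumes "\<And>u. (\<Sum>j<CARD('p). c j * dpow j u) = 0" "j < CARD('p)"
  shows "c j = 0"
proof -
  \<comment> \<open>the polynomial function of the relation; its coefficients are those of the relation up to units\<close>
  define q where "q = (\<Sum>j<CARD('p). Polynomial.monom (c j / of_nat (fact j)) j)"
  have "poly q u = 0" for u
    using assms(1)[of u] by (simp add: q_def poly_sum poly_monom dpow_def)
  moreover have "Polynomial.degree q < CARD('p)" if "q \<noteq> 0"
    unfolding q_def by (rule degree_sum_less) (auto intro: le_less_trans[OF degree_monom_le])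
  ultimately have "q = 0"
    using poly_roots_degree[of q] by fastforce
  then have "Polynomial.coeff q j = 0" by simp
  then have "c j / of_nat (fact j) = 0" using assms(2) by (simp add: q_def coeff_sum if_distrib cong: if_cong)
  with fact_nonzero[OF assms(2)] show ?thesis by simp
qed

lemma dpow_dual2:
  assumes "i < CARD('p::prime_card)" "j < CARD('p)"
  shows "(\<Sum>v\<in>UNIV. dual_dpow v j * dpow i v) = (if i = j then 1 else 0 :: 'p mod_ring)"
proof -
  let ?c = "\<lambda>j. (\<Sum>v\<in>UNIV. dual_dpow v j * dpow i v) - (if i = j then 1 else 0 :: 'p mod_ring)"
  have "?c j = 0"
  proof (rule dpow_independent[OF _ assms(2)])
    fix u :: "'p mod_ring"
    have 1: "(\<Sum>j<CARD('p). (\<Sum>v\<in>UNIV. dual_dpow v j * dpow i v) * dpow j u)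
      = (\<Sum>v\<in>UNIV. dpow i v * (\<Sum>j<CARD('p). dpow j u * dual_dpow v j))"
      unfolding sum_distrib_left sum_distrib_right by (subst sum.swap) (simp add: mult_ac)
    also have "\<dots> = dpow i u"
      unfolding dpow_dual1 by (simp add: if_distrib[of "\<lambda>x. _ * x"] cong: if_cong)
    finally have 1: "(\<Sum>j<CARD('p). (\<Sum>v\<in>UNIV. dual_dpow v j * dpow i v) * dpow j u) = dpow i u" .
    have 2: "(\<Sum>j<CARD('p). (if i = j then 1 else 0) * dpow j u) = dpow i u"
      using assms(1) by (simp add: if_distrib[of "\<lambda>x. x * _"] cong: if_cong)
    show "(\<Sum>j<CARD('p). ?c j * dpow j u) = 0"
      unfolding left_diff_distrib sum_subtractf 1 2 by simp
  qed
  then show ?thesis by simp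
qed

section \<open>From functions on cells to functions of difference coordinates\<close>

text \<open>
  A function on cells lists the coefficients of a polynomial function of the coordinates \<open>us\<close>. The exponents of all
  coordinates but the last start at \<open>1\<close>, which makes the function vanish wherever one of these coordinates is
  \<open>0\<close>.
\<close>

fun phi :: "(nat list \<Rightarrow> 'p::prime_card mod_ring) \<Rightarrow> 'p mod_ring list \<Rightarrow> 'p mod_ring" where
  "phi G (u # v # r) = (\<Sum>a\<in>{1..<CARD('p)}. dpow a u * phi (\<lambda>l. G (a # l)) (v # r))"
| "phi G [u] = (\<Sum>a<CARD('p). dpow a u * G [a])"
| "phi G [] = 0"

fun psi :: "('p::prime_card mod_ring list \<Rightarrow> 'p mod_ring) \<Rightarrow> nat list \<Rightarrow> 'p mod_ring" where
  "psi F (a # b # r) = (\<Sum>v\<in>UNIV. dual_dpow v a * psi (\<lambda>l. F (v # l)) (b # r))"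
| "psi F [a] = (\<Sum>v\<in>UNIV. dual_dpow v a * F [v])"
| "psi F [] = 0"

lemma phi_functional: "functional (cells CARD('p) (length us)) (\<lambda>G. phi G (us :: 'p::prime_card mod_ring list))"
proof (induction us rule: induct_list012)
  case (2 u)
  show ?case unfolding phi.simps
    by (intro functional_sum functional_mult functional_point) (simp, simp add: cells_def)
next
  case (3 u v r)
  have "(#) a ` cells CARD('p) (length (v # r)) \<subseteq> cells CARD('p) (length (u # v # r))"
    if "a \<in> {1..<CARD('p)}" for a
    using that by (auto simp: cells_def length_Suc_conv)
  then show ?case unfolding phi.simps
    by (intro functional_sum functional_mult functional_comp[OF 3(2)]) auto
qed simp

lemma finite_length [simp]: "finite {us :: 'a::finite list. length us = n}"
  using finite_lists_length_eq[of "UNIV :: 'a set" n] by simp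

lemma psi_functional:
  "functional {us :: 'p::prime_card mod_ring list. length us = length l} (\<lambda>F. psi F l)"
proof (induction l rule: induct_list012)
  case (2 u)
  show ?case unfolding psi.simps
    by (intro functional_sum functional_mult functional_point) auto
next
  case (3 a b r)
  show ?case unfolding psi.simps
    by (intro functional_sum functional_mult functional_comp[OF 3(2)]) auto
qed simp

lemma phi_cong: "(\<And>l. cell CARD('p) l \<Longrightarrow> length l = length us \<Longrightarrow> G l = G' l) \<Longrightarrow> phi G us = phi G' us"
  for us :: "'p::prime_card mod_ring list"
  by (rule functional_cong[OF phi_functional]) (simp add: cells_def)

lemma psi_cong: "(\<And>us. length us = length l \<Longrightarrow> F us = F' us) \<Longrightarrow> psi F l = psi F' l"
  by (rule functional_cong[OF psi_functional]) simp

fun degen :: "'a::zero list \<Rightarrow> bool" where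
  "degen (u # v # r) = (u = 0 \<or> degen (v # r))"
| "degen _ = False"

lemma phi_degen: "degen us \<Longrightarrow> phi G us = 0"
proof (induction G us rule: phi.induct)
  case (1 G u v r)
  then show ?case by (auto simp: dpow_zero intro!: sum.neutral)
qed auto

text \<open>
  The exponent \<open>0\<close> missing in \<open>phi\<close> would contribute the value at a vanishing coordinate, which is \<open>0\<close>.
\<close>

lemma phi_psi:
  fixes us :: "'p::prime_card mod_ring list"
  assumes "us \<noteq> []" "\<And>us'. length us' = length us \<Longrightarrow> degen us' \<Longrightarrow> F us' = 0"
  shows "phi (psi F) us = F us"
  using assms
proof (induction us arbitrary: F rule: induct_list012)
  case (2 u)
  have "phi (psi F) [u] = (\<Sum>v\<in>UNIV. F [v] * (\<Sum>a<CARD('p). dpow a u * dual_dpow v a))"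
    unfolding phi.simps psi.simps sum_distrib_left by (subst sum.swap) (simp add: mult_ac)
  also have "\<dots> = F [u]"
    unfolding dpow_dual1 by (simp add: if_distrib[of "\<lambda>x. _ * x"] cong: if_cong)
  finally show ?case .
next
  case (3 u v r)
  have IH: "phi (psi (\<lambda>l. F (w # l))) (v # r) = F (w # v # r)" for w
  proof (rule "3.IH"(2))
    fix us' :: "'p mod_ring list" assume "length us' = length (v # r)" "degen us'"
    then show "F (w # us') = 0" by (intro "3.prems"(2)) (cases us'; auto)+
  qed simp
  have split: "{..<CARD('p)} = insert 0 {1..<CARD('p)}" by auto
  have dd: "(\<Sum>a\<in>{1..<CARD('p)}. dpow a u * dual_dpow w a) = (if u = w then 1 else 0) - (if w = 0 then 1 else 0)" for w
    using dpow_dual1[of u w] unfolding split by (simp add: dual_dpow_0 algebra_simps)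
  have "phi (\<lambda>l. psi F (a # l)) (v # r) = phi (\<lambda>l. \<Sum>w\<in>UNIV. dual_dpow w a * psi (\<lambda>l. F (w # l)) l) (v # r)" for a
    by (rule phi_cong) (auto simp: length_Suc_conv)
  then have "phi (psi F) (u # v # r) = (\<Sum>a\<in>{1..<CARD('p)}. dpow a u * (\<Sum>w\<in>UNIV. dual_dpow w a * F (w # v # r)))"
    by (simp add: functional_sum_arg[OF phi_functional] IH)
  also have "\<dots> = (\<Sum>w\<in>UNIV. F (w # v # r) * (\<Sum>a\<in>{1..<CARD('p)}. dpow a u * dual_dpow w a))"
    unfolding sum_distrib_left by (subst sum.swap) (simp add: mult_ac)
  also have "\<dots> = F (u # v # r) - F (0 # v # r)"
    unfolding dd right_diff_distrib sum_subtractf by (simp add: if_distrib[of "\<lambda>x. _ * x"] cong: if_cong)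
  finally show ?case using "3.prems"(2)[of "0 # v # r"] by simp
qed simp

lemma psi_phi:
  fixes G :: "nat list \<Rightarrow> 'p::prime_card mod_ring"
  assumes "cell CARD('p) l" "l \<noteq> []"
  shows "psi (phi G) l = G l"
  using assms
proof (induction l arbitrary: G rule: induct_list012)
  case (2 a)
  have "psi (phi G) [a] = (\<Sum>c<CARD('p). G [c] * (\<Sum>v\<in>UNIV. dual_dpow v a * dpow c v))"
    unfolding phi.simps psi.simps sum_distrib_left by (subst sum.swap) (simp add: mult_ac)
  also have "\<dots> = (\<Sum>c<CARD('p). G [c] * (if c = a then 1 else 0))"
    by (rule sum.cong) (use 2 in \<open>simp_all add: dpow_dual2\<close>)
  finally show ?case using 2 by (simp add: if_distrib[of "\<lambda>x. _ * x"] cong: if_cong)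
next
  case (3 a b r)
  then have a: "1 \<le> a" "a < CARD('p)" by auto
  have "psi (\<lambda>l. phi G (v # l)) (b # r) = psi (\<lambda>l. \<Sum>c\<in>{1..<CARD('p)}. dpow c v * phi (\<lambda>l. G (c # l)) l) (b # r)" for v
    by (rule psi_cong) (auto simp: length_Suc_conv)
  then have "psi (phi G) (a # b # r) = (\<Sum>v\<in>UNIV. dual_dpow v a * (\<Sum>c\<in>{1..<CARD('p)}. dpow c v * G (c # b # r)))"
    using 3 by (simp add: functional_sum_arg[OF psi_functional])
  also have "\<dots> = (\<Sum>c\<in>{1..<CARD('p)}. G (c # b # r) * (\<Sum>v\<in>UNIV. dual_dpow v a * dpow c v))"
    unfolding sum_distrib_left by (subst sum.swap) (simp add: mult_ac)
  also have "\<dots> = (\<Sum>c\<in>{1..<CARD('p)}. G (c # b # r) * (if c = a then 1 else 0))"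
    by (rule sum.cong) (use a in \<open>simp_all add: dpow_dual2\<close>)
  finally show ?case using a by (simp add: if_distrib[of "\<lambda>x. _ * x"] cong: if_cong)
qed simp

text \<open>
  In difference coordinates the face maps add neighbouring coordinates, after multiplying all coordinates up to
  the first of the two by \<open>e\<close>: \<open>e = 1\<close> gives one family of faces and \<open>e = - 1\<close> the other.
\<close>

fun diff_cob :: "'a::comm_ring_1 \<Rightarrow> ('a list \<Rightarrow> 'b::comm_ring_1) \<Rightarrow> 'a list \<Rightarrow> 'b" where
  "diff_cob e F (u # v # r) = - F ((v + e * u) # r) - diff_cob e (\<lambda>l. F ((e * u) # l)) (v # r)"
| "diff_cob e F _ = 0"

fun twisted_cob :: "nat \<Rightarrow> 'k::comm_ring_1 \<Rightarrow> (nat list \<Rightarrow> 'k) \<Rightarrow> nat list \<Rightarrow> 'k" where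
  "twisted_cob p e G (a # b # r) = - (e ^ a * (if a + b < p then G ((a + b) # r) else 0))
     - e ^ a * twisted_cob p e (\<lambda>l. G (a # l)) (b # r)"
| "twisted_cob p e G _ = 0"

text \<open>
  The coefficient of a merge in the difference is \<open>1 - (-1) ^ S\<close> with \<open>S\<close> the partial sum, hence \<open>2\<close> for odd \<open>S\<close>
  and \<open>0\<close> for even \<open>S\<close>.
\<close>

lemma twisted_cob_diff:
  "twisted_cob p 1 G l - (if od then - 1 else 1) * twisted_cob p (- 1) G l = 2 * merge_cob p od G l"
proof (induction p od G l rule: merge_cob.induct)
  case (1 p od G a b r)
  have "(if odd a \<noteq> od then - 1 else 1 :: 'a) = (if od then - 1 else 1) * (- 1) ^ a"
    by (cases "odd a") auto
  note 2 = "1.IH"[unfolded this]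
  show ?case
    using 2 by (cases "odd a"; cases od) (auto simp: algebra_simps)
qed auto

lemma sum_triangle:
  fixes f :: "nat \<Rightarrow> nat \<Rightarrow> 'k::comm_ring_1"
  shows "(\<Sum>a<p. \<Sum>i\<le>a. f i (a - i)) = (\<Sum>i<p. \<Sum>c<p. if i + c < p then f i c else 0)"
proof -
  have "(\<Sum>a<p. \<Sum>i\<le>a. f i (a - i)) = (\<Sum>(a, i)\<in>Sigma {..<p} (\<lambda>a. {..a}). f i (a - i))"
    by (rule sum.Sigma) auto
  also have "\<dots> = (\<Sum>(i, c)\<in>{(i, c). i + c < p}. f i c)"
    by (rule sum.reindex_bij_witness[of _ "\<lambda>(i, c). (i + c, i)" "\<lambda>(a, i). (i, a - i)"]) auto
  also have "{(i, c). i + c < p} = {ic \<in> {..<p} \<times> {..<p}. fst ic + snd ic < p}" by auto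
  also have "(\<Sum>(i, c)\<in>\<dots>. f i c) = (\<Sum>(i, c)\<in>{..<p} \<times> {..<p}. if i + c < p then f i c else 0)"
    by (subst sum.inter_filter) (auto intro!: sum.cong)
  finally show ?thesis by (simp add: sum.cartesian_product)
qed

text \<open>
  The addition law of the divided powers, with the exponent \<open>0\<close> of the first coordinate split off.
\<close>

lemma sum_dpow_shift:
  fixes u v :: "'p::prime_card mod_ring"
  shows "(\<Sum>a<CARD('p). dpow a (v + e * u) * X a) = (\<Sum>c<CARD('p). dpow c v * X c)
    + (\<Sum>i\<in>{1..<CARD('p)}. dpow i u * (\<Sum>c<CARD('p). dpow c v * (e ^ i * (if i + c < CARD('p) then X (i + c) else 0))))"
proof -
  have split: "{..<CARD('p)} = insert 0 {1..<CARD('p)}" by auto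
  have "(\<Sum>a<CARD('p). dpow a (v + e * u) * X a)
      = (\<Sum>a<CARD('p). \<Sum>i\<le>a. e ^ i * dpow i u * dpow (a - i) v * X (i + (a - i)))"
  proof (rule sum.cong)
    fix a assume "a \<in> {..<CARD('p)}"
    then have "dpow a (v + e * u) = (\<Sum>i\<le>a. dpow i (e * u) * dpow (a - i) v)"
      using dpow_add[of a "e * u" v] by (simp add: add.commute)
    then show "dpow a (v + e * u) * X a = (\<Sum>i\<le>a. e ^ i * dpow i u * dpow (a - i) v * X (i + (a - i)))"
      by (simp add: sum_distrib_right dpow_mult)
  qed simp
  also have "\<dots> = (\<Sum>i<CARD('p). \<Sum>c<CARD('p). if i + c < CARD('p) then e ^ i * dpow i u * dpow c v * X (i + c) else 0)"
    by (rule sum_triangle[where f = "\<lambda>i c. e ^ i * dpow i u * dpow c v * X (i + c)"])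
  also have "\<dots> = (\<Sum>i<CARD('p). dpow i u * (\<Sum>c<CARD('p). dpow c v * (e ^ i * (if i + c < CARD('p) then X (i + c) else 0))))"
    unfolding sum_distrib_left by (intro sum.cong refl) (simp add: mult_ac)
  finally show ?thesis unfolding split[THEN arg_cong[where f = "sum _"]] by simp
qed

lemma diff_cob_cong: "(\<And>l. l \<noteq> [] \<Longrightarrow> length l < length us \<Longrightarrow> F l = F' l) \<Longrightarrow> diff_cob e F us = diff_cob e F' us"
proof (induction e F us arbitrary: F' rule: diff_cob.induct)
  case (1 e F u v r)
  have "diff_cob e (\<lambda>l. F ((e * u) # l)) (v # r) = diff_cob e (\<lambda>l. F' ((e * u) # l)) (v # r)"
    by (rule "1.IH") (use "1.prems" in auto)
  with "1.prems"[of "(v + e * u) # r"] show ?case by simp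
qed auto

lemma diff_cob_sum: "diff_cob e (\<lambda>l. \<Sum>i\<in>I. c i * F i l) us = (\<Sum>i\<in>I. c i * diff_cob e (F i) us)"
proof (induction us arbitrary: F rule: induct_list012)
  case (3 u v r)
  show ?case by (simp add: "3.IH"(2) sum_subtractf sum_negf right_diff_distrib)
qed auto

text \<open>
  Expanding each merged coordinate by the addition law produces exponents \<open>0\<close> that no cell has. Those from
  neighbouring faces cancel, and the first one gives the last term, which is independent of \<open>e\<close> and disappears
  from the difference of the two families.
\<close>

lemma diff_cob_phi:
  fixes G :: "nat list \<Rightarrow> 'p::prime_card mod_ring"
  shows "diff_cob e (phi G) (u # r) = phi (twisted_cob CARD('p) e G) (u # r) - phi G r"
proof (induction r arbitrary: u G)
  case Nil
  show ?case by simp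
next
  case (Cons v r)
  \<comment> \<open>the coefficient of exponent \<open>a\<close> in \<open>phi G (w # r)\<close>, extended by \<open>0\<close> to exponents that no cell has\<close>
  define X where "X a = (if r = [] then G [a] else if a = 0 then 0 else phi (\<lambda>l. G (a # l)) r)" for a
  let ?A = "{..<CARD('p)}" and ?B = "{1..<CARD('p)}"
  have split: "?A = insert 0 ?B" by auto
  have X: "phi G (w # r) = (\<Sum>a\<in>?A. dpow a w * X a)" for w
  proof (cases r)
    case (Cons w' r')
    then show ?thesis unfolding split by (simp add: X_def)
  qed (simp add: X_def)
  have X': "phi (\<lambda>l. case l of [] \<Rightarrow> 0 | c # l' \<Rightarrow> (if i + c < CARD('p) then G ((i + c) # l') else 0)) (v # r)
    = (\<Sum>c<CARD('p). dpow c v * (if i + c < CARD('p) then X (i + c) else 0)) - (if r = [] then 0 else X i)"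
    if "i \<in> ?B" for i
  proof (cases r)
    case (Cons w' r')
    have "phi (\<lambda>l. case c # l of [] \<Rightarrow> 0 | c # l' \<Rightarrow> (if i + c < CARD('p) then G ((i + c) # l') else 0)) r
        = (if i + c < CARD('p) then X (i + c) else 0)" for c
      using that Cons phi_degen[of r "\<lambda>l. 0"] functional_mult_arg[OF phi_functional, of 0 "\<lambda>l. 0" r] by (simp add: X_def)
    with that Cons show ?thesis unfolding split by simp
  next
    case Nil
    then have "X = (\<lambda>a. G [a])" by (simp add: X_def fun_eq_iff)
    with Nil show ?thesis by (simp cong: if_cong)
  qed
  have t: "phi (\<lambda>l. twisted_cob CARD('p) e G (i # l)) (v # r)
    = - (e ^ i * phi (\<lambda>l. case l of [] \<Rightarrow> 0 | c # l' \<Rightarrow> (if i + c < CARD('p) then G ((i + c) # l') else 0)) (v # r))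
      - e ^ i * phi (twisted_cob CARD('p) e (\<lambda>l. G (i # l))) (v # r)" for i
  proof -
    let ?M = "\<lambda>l. case l of [] \<Rightarrow> 0 | c # l' \<Rightarrow> (if i + c < CARD('p) then G ((i + c) # l') else 0)"
    have "phi (\<lambda>l. twisted_cob CARD('p) e G (i # l)) (v # r)
      = phi (\<lambda>l. (- (e ^ i)) * ?M l - e ^ i * twisted_cob CARD('p) e (\<lambda>l. G (i # l)) l) (v # r)"
      by (rule phi_cong) (auto simp: length_Suc_conv)
    then show ?thesis
      unfolding functional_diff_arg[OF phi_functional] functional_mult_arg[OF phi_functional] by simp
  qed
  have r1: "diff_cob e (\<lambda>l. phi G ((e * u) # l)) (v # r)
      = (\<Sum>i\<in>?B. e ^ i * dpow i u * (phi (twisted_cob CARD('p) e (\<lambda>l. G (i # l))) (v # r) - phi (\<lambda>l. G (i # l)) r))"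
  proof -
    have "diff_cob e (\<lambda>l. phi G ((e * u) # l)) (v # r)
      = diff_cob e (\<lambda>l. \<Sum>i\<in>?B. (e ^ i * dpow i u) * phi (\<lambda>l. G (i # l)) l) (v # r)"
      by (rule diff_cob_cong) (auto simp: neq_Nil_conv dpow_mult)
    then show ?thesis by (simp only: diff_cob_sum Cons.IH)
  qed
  have Xr: "phi (\<lambda>l. G (i # l)) r = (if r = [] then 0 else X i)" if "i \<in> ?B" for i
    using that by (simp add: X_def)
  have s: "(\<Sum>i\<in>?B. dpow i u * phi (\<lambda>l. twisted_cob CARD('p) e G (i # l)) (v # r))
    = - (\<Sum>i\<in>?B. dpow i u * (\<Sum>c<CARD('p). dpow c v * (e ^ i * (if i + c < CARD('p) then X (i + c) else 0))))
      - diff_cob e (\<lambda>l. phi G ((e * u) # l)) (v # r)"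
    unfolding r1 sum_negf[symmetric] sum_subtractf[symmetric]
    by (intro sum.cong refl) (simp add: t X' Xr algebra_simps sum_distrib_left)
  have "diff_cob e (phi G) (u # v # r) = - phi G ((v + e * u) # r) - diff_cob e (\<lambda>l. phi G ((e * u) # l)) (v # r)"
    by simp
  also have "\<dots> = phi (twisted_cob CARD('p) e G) (u # v # r) - phi G (v # r)"
    unfolding X sum_dpow_shift phi.simps(1) s by (simp add: algebra_simps)
  finally show ?case .
qed

section \<open>The rack coboundary in difference coordinates\<close>

definition hd0 :: "'a::zero list \<Rightarrow> 'a" where
  "hd0 r = (case r of [] \<Rightarrow> 0 | z # _ \<Rightarrow> z)"

fun diff_coords :: "'a::comm_ring_1 list \<Rightarrow> 'a list" where
  "diff_coords [] = []"
| "diff_coords (x # r) = (x - hd0 r) # diff_coords r"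

fun of_diff_coords :: "'a::comm_ring_1 list \<Rightarrow> 'a list" where
  "of_diff_coords [] = []"
| "of_diff_coords (u # r) = (u + hd0 (of_diff_coords r)) # of_diff_coords r"

lemma diff_coords_of_diff_coords [simp]: "diff_coords (of_diff_coords us) = us"
  by (induction us) auto

lemma of_diff_coords_diff_coords [simp]: "of_diff_coords (diff_coords xs) = xs"
  by (induction xs) auto

lemma length_diff_coords [simp]: "length (diff_coords xs) = length xs"
  by (induction xs) auto

lemma length_of_diff_coords [simp]: "length (of_diff_coords xs) = length xs"
  by (induction xs) auto

lemma diff_coords_eq_Nil [simp]: "diff_coords xs = [] \<longleftrightarrow> xs = []" "of_diff_coords xs = [] \<longleftrightarrow> xs = []"
  by (cases xs; simp)+

definition repeats :: "'a list \<Rightarrow> bool" where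
  "repeats xs \<longleftrightarrow> (\<exists>i. Suc i < length xs \<and> xs ! i = xs ! Suc i)"

lemma degen_diff_coords: "degen (diff_coords xs) \<longleftrightarrow> repeats xs"
proof (induction xs rule: induct_list012)
  case (3 x y r)
  have "repeats (x # y # r) \<longleftrightarrow> x = y \<or> repeats (y # r)"
  proof
    assume "repeats (x # y # r)"
    then obtain i where i: "Suc i < length (x # y # r)" "(x # y # r) ! i = (x # y # r) ! Suc i"
      unfolding repeats_def by blast
    then show "x = y \<or> repeats (y # r)"
      unfolding repeats_def by (cases i) auto
  next
    assume *: "x = y \<or> repeats (y # r)"
    show "repeats (x # y # r)"
    proof (cases "x = y")
      case True
      then show ?thesis unfolding repeats_def by (intro exI[of _ 0]) simp
    next
      case False
      with * obtain i where "Suc i < length (y # r)" "(y # r) ! i = (y # r) ! Suc i"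
        unfolding repeats_def by blast
      then show ?thesis unfolding repeats_def by (intro exI[of _ "Suc i"]) simp
    qed
  qed
  with 3 show ?case by (simp add: hd0_def)
qed (auto simp: repeats_def)

text \<open>
  Both families of faces in one formula: \<open>e = 1\<close> moves nothing, and \<open>e = - 1\<close> reflects the preceding
  entries in the deleted one.
\<close>

definition face :: "'a::comm_ring_1 \<Rightarrow> nat \<Rightarrow> 'a list \<Rightarrow> 'a list" where
  "face e i xs = map (\<lambda>x. e * (x - xs ! (i - 1)) + xs ! (i - 1)) (take (i - 1) xs) @ drop i xs"

lemma face0_face: "face0 i xs = face 1 i xs"
  by (simp add: face0_def face_def)

lemma face1_face: "face1 dihedral_op i xs = face (- 1) i xs"
  by (simp add: face1_def face_def dihedral_op_def)

lemma face_Suc_Cons: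
  assumes "2 \<le> j" "j \<le> length (y # r)"
  shows "diff_coords (face e (Suc j) (x # y # r)) = (e * (x - y)) # diff_coords (face e j (y # r))"
proof -
  from assms(1) obtain k where "j = 2 + k" using le_Suc_ex by blast
  then have j: "j = Suc (Suc k)" by simp
  have "e * (x - w) + w - (e * (y - w) + w) = e * (x - y)" for w
    by (simp add: algebra_simps)
  then show ?thesis by (simp add: face_def j hd0_def)
qed

text \<open>
  The sum omits the face with index \<open>1\<close>, where the two families agree.
\<close>

lemma sum_face:
  "(\<Sum>i = 2..length xs. (- 1) ^ i * F (diff_coords (face e i xs))) = - diff_cob e F (diff_coords xs)"
proof (induction xs arbitrary: F rule: induct_list012)
  case (3 x y r)
  have "(\<Sum>i = 2..length (x # y # r). (- 1) ^ i * F (diff_coords (face e i (x # y # r))))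
    = F (diff_coords (face e 2 (x # y # r)))
      + (\<Sum>i = Suc 2..Suc (length (y # r)). (- 1) ^ i * F (diff_coords (face e i (x # y # r))))"
    by (subst sum.atLeast_Suc_atMost) auto
  also have "diff_coords (face e 2 (x # y # r)) = (y - hd0 r + e * (x - y)) # diff_coords r"
    by (simp add: face_def)
  also have "(\<Sum>i = Suc 2..Suc (length (y # r)). (- 1) ^ i * F (diff_coords (face e i (x # y # r))))
    = (\<Sum>j = 2..length (y # r). (- 1) ^ Suc j * F ((e * (x - y)) # diff_coords (face e j (y # r))))"
    unfolding sum.shift_bounds_cl_Suc_ivl by (rule sum.cong[OF refl]) (simp add: face_Suc_Cons del: diff_coords.simps)
  also have "\<dots> = diff_cob e (\<lambda>l. F ((e * (x - y)) # l)) (diff_coords (y # r))"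
    using "3.IH"(2)[of "\<lambda>l. F ((e * (x - y)) # l)"] by (simp add: sum_negf)
  finally show ?case by (simp add: hd0_def)
qed auto

definition rack_cob :: "('a::comm_ring_1 list \<Rightarrow> 'b::comm_ring_1) \<Rightarrow> 'a list \<Rightarrow> 'b" where
  "rack_cob F xs = (\<Sum>i = 1..length xs. (- 1) ^ i * (F (face 1 i xs) - F (face (- 1) i xs)))"

lemma rack_cob_diff_coords:
  "rack_cob (\<lambda>xs. F (diff_coords xs)) xs = - (diff_cob 1 F (diff_coords xs) - diff_cob (- 1) F (diff_coords xs))"
proof (cases "xs = []")
  case False
  have "rack_cob (\<lambda>xs. F (diff_coords xs)) xs = (\<Sum>i = 2..length xs. (- 1) ^ i * (F (diff_coords (face 1 i xs)) - F (diff_coords (face (- 1) i xs))))"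
    unfolding rack_cob_def using False
    by (subst sum.atLeast_Suc_atMost) (auto simp: face_def numeral_2_eq_2 Suc_le_eq)
  then show ?thesis unfolding right_diff_distrib sum_subtractf sum_face by simp
qed (simp add: rack_cob_def)

definition Phi :: "(nat list \<Rightarrow> 'p::prime_card mod_ring) \<Rightarrow> 'p mod_ring list \<Rightarrow> 'p mod_ring" where
  "Phi G xs = phi G (diff_coords xs)"

definition Psi :: "('p::prime_card mod_ring list \<Rightarrow> 'p mod_ring) \<Rightarrow> nat list \<Rightarrow> 'p mod_ring" where
  "Psi F l = psi (\<lambda>us. F (of_diff_coords us)) l"

lemma Phi_functional: "functional (cells CARD('p) (length xs)) (\<lambda>G. Phi G (xs :: 'p::prime_card mod_ring list))"
  using phi_functional[of "diff_coords xs"] by (simp add: Phi_def)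

lemma Psi_functional: "functional {xs :: 'p::prime_card mod_ring list. length xs = length l} (\<lambda>F. Psi F l)"
  unfolding Psi_def by (rule functional_comp[OF psi_functional]) auto

lemma Phi_cong: "(\<And>l. cell CARD('p) l \<Longrightarrow> length l = length xs \<Longrightarrow> G l = G' l) \<Longrightarrow> Phi G xs = Phi G' xs"
  for xs :: "'p::prime_card mod_ring list"
  unfolding Phi_def by (rule phi_cong) auto

lemma Psi_cong: "(\<And>xs. length xs = length l \<Longrightarrow> F xs = F' xs) \<Longrightarrow> Psi F l = Psi F' l"
  unfolding Psi_def by (rule psi_cong) auto

lemma Phi_repeats: "repeats xs \<Longrightarrow> Phi G xs = 0"
  unfolding Phi_def degen_diff_coords[symmetric] by (rule phi_degen)

lemma Phi_Psi:
  fixes F :: "'p::prime_card mod_ring list \<Rightarrow> 'p mod_ring"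
  assumes "xs \<noteq> []" "\<And>ys. length ys = length xs \<Longrightarrow> repeats ys \<Longrightarrow> F ys = 0"
  shows "Phi (Psi F) xs = F xs"
proof -
  have "phi (psi (\<lambda>us. F (of_diff_coords us))) (diff_coords xs) = F (of_diff_coords (diff_coords xs))"
  proof (rule phi_psi)
    fix us' :: "'p mod_ring list"
    assume "length us' = length (diff_coords xs)" "degen us'"
    then show "F (of_diff_coords us') = 0"
      using degen_diff_coords[of "of_diff_coords us'"] by (intro assms(2)) simp_all
  qed (use assms(1) in simp)
  then show ?thesis by (simp add: Phi_def Psi_def[abs_def])
qed

lemma Psi_Phi: "cell CARD('p) l \<Longrightarrow> l \<noteq> [] \<Longrightarrow> Psi (Phi G :: 'p::prime_card mod_ring list \<Rightarrow> _) l = G l"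
  by (simp add: Phi_def Psi_def psi_phi)

lemma rack_cob_cong:
  assumes "\<And>ys. length ys + 1 = length xs \<Longrightarrow> F ys = F' ys"
  shows "rack_cob F xs = rack_cob F' xs"
  unfolding rack_cob_def by (rule sum.cong) (use assms in \<open>auto simp: face_def\<close>)

lemma rack_cob_mult: "rack_cob (\<lambda>xs. c * F xs) xs = c * rack_cob F xs"
  by (simp add: rack_cob_def sum_distrib_left algebra_simps)

lemma rack_cob_Phi:
  assumes "xs \<noteq> []"
  shows "rack_cob (Phi G) xs = - 2 * Phi (merge_cob CARD('p) False G) (xs :: 'p::prime_card mod_ring list)"
proof -
  obtain u r where ur: "diff_coords xs = u # r" using assms by (cases xs) auto
  have "rack_cob (Phi G) xs = - (phi (twisted_cob CARD('p) 1 G) (diff_coords xs) - phi (twisted_cob CARD('p) (- 1) G) (diff_coords xs))"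
    unfolding Phi_def rack_cob_diff_coords unfolding ur diff_cob_phi by simp
  also have "\<dots> = - phi (\<lambda>l. twisted_cob CARD('p) 1 G l - twisted_cob CARD('p) (- 1) G l) (diff_coords xs)"
    by (simp only: functional_diff_arg[OF phi_functional])
  also have "(\<lambda>l. twisted_cob CARD('p) 1 G l - twisted_cob CARD('p) (- 1) G l) = (\<lambda>l. 2 * merge_cob CARD('p) False G l)"
    using twisted_cob_diff[of "CARD('p)" G _ False] by (simp add: fun_eq_iff)
  finally show ?thesis by (simp add: functional_mult_arg[OF phi_functional] Phi_def[abs_def])
qed

text \<open>
  For lists of length one both sides vanish, although the value of \<open>F\<close> at the empty list is not controlled by
  \<open>Psi F\<close>.
\<close>

lemma Psi_rack_cob:
  fixes F :: "'p::prime_card mod_ring list \<Rightarrow> 'p mod_ring"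
  assumes "cell CARD('p) l" "\<And>ys. length ys + 1 = length l \<Longrightarrow> repeats ys \<Longrightarrow> F ys = 0"
  shows "Psi (rack_cob F) l = - 2 * merge_cob CARD('p) False (Psi F) l"
proof (cases l rule: remdups_adj.cases)
  case 1
  then show ?thesis by (simp add: Psi_def)
next
  case (2 a)
  then have "Psi (rack_cob F) l = Psi (\<lambda>xs. 0 * F xs) l"
    by (intro Psi_cong) (auto simp: rack_cob_def face_def length_Suc_conv)
  also have "\<dots> = 0" by (subst functional_mult_arg[OF Psi_functional]) simp
  finally show ?thesis using 2 by simp
next
  case (3 a b r)
  have "Psi (rack_cob F) l = Psi (rack_cob (Phi (Psi F))) l"
  proof (rule Psi_cong, rule rack_cob_cong)
    fix xs ys :: "'p mod_ring list" assume "length xs = length l" "length ys + 1 = length xs"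
    with 3 assms show "F ys = Phi (Psi F) ys" by (subst Phi_Psi) auto
  qed
  also have "\<dots> = Psi (\<lambda>xs. - 2 * Phi (merge_cob CARD('p) False (Psi F)) xs) l"
    by (rule Psi_cong, rule rack_cob_Phi) (use 3 in auto)
  also have "\<dots> = - 2 * merge_cob CARD('p) False (Psi F) l"
    by (subst functional_mult_arg[OF Psi_functional]) (use 3 assms in \<open>simp add: Psi_Phi\<close>)
  finally show ?thesis .
qed

text \<open>
  The factor cancels the \<open>- 2\<close> relating the rack coboundary to the merges.
\<close>

definition tuple_contraction :: "('p::prime_card mod_ring list \<Rightarrow> 'p mod_ring) \<Rightarrow> 'p mod_ring list \<Rightarrow> 'p mod_ring" where
  "tuple_contraction F xs = - (1 / 2) * Phi (contraction CARD('p) False (Psi F)) xs"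

lemma two_nonzero:
  assumes "odd CARD('p::prime_card)"
  shows "(2 :: 'p mod_ring) \<noteq> 0"
proof
  assume "(2 :: 'p mod_ring) = 0"
  then have "(of_nat 2 :: 'p mod_ring) = 0" by simp
  then have "CARD('p) dvd 2" by (rule of_nat_0_mod_ring_dvd)
  then have "CARD('p) \<le> 2" by (rule dvd_imp_le) simp
  with assms prime_gt_1_nat[OF prime_card[where 'a = 'p]] show False by (cases "CARD('p) = 2") auto
qed

lemma tuple_contraction_homotopy:
  fixes F :: "'p::prime_card mod_ring list \<Rightarrow> 'p mod_ring"
  assumes p: "odd CARD('p)" and xs: "xs \<noteq> []"
    and F: "\<And>ys. length ys = length xs \<Longrightarrow> repeats ys \<Longrightarrow> F ys = 0"
  shows "rack_cob (tuple_contraction F) xs + tuple_contraction (rack_cob F) xs = F xs - Phi (retraction CARD('p) False (Psi F)) xs"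
proof -
  let ?p = "CARD('p)"
  have p1: "1 < ?p" using prime_gt_1_nat[OF prime_card[where 'a = 'p]] .
  note two = two_nonzero[OF p]
  have 1: "rack_cob (tuple_contraction F) xs = Phi (merge_cob ?p False (contraction ?p False (Psi F))) xs"
    unfolding tuple_contraction_def[abs_def] rack_cob_mult rack_cob_Phi[OF xs] using two by simp
  have "Phi (contraction ?p False (Psi (rack_cob F))) xs = Phi (\<lambda>l. - 2 * contraction ?p False (merge_cob ?p False (Psi F)) l) xs"
  proof (rule Phi_cong)
    fix l assume l: "cell ?p l" "length l = length xs"
    have "contraction ?p False (Psi (rack_cob F)) l = contraction ?p False (\<lambda>l. - 2 * merge_cob ?p False (Psi F) l) l"
      by (rule contraction_cong[OF l(1) p p1], rule Psi_rack_cob) (use l F in auto)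
    also have "\<dots> = - 2 * contraction ?p False (merge_cob ?p False (Psi F)) l"
      by (rule functional_mult_arg[OF contraction_functional[OF l(1) p p1]])
    finally show "contraction ?p False (Psi (rack_cob F)) l = - 2 * contraction ?p False (merge_cob ?p False (Psi F)) l" .
  qed
  then have 2: "tuple_contraction (rack_cob F) xs = Phi (contraction ?p False (merge_cob ?p False (Psi F))) xs"
    unfolding tuple_contraction_def functional_mult_arg[OF Phi_functional] using two by simp
  have "Phi (merge_cob ?p False (contraction ?p False (Psi F))) xs + Phi (contraction ?p False (merge_cob ?p False (Psi F))) xs
      = Phi (\<lambda>l. merge_cob ?p False (contraction ?p False (Psi F)) l + contraction ?p False (merge_cob ?p False (Psi F)) l) xs"
    by (rule functional_add_arg[OF Phi_functional, symmetric])
  also have "\<dots> = Phi (\<lambda>l. Psi F l - retraction ?p False (Psi F) l) xs"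
    by (rule Phi_cong) (use homotopy[OF _ p p1, where od = False] in \<open>simp add: aug_cob_def[abs_def]\<close>)
  also have "\<dots> = Phi (Psi F) xs - Phi (retraction ?p False (Psi F)) xs"
    by (rule functional_diff_arg[OF Phi_functional])
  finally show ?thesis unfolding 1 2 using Phi_Psi[OF xs F] by simp
qed

section \<open>Quotient modules and their dimension\<close>

definition fun_module :: "'x set \<Rightarrow> ('k::field, 'x \<Rightarrow> 'k) module" where
  "fun_module S = \<lparr>carrier = {f. \<forall>x. x \<notin> S \<longrightarrow> f x = 0}, monoid.mult = (\<lambda>_ _ _. 0), one = (\<lambda>_. 0),
     zero = (\<lambda>_. 0), add = (\<lambda>f g x. f x + g x), module.smult = (\<lambda>a f x. a * f x)\<rparr>"

lemma vectorspace_transfer: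
  fixes W :: "('k::field, 'w, 'm) module_scheme" and V :: "('k, 'v, 'n) module_scheme"
  assumes W: "vectorspace class_ring W"
    and bij: "bij_betw S (carrier W) (carrier V)"
    and zero: "S \<zero>\<^bsub>W\<^esub> = \<zero>\<^bsub>V\<^esub>"
    and add: "\<And>x y. x \<in> carrier W \<Longrightarrow> y \<in> carrier W \<Longrightarrow> S (x \<oplus>\<^bsub>W\<^esub> y) = S x \<oplus>\<^bsub>V\<^esub> S y"
    and smult: "\<And>a x. x \<in> carrier W \<Longrightarrow> S (a \<odot>\<^bsub>W\<^esub> x) = a \<odot>\<^bsub>V\<^esub> S x"
  shows "vectorspace class_ring V"
    and "vectorspace.fin_dim class_ring W \<Longrightarrow> vectorspace.dim class_ring V = vectorspace.dim class_ring W"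
    and "vectorspace.fin_dim class_ring W \<Longrightarrow> vectorspace.fin_dim class_ring V"
proof -
  interpret W: vectorspace class_ring W by (rule W)
  have car: "carrier V = S ` carrier W" using bij by (simp add: bij_betw_def)
  have inj: "inj_on S (carrier W)" using bij by (simp add: bij_betw_def)
  have "abelian_group V"
  proof (rule abelian_groupI)
    fix x y z assume "x \<in> carrier V" "y \<in> carrier V" "z \<in> carrier V"
    then obtain a b c where [simp]: "x = S a" "y = S b" "z = S c" "a \<in> carrier W" "b \<in> carrier W" "c \<in> carrier W"
      unfolding car by blast
    show "x \<oplus>\<^bsub>V\<^esub> y \<in> carrier V" by (simp add: car add[symmetric])
    show "x \<oplus>\<^bsub>V\<^esub> y \<oplus>\<^bsub>V\<^esub> z = x \<oplus>\<^bsub>V\<^esub> (y \<oplus>\<^bsub>V\<^esub> z)" by (simp add: add[symmetric] W.M.a_assoc)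
    show "x \<oplus>\<^bsub>V\<^esub> y = y \<oplus>\<^bsub>V\<^esub> x" by (simp add: add[symmetric] W.M.a_comm)
    show "\<zero>\<^bsub>V\<^esub> \<oplus>\<^bsub>V\<^esub> x = x" by (simp add: add[symmetric] zero[symmetric])
    show "\<exists>y\<in>carrier V. y \<oplus>\<^bsub>V\<^esub> x = \<zero>\<^bsub>V\<^esub>"
      by (rule bexI[of _ "S (\<ominus>\<^bsub>W\<^esub> a)"]) (simp_all add: car add[symmetric] zero[symmetric] W.M.l_neg)
  qed (simp add: car zero[symmetric])
  moreover have "Module.module class_ring V"
    if "abelian_group V"
  proof (rule moduleI)
    fix a b :: 'k and x y assume "x \<in> carrier V" "y \<in> carrier V"
    then obtain u v where [simp]: "x = S u" "y = S v" "u \<in> carrier W" "v \<in> carrier W"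
      unfolding car by blast
    have cl: "c \<odot>\<^bsub>W\<^esub> w \<in> carrier W" if "w \<in> carrier W" for c w
      using W.smult_closed[of c w] that by (simp add: class_ring_simps)
    show "a \<odot>\<^bsub>V\<^esub> x \<in> carrier V" by (simp add: car smult[symmetric] cl)
    show "(a \<oplus>\<^bsub>class_ring\<^esub> b) \<odot>\<^bsub>V\<^esub> x = a \<odot>\<^bsub>V\<^esub> x \<oplus>\<^bsub>V\<^esub> b \<odot>\<^bsub>V\<^esub> x"
      using W.smult_l_distr[of a b u] by (simp add: smult[symmetric] add[symmetric] cl)
    show "a \<odot>\<^bsub>V\<^esub> (x \<oplus>\<^bsub>V\<^esub> y) = a \<odot>\<^bsub>V\<^esub> x \<oplus>\<^bsub>V\<^esub> a \<odot>\<^bsub>V\<^esub> y"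
      using W.smult_r_distr[of a u v] by (simp add: smult[symmetric] add[symmetric] cl)
    show "(a \<otimes>\<^bsub>class_ring\<^esub> b) \<odot>\<^bsub>V\<^esub> x = a \<odot>\<^bsub>V\<^esub> (b \<odot>\<^bsub>V\<^esub> x)"
      using W.smult_assoc1[of a b u] by (simp add: smult[symmetric] cl)
    show "\<one>\<^bsub>class_ring\<^esub> \<odot>\<^bsub>V\<^esub> x = x"
      using W.smult_one[of u] by (simp add: smult[symmetric])
  qed (use that class_cring.cring_axioms in auto)
  ultimately show V: "vectorspace class_ring V"
    by (intro vectorspace.intro class_field) auto
  have lin: "linear_map class_ring W V S"
  proof (intro linear_map.intro mod_hom.intro)
    show "mod_hom_axioms class_ring W V S"
      unfolding mod_hom_axioms_def LinearCombinations.module_hom_def using add smult car by auto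
  qed (rule W V vectorspace.axioms(1)[OF W] vectorspace.axioms(1)[OF V])+
  assume fin: "vectorspace.fin_dim class_ring W"
  from linear_map.dim_eq[OF lin fin inj] car
  show "vectorspace.dim class_ring V = vectorspace.dim class_ring W" by simp
  from linear_map.image_fin_dim[OF lin fin] car show "vectorspace.fin_dim class_ring V" by simp
qed

lemma fun_module_dim:
  assumes "finite S"
  shows "vectorspace class_ring (fun_module S :: ('k::field, 'x \<Rightarrow> 'k) module)"
    and "vectorspace.fin_dim class_ring (fun_module S :: ('k::field, 'x \<Rightarrow> 'k) module)"
    and "vectorspace.dim class_ring (fun_module S :: ('k::field, 'x \<Rightarrow> 'k) module) = card S"
proof -
  let ?n = "card S" and ?F = "fun_module S :: ('k, 'x \<Rightarrow> 'k) module"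
  interpret V: vec_space "TYPE('k)" ?n .
  obtain h where h: "bij_betw h S {..<?n}"
    using ex_bij_betw_finite_nat[OF assms] atLeast0LessThan by auto
  define T where "T v = (\<lambda>x. if x \<in> S then v $ h x else 0)" for v :: "'k vec"
  have hS: "h x < ?n" if "x \<in> S" for x using h that by (auto simp: bij_betw_def)
  have 1: "bij_betw T (carrier (module_vec TYPE('k) ?n)) (carrier ?F)"
  proof (rule bij_betw_byWitness[where f' = "\<lambda>f. vec ?n (\<lambda>i. f (inv_into S h i))"])
    show "\<forall>v\<in>carrier (module_vec TYPE('k) ?n). vec ?n (\<lambda>i. T v (inv_into S h i)) = v"
    proof
      fix v assume "v \<in> carrier (module_vec TYPE('k) ?n)"
      then have "dim_vec v = ?n" by (simp add: module_vec_simps)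
      then show "vec ?n (\<lambda>i. T v (inv_into S h i)) = v"
        using bij_betw_inv_into_right[OF h] bij_betwE[OF bij_betw_inv_into[OF h]]
        by (intro eq_vecI) (auto simp: T_def)
    qed
    show "\<forall>f\<in>carrier ?F. T (vec ?n (\<lambda>i. f (inv_into S h i))) = f"
      using hS bij_betw_inv_into_left[OF h] by (auto simp: T_def fun_module_def fun_eq_iff)
  qed (auto simp: T_def fun_module_def module_vec_simps)
  have 2: "T \<zero>\<^bsub>module_vec TYPE('k) ?n\<^esub> = \<zero>\<^bsub>?F\<^esub>"
    using hS by (auto simp: T_def fun_module_def module_vec_simps fun_eq_iff)
  have 3: "T (x \<oplus>\<^bsub>module_vec TYPE('k) ?n\<^esub> y) = T x \<oplus>\<^bsub>?F\<^esub> T y"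
    if "x \<in> carrier (module_vec TYPE('k) ?n)" "y \<in> carrier (module_vec TYPE('k) ?n)" for x y
    using hS that by (auto simp: T_def fun_module_def module_vec_simps fun_eq_iff)
  have 4: "T (a \<odot>\<^bsub>module_vec TYPE('k) ?n\<^esub> x) = a \<odot>\<^bsub>?F\<^esub> T x"
    if "x \<in> carrier (module_vec TYPE('k) ?n)" for a x
    using hS that by (auto simp: T_def fun_module_def module_vec_simps fun_eq_iff)
  have vs: "vectorspace class_ring (module_vec TYPE('k) ?n)" by (rule V.vectorspace_axioms)
  show "vectorspace class_ring ?F"
    by (rule vectorspace_transfer(1)[OF vs 1 2]; simp only: 3 4)
  have "vectorspace.dim class_ring ?F = vectorspace.dim class_ring (module_vec TYPE('k) ?n)"
  proof (rule vectorspace_transfer(2)[OF vs 1 2])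
    show "vectorspace.fin_dim class_ring (module_vec TYPE('k) ?n)" by (rule V.fin_dim)
  qed (simp only: 3 4)+
  then show "vectorspace.dim class_ring ?F = card S" by (simp only: V.dim_is_n)
  show "vectorspace.fin_dim class_ring ?F"
  proof (rule vectorspace_transfer(3)[OF vs 1 2])
    show "vectorspace.fin_dim class_ring (module_vec TYPE('k) ?n)" by (rule V.fin_dim)
  qed (simp only: 3 4)+
qed

text \<open>
  Cosets of the kernel of \<open>f\<close> are its fibres. Describing the quotient through the fibres keeps all computations with
  nested cosets inside a concrete space of functions.
\<close>

lemma quotient_fibres:
  fixes M :: "('k::comm_ring_1, 'v, 'm) module_scheme" and f :: "'v \<Rightarrow> 'x \<Rightarrow> 'k"
  assumes add: "\<And>x y. x \<in> carrier M \<Longrightarrow> y \<in> carrier M \<Longrightarrow>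
        x \<oplus>\<^bsub>M\<^esub> y \<in> carrier M \<and> f (x \<oplus>\<^bsub>M\<^esub> y) = (\<lambda>z. f x z + f y z)"
    and smult: "\<And>a x. x \<in> carrier M \<Longrightarrow> a \<odot>\<^bsub>M\<^esub> x \<in> carrier M \<and> f (a \<odot>\<^bsub>M\<^esub> x) = (\<lambda>z. a * f x z)"
    and diff: "\<And>x y. x \<in> carrier M \<Longrightarrow> y \<in> carrier M \<Longrightarrow> \<exists>z\<in>carrier M. x = z \<oplus>\<^bsub>M\<^esub> y"
    and N: "N = {x \<in> carrier M. f x = (\<lambda>z. 0)}"
  defines "fib \<equiv> \<lambda>w. {x \<in> carrier M. f x = w}"
  shows coset_fibre: "\<And>x. x \<in> carrier M \<Longrightarrow> N +>\<^bsub>M\<^esub> x = fib (f x)"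
    and "carrier (quotient_module M N) = fib ` (f ` carrier M)"
    and "\<zero>\<^bsub>quotient_module M N\<^esub> = fib (\<lambda>z. 0)"
    and "\<And>w w'. w \<in> f ` carrier M \<Longrightarrow> w' \<in> f ` carrier M \<Longrightarrow>
        fib w \<oplus>\<^bsub>quotient_module M N\<^esub> fib w' = fib (\<lambda>z. w z + w' z)"
    and "\<And>a w. w \<in> f ` carrier M \<Longrightarrow> a \<odot>\<^bsub>quotient_module M N\<^esub> fib w = fib (\<lambda>z. a * w z)"
    and "inj_on fib (f ` carrier M)"
proof -
  have diff': "\<exists>z\<in>carrier M. x = z \<oplus>\<^bsub>M\<^esub> y \<and> f z = (\<lambda>t. f x t - f y t)"
    if xy: "x \<in> carrier M" "y \<in> carrier M" for x y
  proof -
    from diff[OF xy] obtain z where "z \<in> carrier M" "x = z \<oplus>\<^bsub>M\<^esub> y" by blast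
    with add[of z y] xy show ?thesis by (intro bexI[of _ z]) auto
  qed
  show c: "N +>\<^bsub>M\<^esub> x = fib (f x)" if x: "x \<in> carrier M" for x
  proof (intro equalityI subsetI)
    fix y assume "y \<in> N +>\<^bsub>M\<^esub> x"
    then obtain h where "h \<in> carrier M" "f h = (\<lambda>z. 0)" "y = h \<oplus>\<^bsub>M\<^esub> x" unfolding N a_r_coset_def' by auto
    with add[of h x] x show "y \<in> fib (f x)" unfolding fib_def by simp
  next
    fix y assume "y \<in> fib (f x)"
    with diff'[of y x] x obtain h where "h \<in> carrier M" "y = h \<oplus>\<^bsub>M\<^esub> x" "f h = (\<lambda>z. 0)"
      unfolding fib_def by auto
    then show "y \<in> N +>\<^bsub>M\<^esub> x" unfolding N a_r_coset_def' by auto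
  qed
  show "carrier (quotient_module M N) = fib ` (f ` carrier M)"
    unfolding quotient_module_def A_RCOSETS_def' using c by auto
  show "\<zero>\<^bsub>quotient_module M N\<^esub> = fib (\<lambda>z. 0)"
    unfolding quotient_module_def N fib_def by simp
  show "fib w \<oplus>\<^bsub>quotient_module M N\<^esub> fib w' = fib (\<lambda>z. w z + w' z)"
    if "w \<in> f ` carrier M" "w' \<in> f ` carrier M" for w w'
  proof -
    have "fib w <+>\<^bsub>M\<^esub> fib w' = fib (\<lambda>z. w z + w' z)"
    proof (intro equalityI subsetI)
      fix y assume "y \<in> fib w <+>\<^bsub>M\<^esub> fib w'"
      then obtain x x' where "x \<in> fib w" "x' \<in> fib w'" "y = x \<oplus>\<^bsub>M\<^esub> x'" unfolding set_add_def' by auto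
      with add[of x x'] show "y \<in> fib (\<lambda>z. w z + w' z)" unfolding fib_def by auto
    next
      fix y assume y: "y \<in> fib (\<lambda>z. w z + w' z)"
      from that obtain x' where x': "x' \<in> carrier M" "f x' = w'" by auto
      with diff'[of y x'] y obtain x where "x \<in> carrier M" "y = x \<oplus>\<^bsub>M\<^esub> x'" "f x = w"
        unfolding fib_def by auto
      with x' show "y \<in> fib w <+>\<^bsub>M\<^esub> fib w'" unfolding set_add_def' fib_def by auto
    qed
    then show ?thesis by (simp add: quotient_module_def)
  qed
  show "a \<odot>\<^bsub>quotient_module M N\<^esub> fib w = fib (\<lambda>z. a * w z)" if "w \<in> f ` carrier M" for a w
  proof -
    have "N +>\<^bsub>M\<^esub> (a \<odot>\<^bsub>M\<^esub> v) = fib (\<lambda>z. a * w z)" if "v \<in> fib w" for v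
      using c[of "a \<odot>\<^bsub>M\<^esub> v"] smult[of v a] that unfolding fib_def by auto
    moreover have "fib w \<noteq> {}" using that unfolding fib_def by auto
    ultimately show ?thesis by (simp add: quotient_module_def)
  qed
  show "inj_on fib (f ` carrier M)"
    unfolding fib_def by (rule inj_onI) auto
qed

text \<open>
  The form of the isomorphism theorem used for homology and cohomology: the module is parametrised by a space \<open>U\<close>
  of functions, and \<open>g\<close> reads off the coordinates of a class.
\<close>

lemma dim_quotient:
  fixes M :: "('k::field, 'v, 'm) module_scheme" and g :: "('x \<Rightarrow> 'k) \<Rightarrow> 'y \<Rightarrow> 'k"
  assumes "finite K"
    and U: "\<And>u v. u \<in> U \<Longrightarrow> v \<in> U \<Longrightarrow> (\<lambda>x. u x + v x) \<in> U" "\<And>a u. u \<in> U \<Longrightarrow> (\<lambda>x. a * u x) \<in> U"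
    and S: "inj_on S U" "carrier M = S ` U"
      "\<And>u v. u \<in> U \<Longrightarrow> v \<in> U \<Longrightarrow> S u \<oplus>\<^bsub>M\<^esub> S v = S (\<lambda>x. u x + v x)"
      "\<And>a u. u \<in> U \<Longrightarrow> a \<odot>\<^bsub>M\<^esub> S u = S (\<lambda>x. a * u x)"
    and g: "\<And>u v. u \<in> U \<Longrightarrow> v \<in> U \<Longrightarrow> g (\<lambda>x. u x + v x) = (\<lambda>y. g u y + g v y)"
      "\<And>a u. u \<in> U \<Longrightarrow> g (\<lambda>x. a * u x) = (\<lambda>y. a * g u y)"
      "g ` U = {f. \<forall>y. y \<notin> K \<longrightarrow> f y = 0}"
    and N: "N = S ` {u \<in> U. g u = (\<lambda>y. 0)}"
  shows "vectorspace.dim class_ring (quotient_module M N) = card K"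
proof -
  define f where "f x = g (inv_into U S x)" for x
  have f: "f (S u) = g u" if "u \<in> U" for u using S(1) that by (simp add: f_def)
  have fM: "f ` carrier M = carrier (fun_module K :: ('k, 'y \<Rightarrow> 'k) module)"
    using g(3) f unfolding S(2) image_image fun_module_def by simp
  have N': "N = {x \<in> carrier M. f x = (\<lambda>z. 0)}" unfolding N S(2) using f by auto
  have Udiff: "(\<lambda>x. u x - v x) \<in> U" if "u \<in> U" "v \<in> U" for u v
    using U(1)[OF that(1) U(2)[OF that(2), of "- 1"]] by simp
  have 1: "x \<oplus>\<^bsub>M\<^esub> y \<in> carrier M \<and> f (x \<oplus>\<^bsub>M\<^esub> y) = (\<lambda>z. f x z + f y z)" if "x \<in> carrier M" "y \<in> carrier M" for x y
  proof -
    from that obtain u v where "x = S u" "y = S v" "u \<in> U" "v \<in> U" unfolding S(2) by blast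
    then show ?thesis using S(3) U(1) g(1) by (simp add: f S(2))
  qed
  have 2: "a \<odot>\<^bsub>M\<^esub> x \<in> carrier M \<and> f (a \<odot>\<^bsub>M\<^esub> x) = (\<lambda>z. a * f x z)" if "x \<in> carrier M" for a x
  proof -
    from that obtain u where "x = S u" "u \<in> U" unfolding S(2) by blast
    then show ?thesis using S(4) U(2) g(2) by (simp add: f S(2))
  qed
  have 3: "\<exists>z\<in>carrier M. x = z \<oplus>\<^bsub>M\<^esub> y" if "x \<in> carrier M" "y \<in> carrier M" for x y
  proof -
    from that obtain u v where uv: "x = S u" "y = S v" "u \<in> U" "v \<in> U" unfolding S(2) by blast
    then have "x = S (\<lambda>x. u x - v x) \<oplus>\<^bsub>M\<^esub> y" using S(3)[OF Udiff[OF uv(3,4)] uv(4)] by simp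
    then show ?thesis using Udiff[OF uv(3,4)] unfolding S(2) by blast
  qed
  note q = quotient_fibres[of M f N, OF 1 2 3 N']
  let ?fib = "\<lambda>w. {x \<in> carrier M. f x = w}"
  note W = fun_module_dim[OF \<open>finite K\<close>, where 'k = 'k]
  have "vectorspace.dim class_ring (quotient_module M N)
      = vectorspace.dim class_ring (fun_module K :: ('k, 'y \<Rightarrow> 'k) module)"
  proof (rule vectorspace_transfer(2)[OF W(1) _ _ _ _ W(2)])
    show "bij_betw ?fib (carrier (fun_module K :: ('k, 'y \<Rightarrow> 'k) module)) (carrier (quotient_module M N))"
      using q(2,6) unfolding fM bij_betw_def by auto
  qed (use q(3-5) in \<open>simp_all add: fM, simp_all add: fun_module_def\<close>)
  with W(3) show ?thesis by simp
qed

section \<open>Cochains and chains on nondegenerate tuples\<close>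

text \<open>
  Degenerate lists form a subcomplex over every ring of values, which is needed for the integers as well as for the
  field: the value does not depend on \<open>e\<close>, so it cancels in the difference of the two families.
\<close>

lemma diff_cob_degen:
  assumes "degen us" "\<And>us'. degen us' \<Longrightarrow> F us' = 0"
  shows "diff_cob e F us = - F (tl us)"
  using assms
proof (induction us arbitrary: F rule: induct_list012)
  case (3 u v r)
  show ?case
  proof (cases "u = 0")
    case True
    have "diff_cob e (\<lambda>l. F ((e * u) # l)) (v # r) = diff_cob e (\<lambda>l. 0) (v # r)"
      by (rule diff_cob_cong) (use True "3.prems"(2) in \<open>auto simp: neq_Nil_conv\<close>)
    also have "\<dots> = 0" using diff_cob_sum[where e = e and I = "{}" and us = "v # r"] by simp
    finally show ?thesis using True by simp
  next
    case False
    then have d: "degen (v # r)" using "3.prems"(1) by simp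
    then obtain w r' where r: "r = w # r'" by (cases r) auto
    have "diff_cob e (\<lambda>l. F ((e * u) # l)) (v # r) = - F ((e * u) # r)"
    proof -
      have "F ((e * u) # us') = 0" if "degen us'" for us'
        using that by (intro "3.prems"(2)) (cases us'; auto)
      from "3.IH"(2)[OF d this] show ?thesis by simp
    qed
    then show ?thesis using d r "3.prems"(2)[of "v # r"]
      by (cases "v = 0") (auto simp: "3.prems"(2))
  qed
qed auto

text \<open>
  The functions on the quotient by the degenerate chains.
\<close>

definition vanishing :: "('a list \<Rightarrow> 'b::zero) \<Rightarrow> bool" where
  "vanishing F \<longleftrightarrow> (\<forall>xs. repeats xs \<longrightarrow> F xs = 0)"

lemma rack_cob_repeats:
  assumes "repeats xs" "vanishing F"
  shows "rack_cob F xs = 0"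
proof -
  have "rack_cob F xs = rack_cob (\<lambda>xs. F (of_diff_coords (diff_coords xs))) xs" by simp
  also have "\<dots> = 0"
    using assms degen_diff_coords[of "of_diff_coords us" for us]
    unfolding rack_cob_diff_coords[where F = "\<lambda>us. F (of_diff_coords us)"]
    by (subst (1 2) diff_cob_degen) (auto simp: degen_diff_coords vanishing_def)
  finally show ?thesis .
qed

lemma vanishing_rack_cob: "vanishing F \<Longrightarrow> vanishing (rack_cob F)"
  using rack_cob_repeats by (auto simp: vanishing_def)

lemma vanishing_tuple_contraction: "vanishing (tuple_contraction F)"
  by (simp add: vanishing_def tuple_contraction_def Phi_repeats)

definition ind :: "'a \<Rightarrow> 'a \<Rightarrow> 'b::zero_neq_one" where
  "ind x = (\<lambda>y. if y = x then 1 else 0)"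

definition nondeg :: "nat \<Rightarrow> 'a list set" where
  "nondeg n = {xs. length xs = n \<and> \<not> repeats xs}"

lemma finite_nondeg [simp]: "finite (nondeg n :: 'a::finite list set)"
  by (rule finite_subset[OF _ finite_length[of n]]) (auto simp: nondeg_def)

lemma vanishing_ind: "x \<in> nondeg n \<Longrightarrow> vanishing (ind x)"
  by (auto simp: vanishing_def ind_def nondeg_def)

lemma functional_expand_nondeg:
  fixes F :: "'a::finite list \<Rightarrow> 'b::comm_ring_1"
  assumes "functional {xs. length xs = n} L" "vanishing F"
  shows "L F = (\<Sum>x\<in>nondeg n. F x * L (ind x))"
proof -
  have "L F = (\<Sum>x\<in>{xs. length xs = n}. F x * L (ind x))"
    unfolding ind_def by (rule functional_expand[OF assms(1) finite_length])
  also have "\<dots> = (\<Sum>x\<in>nondeg n. F x * L (ind x))"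
    by (rule sum.mono_neutral_right) (use assms(2) in \<open>auto simp: nondeg_def vanishing_def\<close>)
  finally show ?thesis .
qed

lemma rack_cob_functional:
  "functional {ys :: 'a::{comm_ring_1,finite} list. length ys = length xs - 1} (\<lambda>F. rack_cob F xs)"
  unfolding rack_cob_def diff_conv_add_uminus
  by (intro functional_sum functional_mult functional_add functional_uminus functional_point)
    (auto simp: face_def)

text \<open>
  The boundary of a chain supported on nondegenerate tuples, as the transpose of the rack coboundary.
\<close>

definition tuple_boundary :: "nat \<Rightarrow> ('a::{comm_ring_1,finite} list \<Rightarrow> 'b::comm_ring_1) \<Rightarrow> 'a list \<Rightarrow> 'b" where
  "tuple_boundary n w y = (if y \<in> nondeg (n - 1) then \<Sum>x\<in>nondeg n. w x * rack_cob (ind y) x else 0)"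

definition pair :: "nat \<Rightarrow> ('a::finite list \<Rightarrow> 'b::comm_ring_1) \<Rightarrow> ('a list \<Rightarrow> 'b) \<Rightarrow> 'b" where
  "pair n F w = (\<Sum>x\<in>nondeg n. w x * F x)"

lemma pair_tuple_boundary:
  assumes "vanishing F"
  shows "pair (n - 1) F (tuple_boundary n w) = pair n (rack_cob F) w"
proof -
  have "pair (n - 1) F (tuple_boundary n w) = (\<Sum>y\<in>nondeg (n - 1). \<Sum>x\<in>nondeg n. w x * (F y * rack_cob (ind y) x))"
    unfolding pair_def by (rule sum.cong) (simp_all add: tuple_boundary_def sum_distrib_left mult_ac)
  also have "\<dots> = (\<Sum>x\<in>nondeg n. w x * (\<Sum>y\<in>nondeg (n - 1). F y * rack_cob (ind y) x))"
    by (subst sum.swap) (simp add: sum_distrib_left)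
  also have "\<dots> = pair n (rack_cob F) w"
    unfolding pair_def
  proof (rule sum.cong)
    fix x :: "'a list" assume "x \<in> nondeg n"
    then have "length x = n" by (simp add: nondeg_def)
    with functional_expand_nondeg[OF rack_cob_functional[of x] assms]
    show "w x * (\<Sum>y\<in>nondeg (n - 1). F y * rack_cob (ind y) x) = w x * rack_cob F x" by simp
  qed simp
  finally show ?thesis .
qed

lemma pair_ind: "y \<in> nondeg n \<Longrightarrow> pair n (ind y) w = w y"
  by (simp add: pair_def ind_def if_distrib[of "\<lambda>x. _ * x"] cong: if_cong)

definition nondeg_functions :: "nat \<Rightarrow> ('a list \<Rightarrow> 'b::zero) set" where
  "nondeg_functions n = {w. \<forall>x. x \<notin> nondeg n \<longrightarrow> w x = 0}"

lemma vanishing_nondeg_functions: "F \<in> nondeg_functions n \<Longrightarrow> vanishing F"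
  by (auto simp: nondeg_functions_def vanishing_def nondeg_def)

lemma tuple_boundary_nondeg_functions: "tuple_boundary n w \<in> nondeg_functions (n - 1)"
  by (simp add: tuple_boundary_def nondeg_functions_def)

lemma tuple_contraction_functional: "functional {ys :: 'p::prime_card mod_ring list. length ys = Suc (length xs)} (\<lambda>F. tuple_contraction F xs)"
  if "odd CARD('p)"
proof -
  have p1: "1 < CARD('p)" using prime_gt_1_nat[OF prime_card[where 'a = 'p]] .
  show ?thesis unfolding tuple_contraction_def
  proof (rule functional_mult, rule functional_bind[OF Phi_functional])
    fix l assume "l \<in> cells CARD('p) (length xs)"
    then have l: "cell CARD('p) l" "length l = length xs" by (auto simp: cells_def)
    show "functional {ys :: 'p mod_ring list. length ys = Suc (length xs)} (\<lambda>F. contraction CARD('p) False (Psi F) l)"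
    proof (rule functional_bind[OF contraction_functional[OF l(1) that p1]])
      fix l' assume "l' \<in> cells CARD('p) (Suc (length l))"
      with l Psi_functional[of l', where 'p = 'p]
      show "functional {ys :: 'p mod_ring list. length ys = Suc (length xs)} (\<lambda>F. Psi F l')"
        by (simp add: cells_def)
    qed
  qed
qed

text \<open>
  The cocycle dual to a critical cell.
\<close>

definition critical_cocycle :: "nat list \<Rightarrow> 'p::prime_card mod_ring list \<Rightarrow> 'p mod_ring" where
  "critical_cocycle k = Phi (retraction CARD('p) False (ind k))"

lemma vanishing_critical_cocycle: "vanishing (critical_cocycle k)"
  by (simp add: vanishing_def critical_cocycle_def Phi_repeats)

context
  assumes odd_p: "odd CARD('p::prime_card)"
begin

lemma p_gt_1: "1 < CARD('p)"
  using prime_gt_1_nat[OF prime_card[where 'a = 'p]] .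

lemma rack_cob_critical_cocycle:
  assumes "xs \<noteq> []"
  shows "rack_cob (critical_cocycle k) (xs :: 'p mod_ring list) = 0"
proof -
  have "Phi (merge_cob CARD('p) False (retraction CARD('p) False (ind k))) xs = Phi (\<lambda>l. 0) xs"
    by (rule Phi_cong) (use aug_cob_retraction[OF _ odd_p p_gt_1, where od = False] in \<open>simp add: aug_cob_def\<close>)
  then show ?thesis
    unfolding critical_cocycle_def rack_cob_Phi[OF assms] by (simp add: functional_zero_arg[OF Phi_functional])
qed

lemma rack_cob_rack_cob:
  fixes F :: "'p mod_ring list \<Rightarrow> 'p mod_ring"
  assumes "vanishing F"
  shows "rack_cob (rack_cob F) xs = 0"
proof (cases "length xs \<le> 1")
  case True
  then consider "xs = []" | x where "xs = [x]" by (cases xs) auto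
  then show ?thesis
    by cases (simp_all add: rack_cob_def face_def)
next
  case False
  have "rack_cob (rack_cob F) xs = rack_cob (\<lambda>ys. - 2 * Phi (merge_cob CARD('p) False (Psi F)) ys) xs"
  proof (rule rack_cob_cong)
    fix ys :: "'p mod_ring list" assume ys: "length ys + 1 = length xs"
    with False have "ys \<noteq> []" by auto
    show "rack_cob F ys = - 2 * Phi (merge_cob CARD('p) False (Psi F)) ys"
    proof (cases "length ys = 1")
      case True
      then obtain y where "ys = [y]" by (cases ys) auto
      moreover have "rack_cob F [y] = 0" by (simp add: rack_cob_def face_def)
      moreover have "Phi (merge_cob CARD('p) False (Psi F)) [y] = 0"
        by (simp add: Phi_def)
      ultimately show ?thesis by simp
    next
      case 2: False
      have "rack_cob F ys = rack_cob (Phi (Psi F)) ys"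
      proof (rule rack_cob_cong)
        fix zs :: "'p mod_ring list" assume "length zs + 1 = length ys"
        with 2 \<open>ys \<noteq> []\<close> have "zs \<noteq> []" by (cases ys) auto
        then show "F zs = Phi (Psi F) zs" using assms by (simp add: Phi_Psi vanishing_def)
      qed
      then show ?thesis by (simp only: rack_cob_Phi[OF \<open>ys \<noteq> []\<close>])
    qed
  qed
  also have "\<dots> = 0"
    using False unfolding rack_cob_mult
    by (subst rack_cob_Phi) (auto simp: merge_cob_merge_cob[abs_def] functional_zero_arg[OF Phi_functional])
  finally show ?thesis .
qed

text \<open>
  Every cochain is a combination of critical cocycles up to the two homotopy terms; the coefficients are its values on
  the critical cells.
\<close>

lemma cochain_homotopy:
  fixes F :: "'p mod_ring list \<Rightarrow> 'p mod_ring"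
  assumes "xs \<noteq> []" "vanishing F"
  shows "F xs = (\<Sum>k\<in>critical_cells CARD('p) False (length xs). Psi F k * critical_cocycle k xs)
    + rack_cob (tuple_contraction F) xs + tuple_contraction (rack_cob F) xs"
proof -
  have "functional (critical_cells CARD('p) False (length xs)) (\<lambda>G. Phi (retraction CARD('p) False G) xs)"
  proof (rule functional_bind[OF Phi_functional])
    fix l assume "l \<in> cells CARD('p) (length xs)"
    then have l: "length xs = length l" by (simp add: cells_def)
    show "functional (critical_cells CARD('p) False (length xs)) (\<lambda>G :: nat list \<Rightarrow> 'p mod_ring. retraction CARD('p) False G l)"
      unfolding l by (rule retraction_functional[OF odd_p p_gt_1])
  qed
  from functional_expand[OF this finite_critical_cells[OF odd_p p_gt_1], folded ind_def, of "Psi F"]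
  have "Phi (retraction CARD('p) False (Psi F)) xs = (\<Sum>k\<in>critical_cells CARD('p) False (length xs). Psi F k * critical_cocycle k xs)"
    by (simp add: critical_cocycle_def)
  with tuple_contraction_homotopy[OF odd_p assms(1), of F] assms(2) show ?thesis
    by (simp add: vanishing_def algebra_simps)
qed

lemma Psi_rack_cob_crit:
  fixes F :: "'p mod_ring list \<Rightarrow> 'p mod_ring"
  assumes "vanishing F" "crit CARD('p) False k"
  shows "Psi (rack_cob F) k = 0"
  using Psi_rack_cob[OF crit_cell[OF assms(2) odd_p p_gt_1], of F] assms(1)
    aug_cob_crit[OF assms(2) odd_p p_gt_1, of "Psi F"]
  by (simp add: vanishing_def aug_cob_def)

lemma Psi_critical_cocycle:
  assumes "k \<in> critical_cells CARD('p) False n" "n \<ge> 1"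
  shows "Psi (critical_cocycle k' :: 'p mod_ring list \<Rightarrow> _) k = ind k' k"
proof -
  have "crit CARD('p) False k" "k \<noteq> []" using assms by (auto simp: critical_cells_def)
  then show ?thesis
    unfolding critical_cocycle_def
    by (simp add: Psi_Phi crit_cell[OF _ odd_p p_gt_1] retraction_crit[OF _ odd_p p_gt_1])
qed

text \<open>
  The transpose of the contraction, applied to \<open>w\<close>, bounds \<open>w\<close>: this is tested against the indicator functions of tuples with
  the homotopy for cochains, whose other terms vanish on \<open>w\<close>.
\<close>

lemma tuple_boundary_kernel:
  fixes w :: "'p mod_ring list \<Rightarrow> 'p mod_ring"
  assumes n: "n \<ge> 1" and w: "w \<in> nondeg_functions n" "tuple_boundary n w = (\<lambda>_. 0)"
    and k: "\<And>k. k \<in> critical_cells CARD('p) False n \<Longrightarrow> pair n (critical_cocycle k) w = 0"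
  shows "\<exists>w'\<in>nondeg_functions (Suc n). w = tuple_boundary (Suc n) w'"
proof -
  define w' where "w' = (\<lambda>z. if z \<in> nondeg (Suc n) then pair n (tuple_contraction (ind z)) w else 0)"
  have "tuple_boundary (Suc n) w' y = w y" for y
  proof (cases "y \<in> nondeg n")
    case True
    let ?F = "ind y :: 'p mod_ring list \<Rightarrow> 'p mod_ring"
    note van = vanishing_ind[OF True, where 'b = "'p mod_ring"]
    have "tuple_boundary (Suc n) w' y = pair n ?F (tuple_boundary (Suc n) w')" by (rule pair_ind[OF True, symmetric])
    also have "\<dots> = pair (Suc n) (rack_cob ?F) w'" using pair_tuple_boundary[OF van, of "Suc n" w'] by simp
    also have "\<dots> = (\<Sum>x\<in>nondeg n. w x * (\<Sum>z\<in>nondeg (Suc n). rack_cob ?F z * tuple_contraction (ind z) x))"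
      unfolding pair_def w'_def sum_distrib_left
      by (subst sum.swap) (simp add: sum_distrib_right sum_distrib_left mult_ac)
    also have "\<dots> = pair n (tuple_contraction (rack_cob ?F)) w"
      unfolding pair_def
    proof (rule sum.cong)
      fix x :: "'p mod_ring list" assume "x \<in> nondeg n"
      then have "length x = n" by (simp add: nondeg_def)
      with functional_expand_nondeg[OF tuple_contraction_functional[OF odd_p, of x] vanishing_rack_cob[OF van]]
      show "w x * (\<Sum>z\<in>nondeg (Suc n). rack_cob ?F z * tuple_contraction (ind z) x) = w x * tuple_contraction (rack_cob ?F) x" by simp
    qed simp
    also have "\<dots> = pair n (\<lambda>x. ?F x - (\<Sum>k\<in>critical_cells CARD('p) False n. Psi ?F k * critical_cocycle k x) - rack_cob (tuple_contraction ?F) x) w"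
      unfolding pair_def
    proof (rule sum.cong)
      fix x :: "'p mod_ring list" assume "x \<in> nondeg n"
      then have x: "length x = n" "x \<noteq> []" using n by (auto simp: nondeg_def)
      from cochain_homotopy[OF x(2) van] x(1)
      show "w x * tuple_contraction (rack_cob ?F) x = w x * (?F x - (\<Sum>k\<in>critical_cells CARD('p) False n. Psi ?F k * critical_cocycle k x) - rack_cob (tuple_contraction ?F) x)"
        by simp
    qed simp
    also have "\<dots> = pair n ?F w - (\<Sum>k\<in>critical_cells CARD('p) False n. Psi ?F k * pair n (critical_cocycle k) w) - pair n (rack_cob (tuple_contraction ?F)) w"
    proof -
      have "(\<Sum>x\<in>nondeg n. w x * (\<Sum>k\<in>critical_cells CARD('p) False n. Psi ?F k * critical_cocycle k x))
        = (\<Sum>k\<in>critical_cells CARD('p) False n. Psi ?F k * (\<Sum>x\<in>nondeg n. w x * critical_cocycle k x))"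
        unfolding sum_distrib_left by (subst sum.swap) (simp add: mult_ac)
      then show ?thesis unfolding pair_def right_diff_distrib sum_subtractf by simp
    qed
    also have "\<dots> = w y"
      using k pair_tuple_boundary[OF vanishing_tuple_contraction, of n "?F" w, symmetric] w(2) pair_ind[OF True, of w]
      by (simp add: pair_def)
    finally show ?thesis .
  next
    case False
    then show ?thesis using w(1) by (simp add: tuple_boundary_def nondeg_functions_def)
  qed
  then show ?thesis by (intro bexI[of _ w']) (auto simp: w'_def nondeg_functions_def)
qed

lemma tuple_boundary_image:
  fixes w :: "'p mod_ring list \<Rightarrow> 'p mod_ring"
  assumes n: "n \<ge> 1"
  shows "pair n (critical_cocycle k) (tuple_boundary (Suc n) w) = 0" and "tuple_boundary n (tuple_boundary (Suc n) w) = (\<lambda>_. 0)"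
proof -
  have "pair n (critical_cocycle k) (tuple_boundary (Suc n) w) = pair (Suc n) (rack_cob (critical_cocycle k)) w"
    using pair_tuple_boundary[OF vanishing_critical_cocycle, of "Suc n"] by simp
  also have "\<dots> = 0"
    unfolding pair_def
  proof (rule sum.neutral, rule ballI)
    fix x :: "'p mod_ring list" assume "x \<in> nondeg (Suc n)"
    then have "x \<noteq> []" by (auto simp: nondeg_def)
    then show "w x * rack_cob (critical_cocycle k) x = 0" by (simp add: rack_cob_critical_cocycle)
  qed
  finally show "pair n (critical_cocycle k) (tuple_boundary (Suc n) w) = 0" .
  show "tuple_boundary n (tuple_boundary (Suc n) w) = (\<lambda>_. 0)"
  proof
    fix y
    show "tuple_boundary n (tuple_boundary (Suc n) w) y = 0"
    proof (cases "y \<in> nondeg (n - 1)")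
      case True
      note van = vanishing_ind[OF True, where 'b = "'p mod_ring"]
      have "tuple_boundary n (tuple_boundary (Suc n) w) y = pair n (rack_cob (ind y)) (tuple_boundary (Suc n) w)"
        using True by (simp add: tuple_boundary_def[of n] pair_def)
      also have "\<dots> = pair (Suc n) (rack_cob (rack_cob (ind y))) w"
        using pair_tuple_boundary[OF vanishing_rack_cob[OF van], of "Suc n"] by simp
      also have "\<dots> = 0" by (simp add: rack_cob_rack_cob[OF van] pair_def)
      finally show ?thesis .
    qed (simp add: tuple_boundary_def)
  qed
qed

text \<open>
  The critical cells themselves, written in the basis of tuples, are cycles dual to the critical cocycles.
\<close>

lemma tuple_boundary_surj:
  fixes G :: "nat list \<Rightarrow> 'p mod_ring"
  assumes n: "n \<ge> 1"
  shows "\<exists>w\<in>nondeg_functions n. tuple_boundary n w = (\<lambda>_. 0) \<and> (\<forall>k\<in>critical_cells CARD('p) False n. pair n (critical_cocycle k) w = G k)"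
proof -
  let ?K = "critical_cells CARD('p) False n"
  define w :: "'p mod_ring list \<Rightarrow> 'p mod_ring" where "w = (\<lambda>x. if x \<in> nondeg n then \<Sum>k\<in>?K. G k * Psi (ind x) k else 0)"
  have pw: "pair n F w = (\<Sum>k\<in>?K. G k * Psi F k)" if "vanishing F" for F
  proof -
    have "pair n F w = (\<Sum>k\<in>?K. G k * (\<Sum>x\<in>nondeg n. F x * Psi (ind x) k))"
      unfolding pair_def w_def sum_distrib_left
      by (subst sum.swap) (simp add: sum_distrib_left mult_ac)
    also have "\<dots> = (\<Sum>k\<in>?K. G k * Psi F k)"
    proof (rule sum.cong)
      fix k assume "k \<in> ?K"
      then have "length k = n" by (simp add: critical_cells_def)
      with functional_expand_nondeg[OF Psi_functional[of k] that]
      show "G k * (\<Sum>x\<in>nondeg n. F x * Psi (ind x) k) = G k * Psi F k" by simp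
    qed simp
    finally show ?thesis .
  qed
  have "tuple_boundary n w = (\<lambda>_. 0)"
  proof
    fix y
    show "tuple_boundary n w y = 0"
    proof (cases "y \<in> nondeg (n - 1)")
      case True
      note van = vanishing_ind[OF True, where 'b = "'p mod_ring"]
      have "tuple_boundary n w y = pair n (rack_cob (ind y)) w" using True by (simp add: tuple_boundary_def pair_def)
      also have "\<dots> = 0" using pw[OF vanishing_rack_cob[OF van]]
        by (simp add: Psi_rack_cob_crit[OF van] critical_cells_def)
      finally show ?thesis .
    qed (simp add: tuple_boundary_def)
  qed
  moreover have "pair n (critical_cocycle k) w = G k" if "k \<in> ?K" for k
    using pw[OF vanishing_critical_cocycle] that finite_critical_cells[OF odd_p p_gt_1]
    by (simp add: Psi_critical_cocycle[OF _ n] ind_def if_distrib[of "\<lambda>x. _ * x"] cong: if_cong)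
  ultimately show ?thesis by (intro bexI[of _ w]) (auto simp: w_def nondeg_functions_def)
qed

end

section \<open>Homology\<close>

lemma lookup_smult: "Poly_Mapping.lookup (Poly_Mapping.map ((*) a) c) x = a * Poly_Mapping.lookup c x"
  for a :: "'k::comm_ring_1"
  by (simp add: Poly_Mapping.map.rep_eq when_def)

lemma keys_smult: "Poly_Mapping.keys (Poly_Mapping.map ((*) a) c) \<subseteq> Poly_Mapping.keys c"
  for a :: "'k::comm_ring_1"
  by (auto simp: in_keys_iff lookup_smult)

lemma module_free_module: "Module.module class_ring (free_module S :: ('k::comm_ring_1, 'b \<Rightarrow>\<^sub>0 'k) module)"
proof (rule moduleI)
  show "cring (class_ring :: 'k ring)" by (rule class_cring.cring_axioms)
  show "abelian_group (free_module S :: ('k, 'b \<Rightarrow>\<^sub>0 'k) module)"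
  proof (rule abelian_groupI)
    fix x :: "'b \<Rightarrow>\<^sub>0 'k" assume "x \<in> carrier (free_module S)"
    then show "\<exists>y\<in>carrier (free_module S). y \<oplus>\<^bsub>free_module S\<^esub> x = \<zero>\<^bsub>free_module S\<^esub>"
      by (intro bexI[of _ "- x"]) (auto simp: free_module_def)
  qed (use keys_add in \<open>force simp: free_module_def add.assoc add.commute\<close>)+
next
  fix a :: 'k and x :: "'b \<Rightarrow>\<^sub>0 'k" assume "x \<in> carrier (free_module S)"
  then show "a \<odot>\<^bsub>free_module S\<^esub> x \<in> carrier (free_module S)"
    using keys_smult[of a x] by (auto simp: free_module_def)
qed (auto simp: free_module_def lookup_smult lookup_add algebra_simps intro!: poly_mapping_eqI)

lemma span_single:
  "LinearCombinations.module.span class_ring (free_module S) ((\<lambda>x. Poly_Mapping.single x 1) ` T)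
    = {c :: 'b \<Rightarrow>\<^sub>0 'k::comm_ring_1. Poly_Mapping.keys c \<subseteq> T}"
  if "T \<subseteq> S"
proof -
  interpret M: Module.module class_ring "free_module S :: ('k, 'b \<Rightarrow>\<^sub>0 'k) module"
    by (rule module_free_module)
  let ?B = "(\<lambda>x. Poly_Mapping.single x 1 :: 'b \<Rightarrow>\<^sub>0 'k) ` T"
  have B: "?B \<subseteq> carrier (free_module S)" using that by (auto simp: free_module_def)
  have sub: "submodule class_ring (M.span ?B) (free_module S)" by (rule M.span_is_submodule[OF B])
  have "submodule class_ring {c :: 'b \<Rightarrow>\<^sub>0 'k. Poly_Mapping.keys c \<subseteq> T} (free_module S)"
  proof (rule submodule.intro)
    fix c :: 'k and v :: "'b \<Rightarrow>\<^sub>0 'k" assume "v \<in> {c. Poly_Mapping.keys c \<subseteq> T}"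
    then show "c \<odot>\<^bsub>free_module S\<^esub> v \<in> {c. Poly_Mapping.keys c \<subseteq> T}"
      using keys_smult[of c v] by (auto simp: free_module_def)
  next
    fix v w :: "'b \<Rightarrow>\<^sub>0 'k" assume "v \<in> {c. Poly_Mapping.keys c \<subseteq> T}" "w \<in> {c. Poly_Mapping.keys c \<subseteq> T}"
    then show "v \<oplus>\<^bsub>free_module S\<^esub> w \<in> {c. Poly_Mapping.keys c \<subseteq> T}"
      using keys_add[of v w] by (auto simp: free_module_def)
  qed (use that module_free_module in \<open>auto simp: free_module_def\<close>)
  then have 1: "M.span ?B \<subseteq> {c. Poly_Mapping.keys c \<subseteq> T}"
    by (intro M.span_is_subset) auto
  have "c \<in> M.span ?B" if "finite K" "K \<subseteq> T" "Poly_Mapping.keys c \<subseteq> K" for c K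
    using that
  proof (induction K arbitrary: c rule: finite_induct)
    case empty
    then have "c = 0" by simp
    moreover have "\<zero>\<^bsub>free_module S\<^esub> \<in> M.span ?B" using sub by (simp add: submodule.zero_closed)
    ultimately show ?case by (simp add: free_module_def)
  next
    case (insert x K)
    let ?s = "Poly_Mapping.single x (Poly_Mapping.lookup c x)"
    have "Poly_Mapping.keys (c - ?s) \<subseteq> K"
      using insert.prems insert.hyps by (auto simp: in_keys_iff lookup_minus lookup_single when_def split: if_splits)
    with insert have d: "c - ?s \<in> M.span ?B" by auto
    have "Poly_Mapping.single x 1 \<in> M.span ?B"
      using M.in_own_span[OF B] insert.prems by blast
    then have "Poly_Mapping.lookup c x \<odot>\<^bsub>free_module S\<^esub> Poly_Mapping.single x 1 \<in> M.span ?B"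
      using sub by (simp add: submodule.smult_closed)
    also have "Poly_Mapping.lookup c x \<odot>\<^bsub>free_module S\<^esub> Poly_Mapping.single x 1 = ?s"
      by (auto simp: free_module_def lookup_smult lookup_single when_def intro!: poly_mapping_eqI)
    finally have "(c - ?s) \<oplus>\<^bsub>free_module S\<^esub> ?s \<in> M.span ?B"
      using d sub by (simp add: submodule.m_closed)
    then show ?case by (simp add: free_module_def)
  qed
  then have "{c. Poly_Mapping.keys c \<subseteq> T} \<subseteq> M.span ?B" by (auto intro: finite_keys)
  with 1 show ?thesis by blast
qed

definition nondeg_part :: "nat \<Rightarrow> ('a list \<Rightarrow>\<^sub>0 'b::zero) \<Rightarrow> 'a list \<Rightarrow> 'b" where
  "nondeg_part n c = (\<lambda>x. if x \<in> nondeg n then Poly_Mapping.lookup c x else 0)"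

text \<open>
  The coset of the degenerate chains whose coefficients at nondegenerate tuples are \<open>w\<close>.
\<close>

definition chain_class :: "nat \<Rightarrow> ('a list \<Rightarrow> 'b::comm_ring_1) \<Rightarrow> ('a list \<Rightarrow>\<^sub>0 'b) set" where
  "chain_class n w = {c \<in> carrier (rack_chains n). nondeg_part n c = w}"

lemma carrier_rack_chains: "carrier (rack_chains n) = {c. Poly_Mapping.keys c \<subseteq> {xs. length xs = n}}"
  by (simp add: rack_chains_def free_module_def)

lemma degenerate_chains_eq:
  "degenerate_chains n = {c :: 'a list \<Rightarrow>\<^sub>0 'b::comm_ring_1. c \<in> carrier (rack_chains n) \<and> nondeg_part n c = (\<lambda>_. 0)}"
proof -
  let ?T = "{xs :: 'a list. length xs = n \<and> repeats xs}"
  have "{Poly_Mapping.single xs (1::'b) |xs. length xs = n \<and> (\<exists>i. Suc i < n \<and> xs ! i = xs ! Suc i)}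
      = (\<lambda>x. Poly_Mapping.single x 1) ` ?T"
    by (auto simp: repeats_def)
  note basis = this
  have "degenerate_chains n = {c :: 'a list \<Rightarrow>\<^sub>0 'b. Poly_Mapping.keys c \<subseteq> ?T}"
    unfolding degenerate_chains_def rack_chains_def basis by (rule span_single) auto
  also have "\<dots> = {c. c \<in> carrier (rack_chains n) \<and> nondeg_part n c = (\<lambda>_. 0)}"
    by (auto simp: carrier_rack_chains nondeg_part_def nondeg_def fun_eq_iff in_keys_iff subset_iff)
  finally show ?thesis .
qed

lemma nondeg_length: "x \<in> nondeg n \<Longrightarrow> length x = n"
  by (simp add: nondeg_def)

lemma nondeg_part_carrier:
  "nondeg_part n ` carrier (rack_chains n) = (nondeg_functions n :: ('a::finite list \<Rightarrow> 'b::comm_ring_1) set)"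
proof (intro equalityI subsetI)
  fix w :: "'a list \<Rightarrow> 'b" assume w: "w \<in> nondeg_functions n"
  let ?c = "\<Sum>x\<in>nondeg n. Poly_Mapping.single x (w x)"
  have l: "Poly_Mapping.lookup ?c y = (if y \<in> nondeg n then w y else 0)" for y
    by (simp add: lookup_sum lookup_single when_def)
  have "nondeg_part n ?c = w" using w by (auto simp: nondeg_part_def l nondeg_functions_def)
  moreover have "?c \<in> carrier (rack_chains n)"
    by (auto simp: carrier_rack_chains in_keys_iff l nondeg_length split: if_splits)
  ultimately show "w \<in> nondeg_part n ` carrier (rack_chains n)" by (metis imageI)
qed (auto simp: nondeg_part_def nondeg_functions_def)

lemma rack_chains_ops:
  "x \<in> carrier (rack_chains n) \<Longrightarrow> y \<in> carrier (rack_chains n) \<Longrightarrow>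
     x \<oplus>\<^bsub>rack_chains n\<^esub> y \<in> carrier (rack_chains n) \<and>
     nondeg_part n (x \<oplus>\<^bsub>rack_chains n\<^esub> y) = (\<lambda>z. nondeg_part n x z + nondeg_part n y z)"
  "x \<in> carrier (rack_chains n) \<Longrightarrow> a \<odot>\<^bsub>rack_chains n\<^esub> x \<in> carrier (rack_chains n) \<and>
     nondeg_part n (a \<odot>\<^bsub>rack_chains n\<^esub> x) = (\<lambda>z. a * nondeg_part n x z)"
  "x \<in> carrier (rack_chains n) \<Longrightarrow> y \<in> carrier (rack_chains n) \<Longrightarrow>
     \<exists>z\<in>carrier (rack_chains n). x = z \<oplus>\<^bsub>rack_chains n\<^esub> y"
proof -
  show "x \<oplus>\<^bsub>rack_chains n\<^esub> y \<in> carrier (rack_chains n) \<and>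
     nondeg_part n (x \<oplus>\<^bsub>rack_chains n\<^esub> y) = (\<lambda>z. nondeg_part n x z + nondeg_part n y z)"
    if "x \<in> carrier (rack_chains n)" "y \<in> carrier (rack_chains n)"
    using that keys_add[of x y] by (auto simp: rack_chains_def free_module_def nondeg_part_def lookup_add fun_eq_iff)
  show "a \<odot>\<^bsub>rack_chains n\<^esub> x \<in> carrier (rack_chains n) \<and>
     nondeg_part n (a \<odot>\<^bsub>rack_chains n\<^esub> x) = (\<lambda>z. a * nondeg_part n x z)" if "x \<in> carrier (rack_chains n)"
    using that keys_smult[of a x] by (auto simp: rack_chains_def free_module_def nondeg_part_def lookup_smult fun_eq_iff)
  show "\<exists>z\<in>carrier (rack_chains n). x = z \<oplus>\<^bsub>rack_chains n\<^esub> y"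
    if "x \<in> carrier (rack_chains n)" "y \<in> carrier (rack_chains n)"
    using that keys_diff[of x y] by (intro bexI[of _ "x - y"]) (auto simp: rack_chains_def free_module_def)
qed

lemma quandle_chains_fibres:
  fixes n :: nat
  defines "Q \<equiv> quandle_chains n :: ('b::comm_ring_1, ('a::finite list \<Rightarrow>\<^sub>0 'b) set) module"
  shows coset_chain_class: "\<And>c :: 'a list \<Rightarrow>\<^sub>0 'b. c \<in> carrier (rack_chains n) \<Longrightarrow>
      degenerate_chains n +>\<^bsub>rack_chains n\<^esub> c = chain_class n (nondeg_part n c)"
    and carrier_quandle_chains: "carrier Q = chain_class n ` nondeg_functions n"
    and zero_quandle_chains: "\<zero>\<^bsub>Q\<^esub> = chain_class n (\<lambda>_. 0)"
    and add_quandle_chains: "\<And>w w'. w \<in> nondeg_functions n \<Longrightarrow> w' \<in> nondeg_functions n \<Longrightarrow>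
      chain_class n w \<oplus>\<^bsub>Q\<^esub> chain_class n w' = chain_class n (\<lambda>z. w z + w' z)"
    and smult_quandle_chains: "\<And>a w. w \<in> nondeg_functions n \<Longrightarrow> a \<odot>\<^bsub>Q\<^esub> chain_class n w = chain_class n (\<lambda>z. a * w z)"
    and inj_chain_class: "inj_on (chain_class n) (nondeg_functions n :: ('a list \<Rightarrow> 'b) set)"
proof -
  note q = quotient_fibres[of "rack_chains n :: ('b, 'a list \<Rightarrow>\<^sub>0 'b) module" "nondeg_part n" "degenerate_chains n",
    OF rack_chains_ops degenerate_chains_eq, folded chain_class_def quandle_chains_def, unfolded nondeg_part_carrier]
  show "degenerate_chains n +>\<^bsub>rack_chains n\<^esub> c = chain_class n (nondeg_part n c)"
    if "c \<in> carrier (rack_chains n)" for c :: "'a list \<Rightarrow>\<^sub>0 'b"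
    by (rule q(1); (assumption | fact that))
  show "carrier Q = chain_class n ` nondeg_functions n" unfolding Q_def by (rule q(2); assumption)
  show "\<zero>\<^bsub>Q\<^esub> = chain_class n (\<lambda>_. 0)" unfolding Q_def by (rule q(3); assumption)
  show "chain_class n w \<oplus>\<^bsub>Q\<^esub> chain_class n w' = chain_class n (\<lambda>z. w z + w' z)" if "w \<in> nondeg_functions n" "w' \<in> nondeg_functions n" for w w'
    unfolding Q_def by (rule q(4); (assumption | fact that))
  show "a \<odot>\<^bsub>Q\<^esub> chain_class n w = chain_class n (\<lambda>z. a * w z)" if "w \<in> nondeg_functions n" for a w
    unfolding Q_def by (rule q(5); (assumption | fact that))
  show "inj_on (chain_class n) (nondeg_functions n :: ('a list \<Rightarrow> 'b) set)" by (rule q(6); assumption)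
qed

lemma nondeg_functions_closed:
  fixes u v :: "'a list \<Rightarrow> 'b::comm_ring_1"
  shows "(\<lambda>_. 0 :: 'b) \<in> nondeg_functions n"
    and "u \<in> nondeg_functions n \<Longrightarrow> v \<in> nondeg_functions n \<Longrightarrow> (\<lambda>x. u x + v x) \<in> nondeg_functions n"
    and "u \<in> nondeg_functions n \<Longrightarrow> (\<lambda>x. a * u x) \<in> nondeg_functions n"
  by (auto simp: nondeg_functions_def)

lemma lookup_rack_boundary:
  fixes c :: "'p::prime_card mod_ring list \<Rightarrow>\<^sub>0 'b::comm_ring_1"
  shows "Poly_Mapping.lookup (rack_boundary dihedral_op c) y
    = (\<Sum>x\<in>Poly_Mapping.keys c. Poly_Mapping.lookup c x * rack_cob (ind y) x)"
  unfolding rack_boundary_def linear_extension_def lookup_sum lookup_smult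
  by (intro sum.cong refl arg_cong2[where f = "(*)"])
    (simp add: lookup_sum lookup_minus lookup_single rack_cob_def face0_face face1_face ind_def when_def
      right_diff_distrib eq_commute[of y] if_distrib[of "\<lambda>x. _ * x"] cong: if_cong)

lemma rack_boundary_chain_class:
  fixes c :: "'p::prime_card mod_ring list \<Rightarrow>\<^sub>0 'b::comm_ring_1"
  assumes c: "c \<in> carrier (rack_chains n)"
  shows "rack_boundary dihedral_op c \<in> carrier (rack_chains (n - 1))"
    and "nondeg_part (n - 1) (rack_boundary dihedral_op c) = tuple_boundary n (nondeg_part n c)"
proof -
  have len: "length x = n" if "x \<in> Poly_Mapping.keys c" for x
    using c that by (auto simp: carrier_rack_chains)
  have z: "rack_cob (ind y :: _ \<Rightarrow> 'b) x = 0" if "length y \<noteq> n - 1" "length x = n" for x y :: "'p mod_ring list"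
    unfolding rack_cob_def by (rule sum.neutral) (use that in \<open>auto simp: ind_def face_def\<close>)
  show "rack_boundary dihedral_op c \<in> carrier (rack_chains (n - 1))"
  proof -
    have "Poly_Mapping.lookup (rack_boundary dihedral_op c) y = 0" if "length y \<noteq> n - 1" for y
      unfolding lookup_rack_boundary by (rule sum.neutral) (use z[OF that] len in auto)
    then show ?thesis by (auto simp: carrier_rack_chains in_keys_iff)
  qed
  show "nondeg_part (n - 1) (rack_boundary dihedral_op c) = tuple_boundary n (nondeg_part n c)"
  proof
    fix y
    show "nondeg_part (n - 1) (rack_boundary dihedral_op c) y = tuple_boundary n (nondeg_part n c) y"
    proof (cases "y \<in> nondeg (n - 1)")
      case True
      note van = vanishing_ind[OF True, where 'b = 'b]
      have "nondeg_part (n - 1) (rack_boundary dihedral_op c) y = Poly_Mapping.lookup (rack_boundary dihedral_op c) y"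
        using True unfolding nondeg_part_def by (rule if_P)
      also have "\<dots> = (\<Sum>x\<in>Poly_Mapping.keys c. Poly_Mapping.lookup c x * rack_cob (ind y) x)"
        by (rule lookup_rack_boundary)
      also have "\<dots> = (\<Sum>x\<in>Poly_Mapping.keys c \<inter> nondeg n. Poly_Mapping.lookup c x * rack_cob (ind y) x)"
        by (rule sum.mono_neutral_right) (use len rack_cob_repeats[OF _ van] in \<open>auto simp: nondeg_def\<close>)
      also have "\<dots> = (\<Sum>x\<in>nondeg n. nondeg_part n c x * rack_cob (ind y) x)"
        by (rule sum.mono_neutral_cong_left) (auto simp: nondeg_part_def in_keys_iff)
      also have "\<dots> = tuple_boundary n (nondeg_part n c) y" using True unfolding tuple_boundary_def by (rule if_P[symmetric])
      finally show ?thesis .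
    qed (simp add: nondeg_part_def tuple_boundary_def)
  qed
qed

lemma quandle_boundary_chain_class:
  fixes w :: "'p::prime_card mod_ring list \<Rightarrow> 'b::comm_ring_1"
  assumes "w \<in> nondeg_functions n"
  shows "quandle_boundary dihedral_op n (chain_class n w) = chain_class (n - 1) (tuple_boundary n w)"
proof -
  have "degenerate_chains (n - 1) +>\<^bsub>rack_chains (n - 1)\<^esub> rack_boundary dihedral_op c = chain_class (n - 1) (tuple_boundary n w)"
    if "c \<in> chain_class n w" for c
  proof -
    from that have "c \<in> carrier (rack_chains n)" "nondeg_part n c = w" by (auto simp: chain_class_def)
    then show ?thesis using coset_chain_class[OF rack_boundary_chain_class(1)] rack_boundary_chain_class(2) by metis
  qed
  moreover have "chain_class n w \<noteq> {}"
    using assms unfolding nondeg_part_carrier[symmetric] by (auto simp: chain_class_def)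
  ultimately show ?thesis by (simp add: quandle_boundary_def)
qed

lemma quandle_cycles_eq:
  "quandle_cycles dihedral_op n = chain_class n ` {w \<in> nondeg_functions n :: ('p::prime_card mod_ring list \<Rightarrow> 'b::comm_ring_1) set. tuple_boundary n w = (\<lambda>_. 0)}"
proof -
  have "chain_class (n - 1) (tuple_boundary n w) = chain_class (n - 1) (\<lambda>_. 0) \<longleftrightarrow> tuple_boundary n w = (\<lambda>_. 0)" for w :: "'p mod_ring list \<Rightarrow> 'b"
    by (rule inj_on_eq_iff[OF inj_chain_class tuple_boundary_nondeg_functions nondeg_functions_closed(1)])
  then show ?thesis
    unfolding quandle_cycles_def carrier_quandle_chains zero_quandle_chains
    using quandle_boundary_chain_class[where 'p = 'p and 'b = 'b] by auto
qed

lemma quandle_boundaries_eq: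
  "quandle_boundaries dihedral_op n = chain_class n ` (tuple_boundary (Suc n) ` (nondeg_functions (Suc n) :: ('p::prime_card mod_ring list \<Rightarrow> 'b::comm_ring_1) set))"
  unfolding quandle_boundaries_def carrier_quandle_chains image_image
  by (rule image_cong) (simp_all add: quandle_boundary_chain_class)

text \<open>
  The coordinates of a homology class are its pairings with the critical cocycles.
\<close>

lemma dim_quandle_homology:
  assumes odd_p: "odd CARD('p::prime_card)" and n: "n \<ge> 1"
  shows "vectorspace.dim class_ring
           (quandle_homology (dihedral_op :: 'p mod_ring \<Rightarrow> 'p mod_ring \<Rightarrow> 'p mod_ring) n
             :: ('p mod_ring, ('p mod_ring list \<Rightarrow>\<^sub>0 'p mod_ring) set set) module)
    = card (critical_cells CARD('p) False n)"
proof -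
  let ?K = "critical_cells CARD('p) False n"
  define U where "U = {w \<in> nondeg_functions n :: ('p mod_ring list \<Rightarrow> 'p mod_ring) set. tuple_boundary n w = (\<lambda>_. 0)}"
  define g where "g = (\<lambda>w k. if k \<in> ?K then pair n (critical_cocycle k) w else 0 :: 'p mod_ring)"
  have tuple_boundary_add: "tuple_boundary n (\<lambda>x. u x + v x) = (\<lambda>y. tuple_boundary n u y + tuple_boundary n v y)" for u v :: "'p mod_ring list \<Rightarrow> 'p mod_ring"
    by (auto simp: tuple_boundary_def fun_eq_iff distrib_right sum.distrib)
  have tuple_boundary_smult: "tuple_boundary n (\<lambda>x. a * u x) = (\<lambda>y. a * tuple_boundary n u y)" for a and u :: "'p mod_ring list \<Rightarrow> 'p mod_ring"
    by (auto simp: tuple_boundary_def fun_eq_iff sum_distrib_left mult_ac)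
  have Usupp: "U \<subseteq> nondeg_functions n" by (auto simp: U_def)
  show ?thesis
    unfolding quandle_homology_def
  proof (rule dim_quotient[where U = U and S = "chain_class n" and g = g])
    show "finite ?K" by (rule finite_critical_cells[OF odd_p p_gt_1[OF odd_p]])
    show "inj_on (chain_class n) U" by (rule inj_on_subset[OF inj_chain_class Usupp])
    show "carrier (quandle_chains n\<lparr>carrier := quandle_cycles dihedral_op n\<rparr>) = chain_class n ` U"
      by (simp add: quandle_cycles_eq U_def)
    show "chain_class n u \<oplus>\<^bsub>quandle_chains n\<lparr>carrier := quandle_cycles dihedral_op n\<rparr>\<^esub> chain_class n v = chain_class n (\<lambda>x. u x + v x)"
      if "u \<in> U" "v \<in> U" for u v
      using that Usupp add_quandle_chains[of u n v] by auto
    show "a \<odot>\<^bsub>quandle_chains n\<lparr>carrier := quandle_cycles dihedral_op n\<rparr>\<^esub> chain_class n u = chain_class n (\<lambda>x. a * u x)"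
      if "u \<in> U" for a u
      using that Usupp smult_quandle_chains[of u n a] by auto
    show "(\<lambda>x. u x + v x) \<in> U" if "u \<in> U" "v \<in> U" for u v
      using that by (simp add: U_def nondeg_functions_closed tuple_boundary_add)
    show "(\<lambda>x. a * u x) \<in> U" if "u \<in> U" for a u
      using that by (simp add: U_def nondeg_functions_closed tuple_boundary_smult)
    show "g (\<lambda>x. u x + v x) = (\<lambda>y. g u y + g v y)" for u v
      by (auto simp: g_def pair_def fun_eq_iff distrib_right sum.distrib)
    show "g (\<lambda>x. a * u x) = (\<lambda>y. a * g u y)" for a u
      by (auto simp: g_def pair_def fun_eq_iff sum_distrib_left mult_ac)
    show "g ` U = {f. \<forall>y. y \<notin> ?K \<longrightarrow> f y = 0}"
    proof (intro equalityI subsetI)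
      fix f :: "nat list \<Rightarrow> 'p mod_ring" assume f: "f \<in> {f. \<forall>y. y \<notin> ?K \<longrightarrow> f y = 0}"
      from tuple_boundary_surj[OF odd_p n, of f] obtain w where w: "w \<in> nondeg_functions n" "tuple_boundary n w = (\<lambda>_. 0)"
        "\<forall>k\<in>?K. pair n (critical_cocycle k) w = f k" by blast
      then have "g w = f" using f by (auto simp: g_def fun_eq_iff)
      with w show "f \<in> g ` U" by (auto simp: U_def)
    qed (auto simp: g_def)
    show "quandle_boundaries dihedral_op n = chain_class n ` {u \<in> U. g u = (\<lambda>y. 0)}"
      unfolding quandle_boundaries_eq
    proof (rule arg_cong[where f = "(`) (chain_class n)"], intro equalityI subsetI)
      fix u :: "'p mod_ring list \<Rightarrow> 'p mod_ring" assume "u \<in> {u \<in> U. g u = (\<lambda>y. 0)}"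
      then have u: "u \<in> nondeg_functions n" "tuple_boundary n u = (\<lambda>_. 0)" "g u = (\<lambda>_. 0)" by (auto simp: U_def)
      have "pair n (critical_cocycle k) u = 0" if "k \<in> ?K" for k
        using fun_cong[OF u(3), of k] that by (simp add: g_def)
      from tuple_boundary_kernel[OF odd_p n u(1,2) this] show "u \<in> tuple_boundary (Suc n) ` nondeg_functions (Suc n)" by blast
    next
      fix u :: "'p mod_ring list \<Rightarrow> 'p mod_ring" assume "u \<in> tuple_boundary (Suc n) ` nondeg_functions (Suc n)"
      then obtain w where "u = tuple_boundary (Suc n) w" by blast
      then show "u \<in> {u \<in> U. g u = (\<lambda>y. 0)}"
        using tuple_boundary_image(1)[OF odd_p n, where w = w] tuple_boundary_image(2)[OF odd_p n, where w = w] tuple_boundary_nondeg_functions[of "Suc n" w] by (auto simp: U_def g_def)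
    qed
  qed
qed


section \<open>Cohomology\<close>

lemma additive_int:
  fixes h :: "int \<Rightarrow> 'k::comm_ring_1"
  assumes "\<And>a b. h (a + b) = h a + h b"
  shows "h a = of_int a * h 1"
proof (induction a rule: int_induct[where k = 0])
  case base
  have "h 0 = 0" using assms[of 0 0] by simp
  then show ?case by simp
next
  case (step1 i)
  then show ?case using assms[of i 1] by (simp add: algebra_simps)
next
  case (step2 i)
  then show ?case using assms[of "i - 1" 1] by (simp add: algebra_simps)
qed

lemma tuple_boundary_of_int: "tuple_boundary n (\<lambda>x. of_int (w x)) = (\<lambda>y. of_int (tuple_boundary n w y) :: 'b::comm_ring_1)"
proof -
  have "of_int (rack_cob (ind y) x) = (rack_cob (ind y) x :: 'b)" for x y :: "'a list"
    by (simp add: rack_cob_def ind_def if_distrib[of of_int] cong: if_cong)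
  then show ?thesis by (auto simp: tuple_boundary_def fun_eq_iff)
qed

text \<open>
  An additive map on integral chain classes is determined by its values on nondegenerate tuples, and these values
  are arbitrary; this is the cochain with values \<open>F\<close>.
\<close>

definition ext_cochain :: "nat \<Rightarrow> ('a::finite list \<Rightarrow> 'k::comm_ring_1) \<Rightarrow> ('a list \<Rightarrow>\<^sub>0 int) set \<Rightarrow> 'k" where
  "ext_cochain n F = (\<lambda>A\<in>carrier (quandle_chains n).
     pair n F (\<lambda>x. of_int (inv_into (nondeg_functions n) (chain_class n) A x)))"

lemma ext_cochain_chain_class:
  assumes "w \<in> nondeg_functions n"
  shows "ext_cochain n F (chain_class n w) = pair n F (\<lambda>x. of_int (w x))"
  using assms inv_into_f_f[OF inj_chain_class assms] by (simp add: ext_cochain_def carrier_quandle_chains)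

lemma extensional_chain_class_eqI:
  fixes \<phi> \<psi> :: "('a::finite list \<Rightarrow>\<^sub>0 int) set \<Rightarrow> 'k"
  assumes "\<phi> \<in> extensional (carrier (quandle_chains n))" "\<psi> \<in> extensional (carrier (quandle_chains n))"
    and "\<And>w. w \<in> nondeg_functions n \<Longrightarrow> \<phi> (chain_class n w) = \<psi> (chain_class n w)"
  shows "\<phi> = \<psi>"
  using assms by (intro extensionalityI[OF assms(1,2)]) (auto simp: carrier_quandle_chains)

lemma ext_cochain_extensional: "ext_cochain n F \<in> extensional (carrier (quandle_chains n))"
  by (simp add: ext_cochain_def)

lemma nondeg_functions_ind: "x \<in> nondeg n \<Longrightarrow> ind x \<in> nondeg_functions n"
  by (auto simp: nondeg_functions_def ind_def)

lemma ext_cochain_ind: "x \<in> nondeg n \<Longrightarrow> ext_cochain n F (chain_class n (ind x)) = F x"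
  unfolding ext_cochain_chain_class[OF nondeg_functions_ind] pair_def
  by (simp add: ind_def if_distrib[of of_int] if_distrib[of "\<lambda>c. c * _"] cong: if_cong)

lemma inj_ext_cochain: "inj_on (ext_cochain n) (nondeg_functions n)"
proof (rule inj_onI)
  fix F F' :: "'a list \<Rightarrow> 'b" assume F: "F \<in> nondeg_functions n" "F' \<in> nondeg_functions n" and eq: "ext_cochain n F = ext_cochain n F'"
  show "F = F'"
  proof
    fix x
    show "F x = F' x"
    proof (cases "x \<in> nondeg n")
      case True
      then show ?thesis using ext_cochain_ind[of x n F] ext_cochain_ind[of x n F'] eq by simp
    qed (use F in \<open>simp add: nondeg_functions_def\<close>)
  qed
qed

lemma carrier_quandle_cochains:
  "carrier (quandle_cochains n) = ext_cochain n ` (nondeg_functions n :: ('a::finite list \<Rightarrow> 'k::comm_ring_1) set)"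
proof (intro equalityI subsetI)
  fix \<phi> :: "('a list \<Rightarrow>\<^sub>0 int) set \<Rightarrow> 'k"
  assume "\<phi> \<in> carrier (quandle_cochains n)"
  then have hom: "\<phi> \<in> hom (add_monoid (quandle_chains n)) (add_monoid class_ring)"
    and ext: "\<phi> \<in> extensional (carrier (quandle_chains n))"
    by (auto simp: quandle_cochains_def Let_def)
  have add: "\<phi> (chain_class n (\<lambda>x. w x + w' x)) = \<phi> (chain_class n w) + \<phi> (chain_class n w')" if "w \<in> nondeg_functions n" "w' \<in> nondeg_functions n" for w w'
  proof -
    have "chain_class n w \<in> carrier (quandle_chains n)" "chain_class n w' \<in> carrier (quandle_chains n)"
      using that by (auto simp: carrier_quandle_chains)
    with hom have "\<phi> (chain_class n w \<oplus>\<^bsub>quandle_chains n\<^esub> chain_class n w') = \<phi> (chain_class n w) + \<phi> (chain_class n w')"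
      by (simp add: hom_def)
    then show ?thesis by (simp add: add_quandle_chains that)
  qed
  have zero: "\<phi> (chain_class n (\<lambda>_. 0)) = 0"
    using add[OF nondeg_functions_closed(1) nondeg_functions_closed(1)] by simp
  have sc: "\<phi> (chain_class n (\<lambda>y. a * ind x y)) = of_int a * \<phi> (chain_class n (ind x))" if "x \<in> nondeg n" for a x
    using additive_int[of "\<lambda>a. \<phi> (chain_class n (\<lambda>y. a * ind x y))" a]
      add[OF nondeg_functions_closed(3)[OF nondeg_functions_ind[OF that]] nondeg_functions_closed(3)[OF nondeg_functions_ind[OF that]]]
    by (simp add: distrib_right)
  have sum: "\<phi> (chain_class n (\<lambda>y. \<Sum>x\<in>T. w x * ind x y)) = (\<Sum>x\<in>T. of_int (w x) * \<phi> (chain_class n (ind x)))"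
    if "finite T" "T \<subseteq> nondeg n" for T w
    using that
  proof (induction T rule: finite_induct)
    case (insert x T)
    have "(\<lambda>y. \<Sum>x\<in>T. w x * ind x y) \<in> nondeg_functions n"
      using insert.prems by (auto simp: nondeg_functions_def ind_def intro!: sum.neutral)
    moreover have "(\<lambda>y. w x * ind x y) \<in> nondeg_functions n"
      using insert.prems by (auto simp: nondeg_functions_def ind_def)
    ultimately show ?case using insert sc[of x "w x"] add by simp
  qed (simp add: zero)
  define F where "F = (\<lambda>x. if x \<in> nondeg n then \<phi> (chain_class n (ind x)) else 0)"
  have "\<phi> = ext_cochain n F"
  proof (rule extensional_chain_class_eqI[OF ext ext_cochain_extensional])
    fix w :: "'a list \<Rightarrow> int" assume w: "w \<in> nondeg_functions n"
    have "w = (\<lambda>y. \<Sum>x\<in>nondeg n. w x * ind x y)"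
      using w by (auto simp: fun_eq_iff ind_def nondeg_functions_def if_distrib[of "\<lambda>c. _ * c"] cong: if_cong)
    then have "\<phi> (chain_class n w) = \<phi> (chain_class n (\<lambda>y. \<Sum>x\<in>nondeg n. w x * ind x y))" by simp
    also have "\<dots> = (\<Sum>x\<in>nondeg n. of_int (w x) * \<phi> (chain_class n (ind x)))"
      by (rule sum) auto
    also have "\<dots> = ext_cochain n F (chain_class n w)"
      by (simp add: ext_cochain_chain_class[OF w] pair_def F_def)
    finally show "\<phi> (chain_class n w) = ext_cochain n F (chain_class n w)" .
  qed
  then show "\<phi> \<in> ext_cochain n ` nondeg_functions n" by (auto simp: F_def nondeg_functions_def)
next
  fix \<phi> :: "('a list \<Rightarrow>\<^sub>0 int) set \<Rightarrow> 'k"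
  assume "\<phi> \<in> ext_cochain n ` nondeg_functions n"
  then obtain F where \<phi>: "\<phi> = ext_cochain n F" by blast
  have "ext_cochain n F (A \<oplus>\<^bsub>quandle_chains n\<^esub> B) = ext_cochain n F A + ext_cochain n F B"
    if "A \<in> carrier (quandle_chains n)" "B \<in> carrier (quandle_chains n)" for A B
  proof -
    from that obtain w w' where "A = chain_class n w" "B = chain_class n w'" "w \<in> nondeg_functions n" "w' \<in> nondeg_functions n"
      unfolding carrier_quandle_chains by blast
    then show ?thesis
      by (simp add: add_quandle_chains ext_cochain_chain_class nondeg_functions_closed pair_def distrib_right sum.distrib)
  qed
  then show "\<phi> \<in> carrier (quandle_cochains n)"
    using ext_cochain_extensional[of n F] unfolding \<phi> by (simp add: quandle_cochains_def Let_def hom_def)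
qed

lemma zero_quandle_cochains: "\<zero>\<^bsub>quandle_cochains n\<^esub> = ext_cochain n (\<lambda>_. 0)"
  by (simp add: quandle_cochains_def ext_cochain_def Let_def pair_def)

lemma add_quandle_cochains:
  "ext_cochain n F \<oplus>\<^bsub>quandle_cochains n\<^esub> ext_cochain n F' = ext_cochain n (\<lambda>x. F x + F' x)"
  by (auto simp: quandle_cochains_def ext_cochain_def Let_def pair_def fun_eq_iff distrib_left sum.distrib restrict_def)

lemma smult_quandle_cochains:
  "a \<odot>\<^bsub>quandle_cochains n\<^esub> ext_cochain n F = ext_cochain n (\<lambda>x. a * F x)"
  by (auto simp: quandle_cochains_def ext_cochain_def Let_def pair_def fun_eq_iff sum_distrib_left mult_ac restrict_def)

definition cut_nondeg :: "nat \<Rightarrow> ('a list \<Rightarrow> 'b::zero) \<Rightarrow> 'a list \<Rightarrow> 'b" where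
  "cut_nondeg n F = (\<lambda>x. if x \<in> nondeg n then F x else 0)"

lemma cut_nondeg_functions: "cut_nondeg n F \<in> nondeg_functions n"
  by (simp add: cut_nondeg_def nondeg_functions_def)

lemma quandle_coboundary_ext:
  fixes F :: "'p::prime_card mod_ring list \<Rightarrow> 'k::comm_ring_1"
  assumes "vanishing F"
  shows "quandle_coboundary dihedral_op n (ext_cochain (n - 1) F) = ext_cochain n (cut_nondeg n (rack_cob F))"
proof (rule extensional_chain_class_eqI[where n = n])
  fix w :: "'p mod_ring list \<Rightarrow> int" assume w: "w \<in> nondeg_functions n"
  have "quandle_coboundary dihedral_op n (ext_cochain (n - 1) F) (chain_class n w)
      = ext_cochain (n - 1) F (quandle_boundary dihedral_op n (chain_class n w))"
    using w by (simp add: quandle_coboundary_def carrier_quandle_chains)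
  also have "\<dots> = pair (n - 1) F (tuple_boundary n (\<lambda>x. of_int (w x)))"
    unfolding quandle_boundary_chain_class[OF w] ext_cochain_chain_class[OF tuple_boundary_nondeg_functions] tuple_boundary_of_int ..
  also have "\<dots> = pair n (rack_cob F) (\<lambda>x. of_int (w x))" by (rule pair_tuple_boundary[OF assms])
  also have "\<dots> = ext_cochain n (cut_nondeg n (rack_cob F)) (chain_class n w)"
    unfolding ext_cochain_chain_class[OF w] pair_def cut_nondeg_def by (rule sum.cong) simp_all
  finally show "quandle_coboundary dihedral_op n (ext_cochain (n - 1) F) (chain_class n w)
      = ext_cochain n (cut_nondeg n (rack_cob F)) (chain_class n w)" .
qed (simp_all add: quandle_coboundary_def ext_cochain_def)

lemma cut_rack_cob_eq_0:
  "vanishing F \<Longrightarrow> cut_nondeg n (rack_cob F) = (\<lambda>_. 0) \<longleftrightarrow> (\<forall>x. length x = n \<longrightarrow> rack_cob F x = 0)"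
  using rack_cob_repeats[of _ F] by (auto simp: cut_nondeg_def nondeg_def fun_eq_iff)

text \<open>
  The coordinates of a cohomology class are its values on the critical cells.
\<close>

lemma dim_quandle_cohomology:
  assumes odd_p: "odd CARD('p::prime_card)" and n: "n \<ge> 1"
  shows "vectorspace.dim class_ring
           (quandle_cohomology (dihedral_op :: 'p mod_ring \<Rightarrow> 'p mod_ring \<Rightarrow> 'p mod_ring) n
             :: ('p mod_ring, (('p mod_ring list \<Rightarrow>\<^sub>0 int) set \<Rightarrow> 'p mod_ring) set) module)
    = card (critical_cells CARD('p) False n)"
proof -
  let ?K = "critical_cells CARD('p) False n"
  define U where "U = {F \<in> nondeg_functions n :: ('p mod_ring list \<Rightarrow> 'p mod_ring) set. \<forall>x. length x = Suc n \<longrightarrow> rack_cob F x = 0}"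
  define g where "g = (\<lambda>F k. if k \<in> ?K then Psi F k else 0 :: 'p mod_ring)"
  have rc_add: "rack_cob (\<lambda>x. F x + F' x) xs = rack_cob F xs + rack_cob F' xs" for F F' :: "'p mod_ring list \<Rightarrow> 'p mod_ring" and xs
    by (simp add: rack_cob_def sum.distrib[symmetric] algebra_simps)
  have Usupp: "U \<subseteq> nondeg_functions n" by (auto simp: U_def)
  have cutE: "rack_cob F x = rack_cob F' x" if "\<And>y. y \<in> nondeg n \<Longrightarrow> F y = F' y" "vanishing F" "vanishing F'" "length x = Suc n"
    for F F' :: "'p mod_ring list \<Rightarrow> 'p mod_ring" and x
  proof (rule rack_cob_cong)
    fix ys :: "'p mod_ring list" assume "length ys + 1 = length x"
    then have "length ys = n" using that(4) by simp
    then show "F ys = F' ys"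
      using that(1)[of ys] that(2,3) by (cases "repeats ys") (auto simp: nondeg_def vanishing_def)
  qed
  have PsiE: "Psi F k = Psi F' k" if "\<And>y. y \<in> nondeg n \<Longrightarrow> F y = F' y" "vanishing F" "vanishing F'" "k \<in> ?K"
    for F F' :: "'p mod_ring list \<Rightarrow> 'p mod_ring" and k
  proof (rule Psi_cong)
    fix xs :: "'p mod_ring list" assume "length xs = length k"
    then have "length xs = n" using that(4) by (simp add: critical_cells_def)
    then show "F xs = F' xs"
      using that(1)[of xs] that(2,3) by (cases "repeats xs") (auto simp: nondeg_def vanishing_def)
  qed
  have van_cut: "vanishing (cut_nondeg n F)" for F :: "'p mod_ring list \<Rightarrow> 'p mod_ring"
    by (rule vanishing_nondeg_functions[OF cut_nondeg_functions])
  show ?thesis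
    unfolding quandle_cohomology_def
  proof (rule dim_quotient[where U = U and S = "ext_cochain n" and g = g])
    show "finite ?K" by (rule finite_critical_cells[OF odd_p p_gt_1[OF odd_p]])
    show "inj_on (ext_cochain n) U" by (rule inj_on_subset[OF inj_ext_cochain Usupp])
    have coc: "quandle_coboundary dihedral_op (Suc n) (ext_cochain n F) = \<zero>\<^bsub>quandle_cochains (Suc n)\<^esub> \<longleftrightarrow> F \<in> U"
      if "F \<in> nondeg_functions n" for F :: "'p mod_ring list \<Rightarrow> 'p mod_ring"
      using quandle_coboundary_ext[OF vanishing_nondeg_functions[OF that], of "Suc n"] that
        inj_on_eq_iff[OF inj_ext_cochain cut_nondeg_functions[of "Suc n" "rack_cob F"] nondeg_functions_closed(1)]
        cut_rack_cob_eq_0[OF vanishing_nondeg_functions[OF that], of "Suc n"]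
      by (simp add: zero_quandle_cochains U_def)
    show "carrier (quandle_cochains n\<lparr>carrier := quandle_cocycles dihedral_op n\<rparr>) = ext_cochain n ` U"
      using coc Usupp by (auto simp: quandle_cocycles_def carrier_quandle_cochains)
    show "ext_cochain n F \<oplus>\<^bsub>quandle_cochains n\<lparr>carrier := quandle_cocycles dihedral_op n\<rparr>\<^esub> ext_cochain n F'
        = ext_cochain n (\<lambda>x. F x + F' x)" for F F'
      using add_quandle_cochains[of n F F'] by simp
    show "a \<odot>\<^bsub>quandle_cochains n\<lparr>carrier := quandle_cocycles dihedral_op n\<rparr>\<^esub> ext_cochain n F
        = ext_cochain n (\<lambda>x. a * F x)" for a F
      using smult_quandle_cochains[of n a F] by simp
    show "(\<lambda>x. u x + v x) \<in> U" if "u \<in> U" "v \<in> U" for u v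
      using that by (simp add: U_def nondeg_functions_closed rc_add)
    show "(\<lambda>x. a * u x) \<in> U" if "u \<in> U" for a u
      using that by (simp add: U_def nondeg_functions_closed rack_cob_mult)
    show "g (\<lambda>x. u x + v x) = (\<lambda>y. g u y + g v y)" for u v
      by (auto simp: g_def fun_eq_iff functional_add_arg[OF Psi_functional])
    show "g (\<lambda>x. a * u x) = (\<lambda>y. a * g u y)" for a u
      by (auto simp: g_def fun_eq_iff functional_mult_arg[OF Psi_functional])
    show "g ` U = {f. \<forall>y. y \<notin> ?K \<longrightarrow> f y = 0}"
    proof (intro equalityI subsetI)
      fix f :: "nat list \<Rightarrow> 'p mod_ring" assume f: "f \<in> {f. \<forall>y. y \<notin> ?K \<longrightarrow> f y = 0}"
      define F where "F = (\<lambda>x. \<Sum>k\<in>?K. f k * critical_cocycle k x)"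
      have van: "vanishing F"
        by (simp add: F_def vanishing_def vanishing_critical_cocycle[unfolded vanishing_def, rule_format])
      have "rack_cob (cut_nondeg n F) x = 0" if "length x = Suc n" for x
      proof -
        have "x \<noteq> []" using that by auto
        have "rack_cob (cut_nondeg n F) x = rack_cob F x"
          by (rule cutE[OF _ van_cut van that]) (simp add: cut_nondeg_def)
        also have "\<dots> = (\<Sum>k\<in>?K. f k * rack_cob (critical_cocycle k) x)"
          unfolding F_def by (rule functional_sum_arg[OF rack_cob_functional])
        finally show ?thesis by (simp add: rack_cob_critical_cocycle[OF odd_p \<open>x \<noteq> []\<close>])
      qed
      then have "cut_nondeg n F \<in> U" by (simp add: U_def cut_nondeg_functions)
      moreover have "g (cut_nondeg n F) = f"
      proof
        fix k
        show "g (cut_nondeg n F) k = f k"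
        proof (cases "k \<in> ?K")
          case True
          have "Psi (cut_nondeg n F) k = Psi F k" by (rule PsiE[OF _ van_cut van True]) (simp add: cut_nondeg_def)
          also have "\<dots> = (\<Sum>k'\<in>?K. f k' * Psi (critical_cocycle k') k)"
            unfolding F_def by (rule functional_sum_arg[OF Psi_functional])
          also have "\<dots> = f k"
            using True finite_critical_cells[OF odd_p p_gt_1[OF odd_p], of False n]
            by (simp add: Psi_critical_cocycle[OF odd_p True n] ind_def if_distrib[of "\<lambda>x. _ * x"] cong: if_cong)
          finally show ?thesis using True by (simp add: g_def)
        qed (use f in \<open>simp add: g_def\<close>)
      qed
      ultimately show "f \<in> g ` U" by blast
    qed (auto simp: g_def)
    have "quandle_coboundaries dihedral_op n = ext_cochain n ` ((\<lambda>F. cut_nondeg n (rack_cob F)) ` (nondeg_functions (n - 1) :: ('p mod_ring list \<Rightarrow> 'p mod_ring) set))"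
      unfolding quandle_coboundaries_def carrier_quandle_cochains image_image
      by (rule image_cong[OF refl]) (rule quandle_coboundary_ext[OF vanishing_nondeg_functions])
    also have "(\<lambda>F. cut_nondeg n (rack_cob F)) ` nondeg_functions (n - 1) = {u \<in> U. g u = (\<lambda>y. 0)}"
    proof (intro equalityI subsetI)
      fix u :: "'p mod_ring list \<Rightarrow> 'p mod_ring" assume "u \<in> (\<lambda>F. cut_nondeg n (rack_cob F)) ` nondeg_functions (n - 1)"
      then obtain F where F: "F \<in> nondeg_functions (n - 1)" "u = cut_nondeg n (rack_cob F)" by blast
      note van = vanishing_nondeg_functions[OF F(1)]
      have "rack_cob u x = 0" if "length x = Suc n" for x
        using cutE[of u "rack_cob F" x] rack_cob_rack_cob[OF odd_p van, of x] van_cut vanishing_rack_cob[OF van] that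
        by (simp add: F(2) cut_nondeg_def)
      moreover have "Psi u k = 0" if "k \<in> ?K" for k
        using PsiE[of u "rack_cob F" k] Psi_rack_cob_crit[OF odd_p van, of k] van_cut vanishing_rack_cob[OF van] that
        by (simp add: F(2) cut_nondeg_def critical_cells_def)
      ultimately show "u \<in> {u \<in> U. g u = (\<lambda>y. 0)}"
        using cut_nondeg_functions F(2) by (auto simp: U_def g_def)
    next
      fix u :: "'p mod_ring list \<Rightarrow> 'p mod_ring" assume "u \<in> {u \<in> U. g u = (\<lambda>y. 0)}"
      then have u: "u \<in> nondeg_functions n" "\<And>x. length x = Suc n \<Longrightarrow> rack_cob u x = 0" "g u = (\<lambda>_. 0)" by (auto simp: U_def)
      have g0: "Psi u k = 0" if "k \<in> ?K" for k
        using fun_cong[OF u(3), of k] that by (simp add: g_def)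
      have "u x = rack_cob (cut_nondeg (n - 1) (tuple_contraction u)) x" if "x \<in> nondeg n" for x
      proof -
        have x: "length x = n" "x \<noteq> []" using that n by (auto simp: nondeg_def)
        have "tuple_contraction (rack_cob u) x = tuple_contraction (\<lambda>_. 0) x"
          by (rule functional_cong[OF tuple_contraction_functional[OF odd_p]]) (use u(2) x in auto)
        also have "\<dots> = 0" by (rule functional_zero_arg[OF tuple_contraction_functional[OF odd_p]])
        finally have "u x = rack_cob (tuple_contraction u) x"
          using cochain_homotopy[OF odd_p x(2) vanishing_nondeg_functions[OF u(1)]] x(1) g0 by simp
        also have "\<dots> = rack_cob (cut_nondeg (n - 1) (tuple_contraction u)) x"
          by (rule rack_cob_cong) (use x vanishing_tuple_contraction[of u] in \<open>auto simp: cut_nondeg_def nondeg_def vanishing_def\<close>)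
        finally show ?thesis .
      qed
      then have "u = cut_nondeg n (rack_cob (cut_nondeg (n - 1) (tuple_contraction u)))"
        using u(1) by (auto simp: cut_nondeg_def[of n] nondeg_functions_def fun_eq_iff)
      then show "u \<in> (\<lambda>F. cut_nondeg n (rack_cob F)) ` nondeg_functions (n - 1)" using cut_nondeg_functions by blast
    qed
    finally show "quandle_coboundaries dihedral_op n = ext_cochain n ` {u \<in> U. g u = (\<lambda>y. 0)}" .
  qed
qed

section \<open>Counting critical cells\<close>

lemma critical_cells_base:
  "critical_cells p False 0 = {[]}" "critical_cells p False (Suc 0) = {[0]}" "critical_cells p True 0 = {}" "critical_cells p True (Suc 0) = {[1]}"
  by (auto simp: critical_cells_def length_Suc_conv)

lemma critical_cells_step:
  "critical_cells p False (Suc (Suc n)) = (\<lambda>r. 1 # (p - 1) # r) ` critical_cells p True n"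
  "critical_cells p True (Suc (Suc n)) = (#) 1 ` critical_cells p False (Suc n) \<union> (\<lambda>r. 2 # (p - 2) # r) ` critical_cells p False n
     \<union> (\<lambda>r. 2 # (p - 1) # r) ` critical_cells p True n"
  by (auto simp: critical_cells_def length_Suc_conv)

lemma card_critical_cells_step:
  assumes "odd p" "1 < p"
  shows "card (critical_cells p False (Suc (Suc n))) = card (critical_cells p True n)"
    and "card (critical_cells p True (Suc (Suc n)))
      = card (critical_cells p False (Suc n)) + card (critical_cells p False n) + card (critical_cells p True n)"
proof -
  note fin = finite_critical_cells[OF assms]
  show "card (critical_cells p False (Suc (Suc n))) = card (critical_cells p True n)"
    unfolding critical_cells_step by (rule card_image) (auto intro: inj_onI)
  have "p - 2 \<noteq> p - 1" using assms(2) by arith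
  then have "card (critical_cells p True (Suc (Suc n))) = card ((#) 1 ` critical_cells p False (Suc n))
      + card ((\<lambda>r. 2 # (p - 2) # r) ` critical_cells p False n) + card ((\<lambda>r. 2 # (p - 1) # r) ` critical_cells p True n)"
    unfolding critical_cells_step by (subst card_Un_disjoint; (simp add: fin)?; fastforce?)+
  then show "card (critical_cells p True (Suc (Suc n)))
      = card (critical_cells p False (Suc n)) + card (critical_cells p False n) + card (critical_cells p True n)"
    by (simp add: card_image inj_on_def)
qed

text \<open>
  The counted sequences in reverse order, where the unrestricted entry comes last. The weight of an entry is the length
  of a block of a critical cell, so that \<open>(0, 0)\<close> corresponds to the final \<open>0\<close>.
\<close>

fun rseq :: "(nat \<times> nat) list \<Rightarrow> bool" where
  "rseq [] = True"
| "rseq (x # r) = (snd x \<in> {0, 1} \<and> (x \<noteq> (0, 0) \<or> r = []) \<and> rseq r)"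

definition weight :: "(nat \<times> nat) list \<Rightarrow> nat" where
  "weight l = (\<Sum>(m, e)\<leftarrow>l. 1 + 2 * m + 3 * e)"

definition rseqs :: "nat \<Rightarrow> (nat \<times> nat) list set" where
  "rseqs n = {l. rseq l \<and> weight l = n}"

lemma weight_simps [simp]: "weight [] = 0" "weight ((m, e) # r) = Suc (2 * m + 3 * e + weight r)"
  by (simp_all add: weight_def)

lemma weight_0 [simp]: "weight l = 0 \<longleftrightarrow> l = []"
  by (cases l) auto

lemma rseq_alt: "rseq l \<longleftrightarrow> (\<forall>(m, e)\<in>set l. e \<in> {0, 1}) \<and> (\<forall>x\<in>set (butlast l). x \<noteq> (0, 0))"
  by (induction l) (auto simp: case_prod_beta)

lemma weight_alt: "weight l = length l + (\<Sum>(m, e)\<leftarrow>l. 2 * m + 3 * e)"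
  by (induction l) auto

lemma weight_rev [simp]: "weight (rev l) = weight l"
  by (simp add: weight_def rev_map[symmetric] del: One_nat_def)

lemma dihedral_sequences_eq:
  assumes "n \<ge> 1"
  shows "dihedral_sequences n = rev ` rseqs n"
proof -
  have tl: "(\<forall>i. 1 \<le> i \<and> i < length l \<longrightarrow> l ! i \<noteq> (0, 0)) \<longleftrightarrow> (\<forall>x\<in>set (tl l). x \<noteq> (0, 0))"
    for l :: "(nat \<times> nat) list"
  proof (cases l)
    case (Cons a r)
    have "(\<forall>i. 1 \<le> i \<and> i < length l \<longrightarrow> l ! i \<noteq> (0, 0)) \<longleftrightarrow> (\<forall>j. j < length r \<longrightarrow> r ! j \<noteq> (0, 0))"
    proof (intro iffI allI impI)
      fix j assume *: "\<forall>i. 1 \<le> i \<and> i < length l \<longrightarrow> l ! i \<noteq> (0, 0)" "j < length r"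
      then show "r ! j \<noteq> (0, 0)" using *(1)[rule_format, of "Suc j"] Cons by simp
    next
      fix i assume *: "\<forall>j. j < length r \<longrightarrow> r ! j \<noteq> (0, 0)" "1 \<le> i \<and> i < length l"
      then show "l ! i \<noteq> (0, 0)" using *(1)[rule_format, of "i - 1"] Cons by (cases i) auto
    qed
    then show ?thesis using Cons by (simp add: all_set_conv_all_nth)
  qed simp
  have "l \<in> dihedral_sequences n \<longleftrightarrow> rev l \<in> rseqs n" for l
  proof -
    have "1 \<le> length l \<and> length l - 1 + (\<Sum>(m, e)\<leftarrow>l. 2 * m + 3 * e) = n - 1 \<longleftrightarrow> weight l = n"
      using assms unfolding weight_alt by (cases l) auto
    then show ?thesis
      unfolding dihedral_sequences_def rseqs_def mem_Collect_eq rseq_alt tl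
      by (auto simp: butlast_rev)
  qed
  then show ?thesis by (metis (no_types, lifting) image_iff rev_rev_ident subsetI subset_antisym)
qed

lemma rseqs_base: "rseqs 0 = {[]}" "rseqs (Suc 0) = {[(0, 0)]}" "rseqs 2 = {}" "rseqs 3 = (#) (1, 0) ` rseqs 0"
proof -
  show r0: "rseqs 0 = {[]}" by (auto simp: rseqs_def)
  have "l = [(0, 0)]" if "rseq l" "weight l = Suc 0" for l
    using that by (cases l) auto
  then show "rseqs (Suc 0) = {[(0, 0)]}" by (auto simp: rseqs_def)
  have "False" if "rseq l" "weight l = 2" for l
    using that by (cases l) (auto, presburger)
  then show "rseqs 2 = {}" by (auto simp: rseqs_def)
  have "l = [(1, 0)]" if "rseq l" "weight l = 3" for l
  proof -
    from that obtain m e r where r: "l = (m, e) # r" by (cases l) auto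
    with that have "2 * m + 3 * e + weight r = 2" "(m, e) \<noteq> (0, 0) \<or> r = []" by auto
    then have "m = 1 \<and> e = 0 \<and> weight r = 0" by (cases m; cases e) auto
    with r show ?thesis by simp
  qed
  then have "rseqs 3 = {[(1, 0)]}" by (auto simp: rseqs_def)
  then show "rseqs 3 = (#) (1, 0) ` rseqs 0" by (simp add: r0)
qed

fun bump :: "(nat \<times> nat) list \<Rightarrow> (nat \<times> nat) list" where
  "bump [] = []"
| "bump ((m, e) # r) = (Suc m, e) # r"

text \<open>
  The three sets mirror the three prefixes of critical cells at an odd position: \<open>1\<close> ends a block of odd length,
  \<open>2, p - 2\<close> one of even length, and \<open>2, p - 1\<close> lengthens a block by two. Weight at least \<open>2\<close> excludes
  the list \<open>[(0, 0)]\<close>.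
\<close>

lemma rseqs_step: "rseqs (n + 4) = (#) (1, 0) ` rseqs (n + 1) \<union> (#) (0, 1) ` rseqs n \<union> bump ` rseqs (n + 2)"
proof (intro equalityI subsetI)
  fix l assume "l \<in> rseqs (n + 4)"
  then have l: "rseq l" "weight l = n + 4" by (auto simp: rseqs_def)
  then obtain m e r where r: "l = (m, e) # r" by (cases l) auto
  with l have e: "e = 0 \<or> e = 1" "rseq r" "(m, e) \<noteq> (0, 0) \<or> r = []" by auto
  consider "m = 0" "e = 1" | "m = 1" "e = 0" | m' where "m = Suc m'" "(m', e) \<noteq> (0, 0)"
    using e l(2) r by (cases m) auto
  then show "l \<in> (#) (1, 0) ` rseqs (n + 1) \<union> (#) (0, 1) ` rseqs n \<union> bump ` rseqs (n + 2)"
  proof cases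
    case 1
    with r e l show ?thesis by (auto simp: rseqs_def)
  next
    case 2
    with r e l show ?thesis by (auto simp: rseqs_def)
  next
    case (3 m')
    then have "l = bump ((m', e) # r)" "(m', e) # r \<in> rseqs (n + 2)"
      using r e l by (auto simp: rseqs_def)
    then show ?thesis by blast
  qed
next
  fix l assume "l \<in> (#) (1, 0) ` rseqs (n + 1) \<union> (#) (0, 1) ` rseqs n \<union> bump ` rseqs (n + 2)"
  then show "l \<in> rseqs (n + 4)"
  proof (elim UnE imageE)
    fix r assume "l = bump r" "r \<in> rseqs (n + 2)"
    then show "l \<in> rseqs (n + 4)" by (cases r) (auto simp: rseqs_def)
  qed (auto simp: rseqs_def)
qed

lemma bump_nonzero: "l \<in> rseqs (n + 2) \<Longrightarrow> \<exists>m e r. l = (m, e) # r \<and> (m, e) \<noteq> (0, 0)"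
  by (cases l) (auto simp: rseqs_def)

lemma card_rseqs_step:
  assumes "finite (rseqs (n + 2))" "finite (rseqs (n + 1))" "finite (rseqs n)"
  shows "finite (rseqs (n + 4))"
    and "card (rseqs (n + 4)) = card (rseqs (n + 1)) + card (rseqs n) + card (rseqs (n + 2))"
proof -
  show "finite (rseqs (n + 4))" unfolding rseqs_step using assms by simp
  have "inj_on bump (rseqs (n + 2))"
  proof (rule inj_onI)
    fix x y assume "bump x = bump y"
    then show "x = y" by (cases x rule: bump.cases; cases y rule: bump.cases) auto
  qed
  then have 1: "card (bump ` rseqs (n + 2)) = card (rseqs (n + 2))" by (rule card_image)
  have d1: "(#) (1, 0) ` rseqs (n + 1) \<inter> (#) (0, 1) ` rseqs n = {}" by auto
  have "\<exists>m e r. x = (Suc m, e) # r \<and> (m, e) \<noteq> (0, 0)" if "x \<in> bump ` rseqs (n + 2)" for x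
  proof -
    from that obtain l where "x = bump l" "l \<in> rseqs (n + 2)" by blast
    with bump_nonzero[of l n] show ?thesis by auto
  qed
  then have d2: "((#) (1, 0) ` rseqs (n + 1) \<union> (#) (0, 1) ` rseqs n) \<inter> bump ` rseqs (n + 2) = {}"
    by fastforce
  show "card (rseqs (n + 4)) = card (rseqs (n + 1)) + card (rseqs n) + card (rseqs (n + 2))"
    unfolding rseqs_step using assms d1 d2 1
    by (simp add: card_Un_disjoint card_image)
qed

lemma card_rseqs_critical_cells:
  assumes "odd p" "1 < p"
  shows "finite (rseqs n) \<and> card (rseqs n) = card (critical_cells p False n)"
proof (induction n rule: less_induct)
  case (less n)
  consider "n = 0" | "n = 1" | "n = 2" | "n = 3" | k where "n = k + 4"
  proof -
    have "n < 4 \<or> n = (n - 4) + 4" by arith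
    then show ?thesis using that by (cases "n < 4") (auto simp: numeral_eq_Suc less_Suc_eq)
  qed
  then show ?case
  proof cases
    case 1
    then show ?thesis by (simp add: rseqs_base critical_cells_base)
  next
    case 2
    then show ?thesis by (simp add: rseqs_base critical_cells_base)
  next
    case 3
    then show ?thesis using card_critical_cells_step(1)[OF assms, of 0] by (simp add: rseqs_base critical_cells_base numeral_2_eq_2[symmetric])
  next
    case 4
    then show ?thesis using card_critical_cells_step(1)[OF assms, of 1] by (simp add: rseqs_base critical_cells_base numeral_3_eq_3[symmetric] card_image)
  next
    case (5 k)
    have IH: "finite (rseqs (k + i)) \<and> card (rseqs (k + i)) = card (critical_cells p False (k + i))" if "i < 4" for i
      using less[of "k + i"] 5 that by simp
    note s = card_rseqs_step[of k] IH[of 0] IH[of 1] IH[of 2]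
    have "card (critical_cells p False (k + 4)) = card (critical_cells p True (Suc (Suc k)))"
      using card_critical_cells_step(1)[OF assms, of "Suc (Suc k)"] by (simp add: numeral_eq_Suc)
    also have "\<dots> = card (critical_cells p False (k + 1)) + card (critical_cells p False k) + card (critical_cells p False (k + 2))"
      using card_critical_cells_step[OF assms, of k] by simp
    finally show ?thesis using s 5 by simp
  qed
qed

lemma card_dihedral_sequences:
  assumes "odd p" "1 < p" "n \<ge> 1"
  shows "card (dihedral_sequences n) = card (critical_cells p False n)"
  using card_rseqs_critical_cells[OF assms(1,2), of n] card_image[of rev "rseqs n"]
  by (simp add: dihedral_sequences_eq[OF assms(3)] inj_on_def)

theorem mainTheorem5:
  fixes n :: nat
  assumes "odd CARD('p::prime_card)" and "n \<ge> 1"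
  shows "vectorspace.dim class_ring
           (quandle_homology (dihedral_op :: 'p mod_ring \<Rightarrow> 'p mod_ring \<Rightarrow> 'p mod_ring) n
             :: ('p mod_ring, ('p mod_ring list \<Rightarrow>\<^sub>0 'p mod_ring) set set) module)
         = card (dihedral_sequences n)
       \<and> vectorspace.dim class_ring
           (quandle_cohomology (dihedral_op :: 'p mod_ring \<Rightarrow> 'p mod_ring \<Rightarrow> 'p mod_ring) n
             :: ('p mod_ring, (('p mod_ring list \<Rightarrow>\<^sub>0 int) set \<Rightarrow> 'p mod_ring) set) module)
         = card (dihedral_sequences n)"
proof -
  note p = prime_gt_1_nat[OF prime_card[where 'a = 'p]]
  show ?thesis
    unfolding dim_quandle_homology[OF assms] dim_quandle_cohomology[OF assms]
      card_dihedral_sequences[OF assms(1) p assms(2)] by simp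
qed

end
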